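(* Let $(X_t)_{t\ge0}$ solve $dX_t=b(t,X_t)\,dt+\sigma(t,X_t)\,dW_t$ on $\mathbb{R}^d$ under the standing assumptions of the context. Assume that there are $\alpha>0$, $\beta>0$, $\theta>0$ such that for all $x\in\mathbb{R}^d$ and $t\ge0$ $$\langle x,b(t,x)\rangle\le\alpha\|x\|-\beta\|x\|^2\qquad\text{and}\qquad\sigma(t,x)\,\sigma(t,x)^{\intercal}\le\theta\,I_d,$$ where the second inequality is in the order induced by positive definite matrices. Then, for every initial probability measure $\mu_0$ on $\mathbb{R}^d$ satisfying $\mathrm{GCBS}(D_0)$ with $D_0>0$, the law $\mu_t$ of $X_t$ satisfies $\mathrm{GCB}(D_t)$ for all $t\ge0$, where $$D_t=\frac{b_t^2\,e}{2a_0\sqrt{\pi}},\qquad a_0=\min\left\{\frac{\beta}{2\theta},\frac1{16D_0}\right\},$$ $$b_t=b_0\exp\left(-a_0\left(\theta d+\frac{2\alpha^2}{\beta}\right)t\right)+2\,e^{\frac{4a_0}{\beta}\left(\theta d+\frac{2\alpha^2}{\beta}\right)}\left(1-\exp\left(-a_0\left(\theta d+\frac{2\alpha^2}{\beta}\right)t\right)\right),$$ and $$b_0=3\exp\left(\frac{\left(\int\|x\|\,d\mu_0(x)\right)^2}{8D_0}\right).$$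
   Context: $W$ is a standard $d$-dimensional Brownian motion independent of $X_0$; $b,\sigma$ are continuous on $\mathbb{R}_+\times\mathbb{R}^d$; $d$ is the dimension and $e$ Euler's number. Standing hypotheses: (A) For any $T>0$, $R>0$ there is $C_{T,R}>0$ such that for $0\le t\le T$, $\|x\|,\|y\|\le R$: $\|b(t,x)-b(t,y)\|+\|\sigma(t,x)-\sigma(t,y)\|\le C_{T,R}\|x-y\|$ (Euclidean norm on vectors, Hilbert-Schmidt norm on matrices). (B) There exist nonnegative continuous functions $\hat\alpha,\hat\beta$ on $\mathbb{R}_+$, with $\hat\beta$ monotone increasing and concave and $\int_0^\infty\frac{du}{1+\hat\beta(u)}=\infty$, such that $2\langle x,b(t,x)\rangle+\|\sigma(t,x)\|^2\le\hat\alpha(t)\hat\beta(\|x\|^2)$ for all $t,x$. With $\mathrm{lip}(f)$ the Lipschitz constant for the Euclidean norm and $\mu(f)=\int f\,d\mu$: $\mathrm{GCBS}(D)$ means $\log\mu(e^{f-\mu(f)})\le D\,\mathrm{lip}(f)^2$ for all $\mathcal{C}^\infty$ compactly supported $f:\mathbb{R}^d\to\mathbb{R}$; $\mathrm{GCB}(D)$ means the same inequality for all Lipschitz $f:\mathbb{R}^d\to\mathbb{R}$ (which are in particular $\mu$-integrable). *)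

theory Defs
  imports "HOL-Probability.Probability"
begin

section \<open>Gaussian concentration bounds\<close>

primrec times_cont_diff :: "nat \<Rightarrow> (real^'n \<Rightarrow> real) \<Rightarrow> bool" where
  "times_cont_diff 0 f \<longleftrightarrow> continuous_on UNIV f"
| "times_cont_diff (Suc k) f \<longleftrightarrow>
     (\<exists>g. (\<forall>x. (f has_derivative (\<lambda>h. \<Sum>i\<in>UNIV. g i x * h $ i)) (at x)) \<and>
          (\<forall>i. times_cont_diff k (g i)))"

definition smooth_compact_support :: "(real^'n \<Rightarrow> real) \<Rightarrow> bool" where
  "smooth_compact_support f \<longleftrightarrow>
     (\<forall>k. times_cont_diff k f) \<and> compact (closure {x. f x \<noteq> 0})"

text \<open>The supremum is only meaningful for Lipschitz functions, and is only used for them.\<close>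

definition lip :: "(real^'n \<Rightarrow> real) \<Rightarrow> real" where
  "lip f = (SUP (x, y) \<in> {(x, y). x \<noteq> y}. \<bar>f x - f y\<bar> / norm (x - y))"

text \<open>Bochner integrals of non-integrable functions are \<open>0\<close>, so the finiteness of both
  integrals in \<open>log \<mu>(exp (f - \<mu>(f)))\<close> has to be stated. For bounded \<open>f\<close> and a probability
  measure \<open>\<mu>\<close> it is automatic.\<close>

definition exp_moment_bound :: "(real^'n) measure \<Rightarrow> real \<Rightarrow> (real^'n \<Rightarrow> real) \<Rightarrow> bool" where
  "exp_moment_bound \<mu> D f \<longleftrightarrow>
     integrable \<mu> f \<and>
     integrable \<mu> (\<lambda>x. exp (f x - (\<integral>y. f y \<partial>\<mu>))) \<and>
     ln (\<integral>x. exp (f x - (\<integral>y. f y \<partial>\<mu>)) \<partial>\<mu>) \<le> D * (lip f)\<^sup>2"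

definition GCBS :: "(real^'n) measure \<Rightarrow> real \<Rightarrow> bool" where
  "GCBS \<mu> D \<longleftrightarrow> (\<forall>f. smooth_compact_support f \<longrightarrow> exp_moment_bound \<mu> D f)"

definition GCB :: "(real^'n) measure \<Rightarrow> real \<Rightarrow> bool" where
  "GCB \<mu> D \<longleftrightarrow> (\<forall>f. (\<exists>L. L-lipschitz_on UNIV f) \<longrightarrow> exp_moment_bound \<mu> D f)"

section \<open>Brownian motion and the It\^o integral\<close>

text \<open>Processes and filtrations are indexed by \<open>real\<close>; only the times \<open>t \<ge> 0\<close> matter.\<close>

definition filtration_on :: "'w measure \<Rightarrow> (real \<Rightarrow> 'w measure) \<Rightarrow> bool" where
  "filtration_on M F \<longleftrightarrow>
     (\<forall>t\<ge>0. subalgebra M (F t)) \<and> (\<forall>s\<ge>0. \<forall>t\<ge>s. subalgebra (F t) (F s))"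

definition adapted :: "(real \<Rightarrow> 'w measure) \<Rightarrow> (real \<Rightarrow> 'w \<Rightarrow> 'b::topological_space) \<Rightarrow> bool" where
  "adapted F Y \<longleftrightarrow> (\<forall>t\<ge>0. Y t \<in> borel_measurable (F t))"

definition continuous_paths :: "'w measure \<Rightarrow> (real \<Rightarrow> 'w \<Rightarrow> 'b::topological_space) \<Rightarrow> bool" where
  "continuous_paths M Y \<longleftrightarrow> (\<forall>\<omega>\<in>space M. continuous_on {0..} (\<lambda>t. Y t \<omega>))"

text \<open>A standard Brownian motion relative to a filtration. The density is that of the
  centred Gaussian law with covariance \<open>(t - s) I\<close>.\<close>

definition brownian_motion ::
  "'w measure \<Rightarrow> (real \<Rightarrow> 'w measure) \<Rightarrow> (real \<Rightarrow> 'w \<Rightarrow> real^'n) \<Rightarrow> bool" where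
  "brownian_motion M F W \<longleftrightarrow>
     adapted F W \<and> continuous_paths M W \<and> (AE \<omega> in M. W 0 \<omega> = 0) \<and>
     (\<forall>s\<ge>0. \<forall>t>s.
        distributed M lborel (\<lambda>\<omega>. W t \<omega> - W s \<omega>)
          (\<lambda>x. ennreal (\<Prod>i\<in>UNIV. normal_density 0 (sqrt (t - s)) (x $ i))) \<and>
        prob_space.indep_set M (sets (F s))
          (sets (vimage_algebra (space M) (\<lambda>\<omega>. W t \<omega> - W s \<omega>) borel)))"

definition progressive ::
  "(real \<Rightarrow> 'w measure) \<Rightarrow> (real \<Rightarrow> 'w \<Rightarrow> 'b::topological_space) \<Rightarrow> bool" where
  "progressive F H \<longleftrightarrow>
     (\<forall>t\<ge>0. (\<lambda>(s, \<omega>). H s \<omega>) \<in> borel_measurable (restrict_space borel {0..t} \<Otimes>\<^sub>M F t))"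

text \<open>The simple process \<open>\<Sum>i<N. \<xi> i * 1 {p i<..p (i + 1)}\<close> is represented by \<open>N\<close>, \<open>p\<close>, \<open>\<xi>\<close>.\<close>

definition simple_data ::
  "'w measure \<Rightarrow> (real \<Rightarrow> 'w measure) \<Rightarrow> nat \<Rightarrow> (nat \<Rightarrow> real) \<Rightarrow> (nat \<Rightarrow> 'w \<Rightarrow> real^'n^'m) \<Rightarrow> bool"
where
  "simple_data M F N p \<xi> \<longleftrightarrow>
     0 \<le> p 0 \<and> (\<forall>i<N. p i \<le> p (Suc i)) \<and>
     (\<forall>i<N. \<xi> i \<in> borel_measurable (F (p i)) \<and> (\<exists>K. \<forall>\<omega>\<in>space M. norm (\<xi> i \<omega>) \<le> K))"

definition simple_process ::
  "nat \<Rightarrow> (nat \<Rightarrow> real) \<Rightarrow> (nat \<Rightarrow> 'w \<Rightarrow> real^'n^'m) \<Rightarrow> real \<Rightarrow> 'w \<Rightarrow> real^'n^'m" where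
  "simple_process N p \<xi> s \<omega> = (\<Sum>i<N. indicator {p i<..p (Suc i)} s *\<^sub>R \<xi> i \<omega>)"

definition simple_integral ::
  "(real \<Rightarrow> 'w \<Rightarrow> real^'n) \<Rightarrow> nat \<Rightarrow> (nat \<Rightarrow> real) \<Rightarrow> (nat \<Rightarrow> 'w \<Rightarrow> real^'n^'m) \<Rightarrow>
    real \<Rightarrow> 'w \<Rightarrow> real^'m" where
  "simple_integral W N p \<xi> t \<omega> =
     (\<Sum>i<N. \<xi> i \<omega> *v (W (min t (p (Suc i))) \<omega> - W (min t (p i)) \<omega>))"

definition tendsto_in_prob ::
  "'w measure \<Rightarrow> (nat \<Rightarrow> 'w \<Rightarrow> 'b::metric_space) \<Rightarrow> ('w \<Rightarrow> 'b) \<Rightarrow> bool" where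
  "tendsto_in_prob M Y Z \<longleftrightarrow>
     (\<forall>k. Y k \<in> borel_measurable M) \<and> Z \<in> borel_measurable M \<and>
     (\<forall>\<epsilon>>0. (\<lambda>k. measure M {\<omega>\<in>space M. \<epsilon> \<le> dist (Y k \<omega>) (Z \<omega>)}) \<longlonglongrightarrow> 0)"

text \<open>\<open>has_ito_integral M F W H t I\<close>: the random variable \<open>I\<close> is (a version of) the It\^o
  integral of the matrix-valued process \<open>H\<close> with respect to \<open>W\<close> over \<open>{0..t}\<close>, where \<open>H\<close> is
  progressively measurable with almost surely square-integrable paths. It is the limit in
  probability of the integrals of simple processes that approximate \<open>H\<close>. The norm of
  \<open>real^'n^'m\<close> is the Hilbert-Schmidt norm.\<close>

definition has_ito_integral ::
  "'w measure \<Rightarrow> (real \<Rightarrow> 'w measure) \<Rightarrow> (real \<Rightarrow> 'w \<Rightarrow> real^'n) \<Rightarrow>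
    (real \<Rightarrow> 'w \<Rightarrow> real^'n^'m) \<Rightarrow> real \<Rightarrow> ('w \<Rightarrow> real^'m) \<Rightarrow> bool" where
  "has_ito_integral M F W H t I \<longleftrightarrow>
     progressive F H \<and>
     (AE \<omega> in M. set_integrable lborel {0..t} (\<lambda>s. (norm (H s \<omega>))\<^sup>2)) \<and>
     (\<exists>N p \<xi>. (\<forall>k. simple_data M F (N k) (p k) (\<xi> k)) \<and>
        tendsto_in_prob M
          (\<lambda>k \<omega>. LINT s:{0..t}|lborel. (norm (simple_process (N k) (p k) (\<xi> k) s \<omega> - H s \<omega>))\<^sup>2)
          (\<lambda>\<omega>. 0) \<and>
        tendsto_in_prob M (\<lambda>k. simple_integral W (N k) (p k) (\<xi> k) t) I)"

section \<open>Stochastic differential equations\<close>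

text \<open>\<open>X\<close> is a solution of \<open>dX = b(t, X) dt + \<sigma>(t, X) dW\<close> on the filtered probability space
  \<open>(M, F)\<close>. The choice of the filtration is free, so both strong solutions (\<open>F\<close> generated
  by \<open>X 0\<close>, \<open>W\<close> and null sets) and weak solutions are covered. Independence of \<open>W\<close> and \<open>X 0\<close>
  already follows from the remaining conditions.\<close>

definition sde_solution ::
  "'w measure \<Rightarrow> (real \<Rightarrow> 'w measure) \<Rightarrow> (real \<Rightarrow> 'w \<Rightarrow> real^'n) \<Rightarrow>
    (real \<Rightarrow> real^'n \<Rightarrow> real^'n) \<Rightarrow> (real \<Rightarrow> real^'n \<Rightarrow> real^'n^'n) \<Rightarrow>
    (real \<Rightarrow> 'w \<Rightarrow> real^'n) \<Rightarrow> bool" where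
  "sde_solution M F W b \<sigma> X \<longleftrightarrow>
     prob_space M \<and> filtration_on M F \<and> brownian_motion M F W \<and>
     adapted F X \<and> continuous_paths M X \<and>
     prob_space.indep_set M
       (sets (vimage_algebra (space M) (X 0) borel))
       (sets (vimage_algebra (space M) (\<lambda>\<omega>. \<lambda>t\<in>{0..}. W t \<omega>) (\<Pi>\<^sub>M t\<in>{0..}. borel))) \<and>
     (\<forall>t\<ge>0. has_ito_integral M F W (\<lambda>s \<omega>. \<sigma> s (X s \<omega>)) t
        (\<lambda>\<omega>. X t \<omega> - X 0 \<omega> - (LINT s:{0..t}|lborel. b s (X s \<omega>))))"

definition locally_lipschitz_coeffs ::
  "(real \<Rightarrow> real^'n \<Rightarrow> real^'n) \<Rightarrow> (real \<Rightarrow> real^'n \<Rightarrow> real^'n^'n) \<Rightarrow> bool" where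
  "locally_lipschitz_coeffs b \<sigma> \<longleftrightarrow>
     (\<forall>T>0. \<forall>R>0. \<exists>C>0. \<forall>t x y. 0 \<le> t \<and> t \<le> T \<and> norm x \<le> R \<and> norm y \<le> R \<longrightarrow>
        norm (b t x - b t y) + norm (\<sigma> t x - \<sigma> t y) \<le> C * norm (x - y))"

definition non_explosion_coeffs ::
  "(real \<Rightarrow> real^'n \<Rightarrow> real^'n) \<Rightarrow> (real \<Rightarrow> real^'n \<Rightarrow> real^'n^'n) \<Rightarrow> bool" where
  "non_explosion_coeffs b \<sigma> \<longleftrightarrow>
     (\<exists>\<alpha> \<beta> :: real \<Rightarrow> real.
        (\<forall>u\<ge>0. 0 \<le> \<alpha> u) \<and> (\<forall>u\<ge>0. 0 \<le> \<beta> u) \<and>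
        continuous_on {0..} \<alpha> \<and> continuous_on {0..} \<beta> \<and>
        mono_on {0..} \<beta> \<and> concave_on {0..} \<beta> \<and>
        (\<integral>\<^sup>+u\<in>{0..}. ennreal (1 / (1 + \<beta> u)) \<partial>lborel) = \<infinity> \<and>
        (\<forall>t\<ge>0. \<forall>x. 2 * (x \<bullet> b t x) + (norm (\<sigma> t x))\<^sup>2 \<le> \<alpha> t * \<beta> ((norm x)\<^sup>2)))"

section \<open>The positive semidefinite order\<close>

definition positive_semidefinite :: "real^'n^'n \<Rightarrow> bool" where
  "positive_semidefinite A \<longleftrightarrow> transpose A = A \<and> (\<forall>v. 0 \<le> v \<bullet> (A *v v))"

definition loewner_le :: "real^'n^'n \<Rightarrow> real^'n^'n \<Rightarrow> bool" where
  "loewner_le A B \<longleftrightarrow> positive_semidefinite (B - A)"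

end

theory Submission
  imports Defs
begin

text \<open>
  A single number is propagated in time, the square-exponential moment
  \<open>E exp (a |X t|\<^sup>2)\<close> with \<open>a = a\<^sub>0\<close>. Three facts combine.

  \<^item> The initial law. Tested on smooth truncations of the norm, \<open>GCBS\<close> says that the norm has a
    Gaussian Laplace transform around its mean. Averaging over a Gaussian Laplace parameter turns this
    into \<open>E exp (a |X 0|\<^sup>2) \<le> b\<^sub>0\<close> (\<open>GCBS_square_exponential_moment\<close>).

  \<^item> The dynamics. With \<open>K = \<theta> d + 2 \<alpha>\<^sup>2 / \<beta>\<close>, the function \<open>V x = exp (a |x|\<^sup>2)\<close> satisfies the
    Lyapunov inequality \<open>L V \<le> - a K V + 2 a K exp (4 a K / \<beta>)\<close> for the generator \<open>L\<close>, by
    dissipativity and \<open>a \<le> \<beta> / (2 \<theta>)\<close>. Hence the moment at time \<open>t\<close> is at most \<open>b\<^sub>t\<close>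
    (\<open>square_exponential_moment_le\<close>).

  \<^item> The return to concentration. If \<open>E exp (a |X|\<^sup>2) \<le> b\<close>, then symmetrization with an independent copy
    gives \<open>GCB\<close> with the constant \<open>b\<^sup>2 exp (- 1/2) / a\<close> (\<open>GCB_of_square_exponential_moment\<close>), and
    \<open>exp (- 1/2) \<le> exp 1 / (2 sqrt pi)\<close>.

  The Lyapunov argument is carried out in discrete time and avoids a change of variables formula for
  stochastic integrals. Since \<open>\<sigma> \<sigma>\<^sup>T \<le> \<theta>\<close>, the conditional Laplace transform of an increment of
  \<open>\<integral> \<sigma> dW\<close> is dominated by that of a Gaussian vector with covariance \<open>\<theta> (t - s) I\<close>
  (\<open>ito_increment_subgaussian\<close>). As \<open>V\<close> is a Gaussian mixture of exponentials of linear forms, the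
  conditional expectation of \<open>V\<close> after one Euler step is at most an explicit Gaussian convolution, whose
  expansion to first order in the step length is the Lyapunov inequality (\<open>gaussian_drift_step\<close>). Paths
  are discarded once they leave a ball of radius \<open>R\<close>, which makes all error terms uniform. The mesh is
  sent to \<open>0\<close> first (\<open>confined_moment_le\<close>), then \<open>R\<close> to infinity.

  The domination of increments rests on the exponential martingale of Brownian motion, which needs only
  the independence of Gaussian increments on a finite grid. It enters twice: it bounds the exponential
  moments of integrals of simple processes, and, through Markov's inequality, it shows that such an
  integral is small in probability if its quadratic variation is.
\<close>

section \<open>Gaussian integrals\<close>

text \<open>Completing the square turns the integrand into a multiple of the normal density with variance
  \<open>s\<^sup>2 / (1 - 2 * k * s\<^sup>2)\<close>; the assumption on \<open>k\<close> says that this variance is positive.\<close>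

lemma nn_integral_exp_quadratic_normal:
  fixes u k s :: real
  assumes s: "s > 0" and k: "2 * k * s\<^sup>2 < 1"
  shows "(\<integral>\<^sup>+w. ennreal (exp (u * w + k * w\<^sup>2) * normal_density 0 s w) \<partial>lborel) =
         ennreal (exp (s\<^sup>2 * u\<^sup>2 / (2 * (1 - 2 * k * s\<^sup>2))) / sqrt (1 - 2 * k * s\<^sup>2))"
proof -
  define q where "q = 1 - 2 * k * s\<^sup>2"
  define r where "r = s / sqrt q"
  have q: "q > 0" using k by (simp add: q_def)
  have r: "r > 0" using s q by (simp add: r_def)
  have r2: "r\<^sup>2 = s\<^sup>2 / q" using q by (simp add: r_def power_divide)
  have ks: "k = (1 - q) / (2 * s\<^sup>2)" using s by (simp add: q_def)
  have pt: "exp (u * w + k * w\<^sup>2) * normal_density 0 s w =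
      exp (s\<^sup>2 * u\<^sup>2 / (2 * q)) / sqrt q * normal_density (r\<^sup>2 * u) r w" for w
  proof -
    have e: "u * w + k * w\<^sup>2 - w\<^sup>2 / (2 * s\<^sup>2) =
        s\<^sup>2 * u\<^sup>2 / (2 * q) - (w - r\<^sup>2 * u)\<^sup>2 / (2 * r\<^sup>2)"
      using s q unfolding r2 ks by (simp add: field_simps power2_eq_square)
    have sq: "sqrt (2 * pi * r\<^sup>2) = sqrt (2 * pi * s\<^sup>2) / sqrt q"
      by (simp add: r2 real_sqrt_divide real_sqrt_mult)
    have "exp (u * w + k * w\<^sup>2) * normal_density 0 s w =
        exp (u * w + k * w\<^sup>2 - w\<^sup>2 / (2 * s\<^sup>2)) / sqrt (2 * pi * s\<^sup>2)"
      by (simp add: normal_density_def exp_add exp_diff exp_minus field_simps)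
    also have "\<dots> = exp (s\<^sup>2 * u\<^sup>2 / (2 * q)) * exp (- ((w - r\<^sup>2 * u)\<^sup>2 / (2 * r\<^sup>2)))
        / sqrt (2 * pi * s\<^sup>2)"
      by (simp add: e exp_diff exp_minus field_simps)
    also have "\<dots> = exp (s\<^sup>2 * u\<^sup>2 / (2 * q)) / sqrt q * normal_density (r\<^sup>2 * u) r w"
      unfolding normal_density_def sq using q s by (simp add: field_simps)
    finally show ?thesis .
  qed
  have "(\<integral>\<^sup>+w. ennreal (exp (u * w + k * w\<^sup>2) * normal_density 0 s w) \<partial>lborel) =
      (\<integral>\<^sup>+w. ennreal (exp (s\<^sup>2 * u\<^sup>2 / (2 * q)) / sqrt q) *
        ennreal (normal_density (r\<^sup>2 * u) r w) \<partial>lborel)"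
    using q by (simp add: pt ennreal_mult'[symmetric])
  also have "\<dots> = ennreal (exp (s\<^sup>2 * u\<^sup>2 / (2 * q)) / sqrt q) *
      (\<integral>\<^sup>+w. ennreal (normal_density (r\<^sup>2 * u) r w) \<partial>lborel)"
    by (rule nn_integral_cmult) simp
  also have "(\<integral>\<^sup>+w. ennreal (normal_density (r\<^sup>2 * u) r w) \<partial>lborel) = 1"
    using r by (subst nn_integral_eq_integral) auto
  finally show ?thesis by (simp add: q_def)
qed

abbreviation gauss_density :: "real \<Rightarrow> real^'n \<Rightarrow> real" where
  "gauss_density s x \<equiv> \<Prod>i\<in>UNIV. normal_density 0 s (x $ i)"

lemma prod_Basis_vec: "(\<Prod>b\<in>(Basis :: (real^'n) set). f b) = (\<Prod>i\<in>UNIV. f (axis i 1))"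
proof -
  have B: "(Basis :: (real^'n) set) = range (\<lambda>i. axis i 1)"
    by (auto simp: Basis_vec_def)
  have inj: "inj (\<lambda>i::'n. axis i (1::real))"
    by (auto simp: inj_on_def axis_eq_axis)
  show ?thesis unfolding B prod.reindex[OF inj] by (simp add: comp_def)
qed

lemma norm_vec_sq: "(norm (x :: real^'n))\<^sup>2 = (\<Sum>i\<in>UNIV. (x $ i)\<^sup>2)"
  unfolding norm_vec_def L2_set_def by (simp add: sum_nonneg)

lemma nn_integral_exp_quadratic_gauss:
  fixes u :: "real^'n"
  assumes s: "s > 0" and k: "2 * k * s\<^sup>2 < 1"
  shows "(\<integral>\<^sup>+w. ennreal (exp (u \<bullet> w + k * (norm w)\<^sup>2) * gauss_density s w) \<partial>lborel) =
         ennreal (exp (s\<^sup>2 * (norm u)\<^sup>2 / (2 * (1 - 2 * k * s\<^sup>2))) /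
           sqrt (1 - 2 * k * s\<^sup>2) ^ CARD('n))"
proof -
  define q where "q = 1 - 2 * k * s\<^sup>2"
  have "exp (u \<bullet> w + k * (norm w)\<^sup>2) * gauss_density s w =
      (\<Prod>b\<in>Basis. exp ((u \<bullet> b) * (w \<bullet> b) + k * (w \<bullet> b)\<^sup>2) * normal_density 0 s (w \<bullet> b))" for w :: "real^'n"
    unfolding prod_Basis_vec prod.distrib
    by (simp add: inner_axis norm_vec_sq inner_vec_def[of u] exp_sum[symmetric] sum.distrib sum_distrib_left)
  then have "(\<integral>\<^sup>+w. ennreal (exp (u \<bullet> w + k * (norm w)\<^sup>2) * gauss_density s w) \<partial>lborel) =
     (\<integral>\<^sup>+w. (\<Prod>b\<in>Basis. ennreal (exp ((u \<bullet> b) * (w \<bullet> b) + k * (w \<bullet> b)\<^sup>2) * normal_density 0 s (w \<bullet> b))) \<partial>lborel)"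
    by (simp add: prod_ennreal)
  also have "\<dots> = (\<Prod>b\<in>Basis. \<integral>\<^sup>+w. ennreal (exp ((u \<bullet> b) * w + k * w\<^sup>2) * normal_density 0 s w) \<partial>lborel)"
    by (rule nn_integral_lborel_prod) auto
  also have "\<dots> = (\<Prod>b\<in>Basis. ennreal (exp (s\<^sup>2 * (u \<bullet> b)\<^sup>2 / (2 * q)) / sqrt q))"
    unfolding nn_integral_exp_quadratic_normal[OF s k] q_def ..
  also have "\<dots> = ennreal (\<Prod>i\<in>UNIV. exp (s\<^sup>2 * (u $ i)\<^sup>2 / (2 * q)) / sqrt q)"
    unfolding prod_Basis_vec using k by (subst prod_ennreal) (auto simp: inner_axis q_def)
  also have "(\<Prod>i\<in>UNIV. exp (s\<^sup>2 * (u $ i)\<^sup>2 / (2 * q)) / sqrt q) =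
      exp (s\<^sup>2 * (norm u)\<^sup>2 / (2 * q)) / sqrt q ^ CARD('n)"
    by (simp add: prod_dividef exp_sum[symmetric] norm_vec_sq sum_distrib_left sum_divide_distrib)
  finally show ?thesis by (simp add: q_def)
qed

abbreviation sqexp :: "real \<Rightarrow> 'a::real_normed_vector \<Rightarrow> real" where
  "sqexp a x \<equiv> exp (a * (norm x)\<^sup>2)"

text \<open>The square-exponential is a Gaussian mixture of exponentials of linear forms. After an exchange
  of integrals, bounds on Laplace transforms become bounds on square-exponential moments. The
  one-dimensional version below serves the norm of the initial value, this one the noise increments.\<close>

lemma exp_square_eq_gauss_integral:
  fixes y :: "real^'n"
  assumes a: "a \<ge> 0"
  shows "ennreal (sqexp a y) =
    (\<integral>\<^sup>+g. ennreal (exp (sqrt (2 * a) * (y \<bullet> g)) * gauss_density 1 g) \<partial>lborel)"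
  using nn_integral_exp_quadratic_gauss[of 1 0 "sqrt (2 * a) *\<^sub>R y"] a
  by (simp add: power_mult_distrib)

lemma exp_square_eq_normal_integral:
  fixes y :: real
  assumes a: "a \<ge> 0"
  shows "ennreal (exp (a * y\<^sup>2)) =
    (\<integral>\<^sup>+g. ennreal (exp (sqrt (2 * a) * g * y) * normal_density 0 1 g) \<partial>lborel)"
  using nn_integral_exp_quadratic_normal[of 1 0 "sqrt (2 * a) * y"] a
  by (simp add: power_mult_distrib ac_simps)

section \<open>Lipschitz constants and limits of integrals\<close>

text \<open>For a Lipschitz function the supremum in \<open>lip\<close> is taken over a bounded set, and this set is
  nonempty because the dimension is positive. Both facts are necessary for a supremum in the reals
  to be a least upper bound.\<close>

lemma lip_bounds:
  fixes f :: "real^'n \<Rightarrow> real"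
  assumes "L-lipschitz_on UNIV f"
  shows lip_nonneg: "0 \<le> lip f" and lip_le: "lip f \<le> L"
    and abs_diff_le_lip: "\<bar>f x - f y\<bar> \<le> lip f * norm (x - y)"
proof -
  let ?S = "{(x, y). x \<noteq> y} :: ((real^'n) \<times> (real^'n)) set"
  let ?q = "\<lambda>(x, y). \<bar>f x - f y\<bar> / norm (x - y)"
  have b: "?q p \<le> L" if "p \<in> ?S" for p
    using that lipschitz_onD[OF assms, of "fst p" "snd p"]
    by (auto simp: dist_norm divide_simps split: prod.split)
  then have bdd: "bdd_above (?q ` ?S)" by (auto simp: bdd_above_def)
  have ne: "(axis undefined 1, 0) \<in> ?S" by (simp add: axis_eq_0_iff)
  then show "lip f \<le> L" unfolding lip_def using b by (intro cSUP_least) auto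
  have up: "?q p \<le> lip f" if "p \<in> ?S" for p
    unfolding lip_def using bdd that by (intro cSUP_upper) auto
  show "0 \<le> lip f" by (rule order_trans[OF _ up[OF ne]]) simp
  show "\<bar>f x - f y\<bar> \<le> lip f * norm (x - y)"
    using up[of "(x, y)"] by (cases "x = y") (auto simp: divide_simps)
qed

lemma nn_integral_le_of_AE_limit:
  fixes g :: "'a \<Rightarrow> ennreal"
  assumes f: "\<And>k :: nat. f k \<in> borel_measurable M" and lim: "AE x in M. (\<lambda>k. f k x) \<longlonglongrightarrow> g x"
    and K: "\<And>k. (\<integral>\<^sup>+x. f k x \<partial>M) \<le> K"
  shows "(\<integral>\<^sup>+x. g x \<partial>M) \<le> K"
proof -
  have "(\<integral>\<^sup>+x. g x \<partial>M) = (\<integral>\<^sup>+x. liminf (\<lambda>k. f k x) \<partial>M)"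
  proof (rule nn_integral_cong_AE)
    show "AE x in M. g x = liminf (\<lambda>k. f k x)"
      using lim by eventually_elim (intro lim_imp_Liminf[symmetric], simp_all)
  qed
  also have "\<dots> \<le> liminf (\<lambda>k. \<integral>\<^sup>+x. f k x \<partial>M)" by (rule nn_integral_liminf[OF f])
  also have "\<dots> \<le> liminf (\<lambda>k. K)" by (intro Liminf_mono always_eventually allI K)
  also have "\<dots> = K" by (simp add: Liminf_const)
  finally show ?thesis .
qed

section \<open>Concentration from a square-exponential moment\<close>

text \<open>This is \<open>cosh s \<le> exp (s\<^sup>2 / 2)\<close>, which is Hoeffding's lemma for a fair sign \<open>s, - s\<close>.\<close>

lemma exp_add_exp_minus_le: "exp s + exp (- s) \<le> 2 * exp (s\<^sup>2 / 2)" for s :: real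
proof -
  have *: "exp s + exp (- s) \<le> 2 * exp (s\<^sup>2 / 2)" if "s \<ge> 0" for s :: real
  proof -
    have p: "0 < (1 + exp (2 * s)) / 2" by (simp add: add_pos_pos)
    have "- (2 * s) * (1/2) + ln (1 + (1/2) * (exp (2 * s) - 1)) \<le> (2 * s)\<^sup>2 / 8"
      using that by (intro Hoeffdings_lemma_aux) auto
    also have "1 + (1/2) * (exp (2 * s) - 1) = (1 + exp (2 * s)) / 2" by (simp add: field_simps)
    finally have "ln ((1 + exp (2 * s)) / 2) \<le> s + s\<^sup>2 / 2" by (simp add: power2_eq_square)
    then have "(1 + exp (2 * s)) / 2 \<le> exp (s + s\<^sup>2 / 2)" using p by (metis exp_le_cancel_iff exp_ln)
    also have "\<dots> = exp s * exp (s\<^sup>2 / 2)" by (simp add: exp_add)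
    finally have "exp (- s) * (1 + exp (2 * s)) \<le> exp (- s) * (2 * (exp s * exp (s\<^sup>2 / 2)))"
      by (intro mult_left_mono) auto
    moreover have "exp (- s) * (1 + exp (2 * s)) = exp s + exp (- s)"
      by (simp add: distrib_left mult_exp_exp)
    moreover have "exp (- s) * (2 * (exp s * exp (s\<^sup>2 / 2))) = 2 * exp (s\<^sup>2 / 2)"
      by (simp add: exp_minus)
    ultimately show ?thesis by simp
  qed
  show ?thesis using *[of s] *[of "- s"] by (cases "s \<ge> 0") (auto simp: add.commute)
qed

text \<open>Jensen's inequality for the concave power \<open>y \<mapsto> y\<^sup>p\<close>: integrate the tangent bound
  \<open>exp (p * s) \<le> 1 - p + p * exp s\<close> at \<open>s = Y - ln b\<close>.\<close>

lemma (in prob_space) nn_integral_exp_scale_le: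
  assumes [measurable]: "Y \<in> borel_measurable M" and b: "(\<integral>\<^sup>+x. ennreal (exp (Y x)) \<partial>M) \<le> ennreal b"
    and b0: "b > 0" and p: "0 \<le> p" "p \<le> 1"
  shows "(\<integral>\<^sup>+x. ennreal (exp (p * Y x)) \<partial>M) \<le> ennreal (exp (p * ln b))"
proof -
  let ?m = "exp (p * ln b)"
  have "(\<integral>\<^sup>+x. ennreal (exp (p * Y x)) \<partial>M) \<le>
     (\<integral>\<^sup>+x. ennreal ((1 - p) * ?m) + ennreal (p * ?m / b) * ennreal (exp (Y x)) \<partial>M)"
  proof (rule nn_integral_mono)
    fix x
    have "exp (p * (Y x - ln b)) \<le> (1 - p) + p * exp (Y x - ln b)"
      using convex_onD[OF convex_on_exp[of 1], of p 0 "Y x - ln b"] p by simp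
    then have "?m * exp (p * (Y x - ln b)) \<le> ?m * ((1 - p) + p * exp (Y x - ln b))"
      by (intro mult_left_mono) auto
    moreover have "?m * exp (p * (Y x - ln b)) = exp (p * Y x)"
      by (simp add: mult_exp_exp right_diff_distrib)
    ultimately have "exp (p * Y x) \<le> (1 - p) * ?m + p * ?m / b * exp (Y x)"
      using b0 by (simp add: exp_diff[of "Y x"] algebra_simps)
    then show "ennreal (exp (p * Y x)) \<le> ennreal ((1 - p) * ?m) + ennreal (p * ?m / b) * ennreal (exp (Y x))"
      using p b0 by (simp add: ennreal_mult[symmetric] ennreal_plus[symmetric] del: ennreal_plus)
  qed
  also have "\<dots> = ennreal ((1 - p) * ?m) + ennreal (p * ?m / b) * (\<integral>\<^sup>+x. ennreal (exp (Y x)) \<partial>M)"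
    by (subst nn_integral_add) (auto simp: nn_integral_cmult emeasure_space_1)
  also have "\<dots> \<le> ennreal ((1 - p) * ?m) + ennreal (p * ?m / b) * ennreal b"
    by (intro add_left_mono mult_left_mono b) auto
  also have "\<dots> = ennreal ?m"
    using p b0 by (simp add: ennreal_mult[symmetric] ennreal_plus[symmetric] algebra_simps del: ennreal_plus)
  finally show ?thesis .
qed

lemma ln_le_mult_exp_minus_half: "ln B + 1/2 \<le> exp (- 1/2) * B" if "B > 0" for B :: real
proof -
  have "exp (ln B - 1/2) = exp (- 1/2) * B"
    using that by (subst diff_conv_add_uminus, subst exp_add) simp
  then show ?thesis using exp_ge_add_one_self[of "ln B - 1/2"] by simp
qed

text \<open>The product is the expectation of \<open>exp (f X - f Y)\<close> for independent \<open>X\<close> and \<open>Y\<close> with law \<open>M\<close>, and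
  \<open>\<bar>f X - f Y\<bar> \<le> l * norm (X - Y)\<close>. If \<open>l\<^sup>2 \<le> a\<close>, exchanging \<open>X\<close> and \<open>Y\<close> replaces the exponential by a
  hyperbolic cosine; the bound \<open>exp (l\<^sup>2 * (norm (X - Y))\<^sup>2 / 2)\<close> then has no linear term and Jensen's
  inequality gives \<open>b powr (2 * l\<^sup>2 / a)\<close>. If \<open>l\<^sup>2 > a\<close>, Young's inequality gives
  \<open>b\<^sup>2 * exp (l\<^sup>2 / (2 * a))\<close>. The elementary inequality \<open>ln B + 1/2 \<le> exp (- 1/2) * B\<close> with \<open>B = b\<^sup>2\<close>
  puts both under a common bound.\<close>

lemma Laplace_symmetrized_le:
  fixes f :: "'a::euclidean_space \<Rightarrow> real"
  assumes "prob_space M" and sM: "sets M = sets borel" and f: "\<And>x y. \<bar>f x - f y\<bar> \<le> l * norm (x - y)" and l: "l \<ge> 0"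
    and fm [measurable]: "f \<in> borel_measurable borel"
    and a: "a > 0" and b: "(\<integral>\<^sup>+x. ennreal (sqexp a x) \<partial>M) \<le> ennreal b" and b1: "b \<ge> 1"
  shows "(\<integral>\<^sup>+x. ennreal (exp (f x)) \<partial>M) * (\<integral>\<^sup>+x. ennreal (exp (- f x)) \<partial>M) \<le>
    ennreal (exp (b\<^sup>2 * exp (- 1/2) / a * l\<^sup>2))" (is "?P * ?N \<le> _")
proof -
  interpret prob_space M by fact
  have [measurable_cong]: "sets M = sets borel" by (fact sM)
  have sq: "(norm (x - y))\<^sup>2 \<le> 2 * (norm x)\<^sup>2 + 2 * (norm y)\<^sup>2" for x y :: 'a
  proof -
    have "(norm (x - y))\<^sup>2 \<le> (norm x + norm y)\<^sup>2"
      by (intro power_mono norm_triangle_ineq4) auto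
    also have "\<dots> \<le> 2 * (norm x)\<^sup>2 + 2 * (norm y)\<^sup>2"
      using sum_squares_bound[of "norm x" "norm y"] by (simp add: power2_eq_square algebra_simps)
    finally show ?thesis .
  qed
  define x where "x = l\<^sup>2 / a"
  have x0: "x \<ge> 0" using a by (simp add: x_def)
  have dbl: "(\<integral>\<^sup>+x. ennreal (exp (u x)) \<partial>M) * (\<integral>\<^sup>+y. ennreal (exp (v y)) \<partial>M) =
     (\<integral>\<^sup>+x. (\<integral>\<^sup>+y. ennreal (exp (u x + v y)) \<partial>M) \<partial>M)"
    if [measurable]: "u \<in> borel_measurable borel" "v \<in> borel_measurable borel" for u v :: "'a \<Rightarrow> real"
    by (simp add: exp_add ennreal_mult nn_integral_cmult nn_integral_multc)
  let ?B = "b\<^sup>2"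
  have B: "?B \<ge> 1" "?B > 0" "ln ?B = 2 * ln b" "ln ?B \<ge> 0" using b1 by (auto simp: ln_realpow)
  have lnB: "ln ?B + 1/2 \<le> exp (- 1/2) * ?B" using B by (intro ln_le_mult_exp_minus_half) auto
  let ?I = "\<lambda>c. \<integral>\<^sup>+x. ennreal (sqexp c x) \<partial>M"
  show ?thesis
  proof (cases "x \<le> 1")
    case True
    \<comment> \<open>Average the two orders of the independent copies.\<close>
    have "2 * (?P * ?N) = ?P * ?N + ?N * ?P" by (simp add: mult.commute mult_2)
    also have "\<dots> = (\<integral>\<^sup>+x. (\<integral>\<^sup>+y. ennreal (exp (f x - f y)) + ennreal (exp (- (f x - f y))) \<partial>M) \<partial>M)"
      by (simp add: dbl nn_integral_add)
    also have "\<dots> \<le> (\<integral>\<^sup>+x. (\<integral>\<^sup>+y. 2 * ennreal (exp (l\<^sup>2 * (norm x)\<^sup>2 + l\<^sup>2 * (norm y)\<^sup>2)) \<partial>M) \<partial>M)"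
    proof (intro nn_integral_mono)
      fix x y
      have "exp (f x - f y) + exp (- (f x - f y)) \<le> 2 * exp ((f x - f y)\<^sup>2 / 2)"
        by (rule exp_add_exp_minus_le)
      also have "(f x - f y)\<^sup>2 \<le> (l * norm (x - y))\<^sup>2"
        using f[of x y] by (rule abs_le_square_iff[THEN iffD1, OF order_trans]) (use l in auto)
      also have "\<dots> \<le> l\<^sup>2 * (2 * (norm x)\<^sup>2 + 2 * (norm y)\<^sup>2)"
        unfolding power_mult_distrib by (intro mult_left_mono sq) auto
      also have "l\<^sup>2 * (2 * (norm x)\<^sup>2 + 2 * (norm y)\<^sup>2) / 2 = l\<^sup>2 * (norm x)\<^sup>2 + l\<^sup>2 * (norm y)\<^sup>2"
        by (simp add: algebra_simps)
      finally have "exp (f x - f y) + exp (- (f x - f y)) \<le> 2 * exp (l\<^sup>2 * (norm x)\<^sup>2 + l\<^sup>2 * (norm y)\<^sup>2)"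
        by simp
      then have "ennreal (exp (f x - f y) + exp (- (f x - f y))) \<le> ennreal (2 * exp (l\<^sup>2 * (norm x)\<^sup>2 + l\<^sup>2 * (norm y)\<^sup>2))"
        by (rule ennreal_leI)
      then show "ennreal (exp (f x - f y)) + ennreal (exp (- (f x - f y))) \<le> 2 * ennreal (exp (l\<^sup>2 * (norm x)\<^sup>2 + l\<^sup>2 * (norm y)\<^sup>2))"
        by (simp add: ennreal_mult)
    qed
    also have "\<dots> = 2 * (?I (l\<^sup>2) * ?I (l\<^sup>2))"
      by (subst dbl) (auto simp: nn_integral_cmult)
    finally have "?P * ?N \<le> ?I (l\<^sup>2) * ?I (l\<^sup>2)"
      by (subst (asm) ennreal_mult_le_mult_iff) auto
    also have "\<dots> \<le> ennreal (exp (x * ln b)) * ennreal (exp (x * ln b))"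
    proof -
      have "(\<integral>\<^sup>+y. ennreal (exp (x * (a * (norm y)\<^sup>2))) \<partial>M) \<le> ennreal (exp (x * ln b))"
        using b1 x0 True b by (intro nn_integral_exp_scale_le) auto
      also have "(\<lambda>y::'a. x * (a * (norm y)\<^sup>2)) = (\<lambda>y. l\<^sup>2 * (norm y)\<^sup>2)"
        using a by (auto simp: x_def)
      finally show ?thesis by (intro mult_mono) auto
    qed
    also have "\<dots> = ennreal (exp (x * ln ?B))"
      by (simp add: ennreal_mult[symmetric] mult_exp_exp B)
    also have "\<dots> \<le> ennreal (exp (x * (exp (- 1/2) * ?B)))"
      using lnB x0 by (intro ennreal_leI, subst exp_le_cancel_iff, intro mult_left_mono) auto
    finally show ?thesis by (simp add: x_def mult_ac)
  next
    case False
    have "?P * ?N = (\<integral>\<^sup>+x. (\<integral>\<^sup>+y. ennreal (exp (f x - f y)) \<partial>M) \<partial>M)"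
      by (simp add: dbl)
    also have "\<dots> \<le> (\<integral>\<^sup>+z. (\<integral>\<^sup>+y. ennreal (exp (x / 2)) * ennreal (exp (a * (norm z)\<^sup>2 + a * (norm y)\<^sup>2)) \<partial>M) \<partial>M)"
    proof (intro nn_integral_mono)
      fix z y :: 'a
      \<comment> \<open>Young's inequality with the weights that leave exactly \<open>a / 2\<close> in front of the square.\<close>
      have "0 \<le> (l / a - norm (z - y))\<^sup>2 * (a / 2)" using a by auto
      also have "\<dots> = x / 2 + a / 2 * (norm (z - y))\<^sup>2 - l * norm (z - y)"
        using a by (simp add: x_def power2_diff power_divide field_simps power2_eq_square)
      finally have "l * norm (z - y) \<le> x / 2 + a / 2 * (norm (z - y))\<^sup>2" by simp
      also have "\<dots> \<le> x / 2 + a / 2 * (2 * (norm z)\<^sup>2 + 2 * (norm y)\<^sup>2)"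
        using mult_left_mono[OF sq[of z y], of "a / 2"] a by simp
      finally have "f z - f y \<le> x / 2 + (a * (norm z)\<^sup>2 + a * (norm y)\<^sup>2)"
        using f[of z y] by (simp add: algebra_simps)
      then show "ennreal (exp (f z - f y)) \<le> ennreal (exp (x / 2)) * ennreal (exp (a * (norm z)\<^sup>2 + a * (norm y)\<^sup>2))"
        by (simp add: ennreal_mult[symmetric] mult_exp_exp)
    qed
    also have "\<dots> = ennreal (exp (x / 2)) * (?I a * ?I a)"
      by (subst dbl) (auto simp: nn_integral_cmult)
    also have "\<dots> \<le> ennreal (exp (x / 2)) * (ennreal b * ennreal b)"
      by (intro mult_left_mono mult_mono b) auto
    also have "\<dots> = ennreal (exp (x / 2 + ln ?B))"
      using b1 by (simp add: ennreal_mult[symmetric] exp_add power2_eq_square)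
    also have "\<dots> \<le> ennreal (exp (x * (exp (- 1/2) * ?B)))"
    proof -
      have "x / 2 + ln ?B \<le> x / 2 + x * ln ?B" using False B mult_right_mono[of 1 x "ln ?B"] by simp
      also have "\<dots> = x * (ln ?B + 1/2)" by (simp add: algebra_simps)
      also have "\<dots> \<le> x * (exp (- 1/2) * ?B)" using lnB x0 by (intro mult_left_mono) auto
      finally show ?thesis by (intro ennreal_leI) simp
    qed
    finally show ?thesis by (simp add: x_def mult_ac)
  qed
qed

text \<open>By Jensen's inequality \<open>exp (- \<mu>(f)) \<le> \<mu>(exp (- f))\<close>, so the centred Laplace transform is at most
  the symmetrized product. The same product yields integrability: it is finite and neither of its
  factors vanishes, so \<open>exp f\<close> and \<open>exp (- f)\<close> are both integrable.\<close>

theorem GCB_of_square_exponential_moment: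
  fixes \<mu> :: "(real^'n) measure"
  assumes "prob_space \<mu>" and sM: "sets \<mu> = sets borel"
    and a: "a > 0" and b: "(\<integral>\<^sup>+x. ennreal (sqexp a x) \<partial>\<mu>) \<le> ennreal b"
    and D: "b\<^sup>2 * exp (- 1/2) / a \<le> D"
  shows "GCB \<mu> D"
  unfolding GCB_def
proof (intro allI impI)
  interpret prob_space \<mu> by fact
  have [measurable_cong]: "sets \<mu> = sets borel" by (fact sM)
  fix f :: "real^'n \<Rightarrow> real" assume "\<exists>L. L-lipschitz_on UNIV f"
  then obtain L where L: "L-lipschitz_on UNIV f" ..
  define l where "l = lip f"
  have l: "l \<ge> 0" and fl: "\<bar>f x - f y\<bar> \<le> l * norm (x - y)" for x y
    using lip_bounds[OF L] by (auto simp: l_def)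
  have [measurable]: "f \<in> borel_measurable borel"
    by (intro borel_measurable_continuous_onI lipschitz_on_continuous_on[OF L])
  have b1: "b \<ge> 1"
  proof -
    have "1 = (\<integral>\<^sup>+x. 1 \<partial>\<mu>)" by (simp add: emeasure_space_1)
    also have "\<dots> \<le> (\<integral>\<^sup>+x. ennreal (sqexp a x) \<partial>\<mu>)"
      using a by (intro nn_integral_mono) auto
    also have "\<dots> \<le> ennreal b" by (fact b)
    finally show ?thesis by simp
  qed
  have sym: "(\<integral>\<^sup>+x. ennreal (exp (f x)) \<partial>\<mu>) * (\<integral>\<^sup>+x. ennreal (exp (- f x)) \<partial>\<mu>) \<le>
      ennreal (exp (b\<^sup>2 * exp (- 1/2) / a * l\<^sup>2))"
    using sM fl l a b b1 \<open>prob_space \<mu>\<close> by (intro Laplace_symmetrized_le) auto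
  have pos: "(\<integral>\<^sup>+x. ennreal (exp (g x)) \<partial>\<mu>) > 0" if [measurable]: "g \<in> borel_measurable borel" for g
  proof (rule ccontr)
    assume "\<not> ?thesis"
    then have "(\<integral>\<^sup>+x. ennreal (exp (g x)) \<partial>\<mu>) = 0" by simp
    then have "AE x in \<mu>. ennreal (exp (g x)) = 0" by (subst (asm) nn_integral_0_iff_AE) auto
    then have "AE x in \<mu>. False" by simp
    then show False using AE_False by auto
  qed
  have fin: "(\<integral>\<^sup>+x. ennreal (exp (f x)) \<partial>\<mu>) < \<infinity>" "(\<integral>\<^sup>+x. ennreal (exp (- f x)) \<partial>\<mu>) < \<infinity>"
    using sym pos[of f] pos[of "\<lambda>x. - f x"]
    by (auto simp: less_top[symmetric] top_unique ennreal_top_mult ennreal_mult_top split: if_splits)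
  have ie: "integrable \<mu> (\<lambda>x. exp (f x))" "integrable \<mu> (\<lambda>x. exp (- f x))"
    using fin by (auto intro!: integrableI_nonneg)
  have "integrable \<mu> f"
  proof (rule Bochner_Integration.integrable_bound)
    show "integrable \<mu> (\<lambda>x. exp (f x) + exp (- f x))" using ie by auto
    show "AE x in \<mu>. norm (f x) \<le> norm (exp (f x) + exp (- f x))"
    proof (intro AE_I2)
      fix x
      have "\<bar>f x\<bar> \<le> exp (f x) + exp (- f x)"
        using exp_ge_add_one_self[of "f x"] exp_ge_add_one_self[of "- f x"] exp_gt_zero[of "f x"]
          exp_gt_zero[of "- f x"] by linarith
      then show "norm (f x) \<le> norm (exp (f x) + exp (- f x))" by simp
    qed
  qed simp
  define m where "m = (\<integral>y. f y \<partial>\<mu>)"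
  have jen: "exp (- m) \<le> (\<integral>x. exp (- f x) \<partial>\<mu>)"
    using jensens_inequality[of "\<lambda>x. - f x" UNIV _ _ exp] ie \<open>integrable \<mu> f\<close> convex_on_exp[of 1]
    by (auto simp: m_def)
  have i2: "integrable \<mu> (\<lambda>x. exp (f x - m))" using ie by (simp add: exp_diff)
  have "(\<integral>x. exp (f x - m) \<partial>\<mu>) = (\<integral>x. exp (f x) \<partial>\<mu>) * exp (- m)"
    by (simp add: exp_diff exp_minus divide_inverse)
  also have "\<dots> \<le> (\<integral>x. exp (f x) \<partial>\<mu>) * (\<integral>x. exp (- f x) \<partial>\<mu>)"
    by (intro mult_left_mono jen) auto
  also have "\<dots> \<le> exp (b\<^sup>2 * exp (- 1/2) / a * l\<^sup>2)"
  proof -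
    have "ennreal ((\<integral>x. exp (f x) \<partial>\<mu>) * (\<integral>x. exp (- f x) \<partial>\<mu>)) \<le> ennreal (exp (b\<^sup>2 * exp (- 1/2) / a * l\<^sup>2))"
      using sym ie by (simp add: nn_integral_eq_integral ennreal_mult)
    then show ?thesis by simp
  qed
  also have "\<dots> \<le> exp (D * l\<^sup>2)" using mult_right_mono[OF D, of "l\<^sup>2"] by simp
  finally have le: "(\<integral>x. exp (f x - m) \<partial>\<mu>) \<le> exp (D * l\<^sup>2)" .
  have "0 < (\<integral>x. exp (f x - m) \<partial>\<mu>)"
    using pos[of "\<lambda>x. f x - m"] i2 by (simp add: nn_integral_eq_integral)
  then have "ln (\<integral>x. exp (f x - m) \<partial>\<mu>) \<le> D * l\<^sup>2" using le by (metis exp_le_cancel_iff exp_ln)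
  then show "exp_moment_bound \<mu> D f"
    using \<open>integrable \<mu> f\<close> i2 unfolding exp_moment_bound_def m_def l_def by auto
qed

section \<open>Smooth truncations of the norm\<close>

definition smooth_fun :: "(real^'n \<Rightarrow> real) \<Rightarrow> bool" where
  "smooth_fun f \<longleftrightarrow> (\<forall>k. times_cont_diff k f)"

text \<open>A smooth function of one variable comes with the whole sequence of its derivatives, because the
  chain rule below needs all of them in one induction.\<close>

definition smooth_on1 :: "real set \<Rightarrow> (real \<Rightarrow> real) \<Rightarrow> bool" where
  "smooth_on1 S g \<longleftrightarrow> (\<exists>D. D 0 = g \<and> (\<forall>k. \<forall>x\<in>S. (D k has_real_derivative D (Suc k) x) (at x)))"

lemma times_cont_diff_continuous: "times_cont_diff k f \<Longrightarrow> continuous_on UNIV f"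
  by (cases k) (auto intro!: continuous_at_imp_continuous_on dest: has_derivative_continuous)

lemma times_cont_diff_Suc_D: "times_cont_diff (Suc k) f \<Longrightarrow> times_cont_diff k f"
proof (induction k arbitrary: f)
  case 0 then show ?case using times_cont_diff_continuous[of "Suc 0"] by simp
next
  case (Suc k)
  from Suc.prems obtain g where
    "\<forall>x. (f has_derivative (\<lambda>h. \<Sum>i\<in>UNIV. g i x * h $ i)) (at x)" "\<forall>i. times_cont_diff (Suc k) (g i)"
    unfolding times_cont_diff.simps(2)[of "Suc k"] by auto
  then show ?case using Suc.IH by auto
qed

lemma times_cont_diff_const: "times_cont_diff k (\<lambda>x. c)"
proof (induction k arbitrary: c)
  case (Suc k)
  then show ?case
    by (auto intro!: exI[of _ "\<lambda>i x. 0"] derivative_eq_intros)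
qed simp

lemma times_cont_diff_nth: "times_cont_diff k (\<lambda>x :: real^'n. x $ j)"
proof (cases k)
  case (Suc m)
  have "((\<lambda>x. x $ j) has_derivative (\<lambda>h. \<Sum>i\<in>UNIV. (if i = j then 1 else 0) * h $ i)) (at x)"
    for x :: "real^'n"
    using bounded_linear_imp_has_derivative[OF bounded_linear_vec_nth]
    by (simp add: if_distrib[of "\<lambda>c. c * _"] sum.delta cong: if_cong)
  then show ?thesis unfolding Suc
    by (auto intro!: exI[of _ "\<lambda>i x. if i = j then 1 else 0"] times_cont_diff_const)
qed (auto intro: continuous_intros)

lemma times_cont_diff_add:
  "times_cont_diff k f \<Longrightarrow> times_cont_diff k g \<Longrightarrow> times_cont_diff k (\<lambda>x. f x + g x)"
proof (induction k arbitrary: f g)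
  case 0 then show ?case by (auto intro: continuous_intros)
next
  case (Suc k)
  then obtain f' g' where
    "\<forall>x. (f has_derivative (\<lambda>h. \<Sum>i\<in>UNIV. f' i x * h $ i)) (at x)" "\<forall>i. times_cont_diff k (f' i)"
    "\<forall>x. (g has_derivative (\<lambda>h. \<Sum>i\<in>UNIV. g' i x * h $ i)) (at x)" "\<forall>i. times_cont_diff k (g' i)"
    by auto
  then show ?case
    by (auto intro!: exI[of _ "\<lambda>i x. f' i x + g' i x"] derivative_eq_intros Suc.IH
        simp: sum.distrib[symmetric] algebra_simps)
qed

lemma times_cont_diff_mult:
  "times_cont_diff k f \<Longrightarrow> times_cont_diff k g \<Longrightarrow> times_cont_diff k (\<lambda>x. f x * g x)"
proof (induction k arbitrary: f g)
  case 0 then show ?case by (auto intro: continuous_intros)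
next
  case (Suc k)
  note fg = Suc.prems[THEN times_cont_diff_Suc_D]
  from Suc.prems obtain f' g' where
    "\<forall>x. (f has_derivative (\<lambda>h. \<Sum>i\<in>UNIV. f' i x * h $ i)) (at x)" "\<forall>i. times_cont_diff k (f' i)"
    "\<forall>x. (g has_derivative (\<lambda>h. \<Sum>i\<in>UNIV. g' i x * h $ i)) (at x)" "\<forall>i. times_cont_diff k (g' i)"
    by auto
  then show ?case using fg
    by (auto intro!: exI[of _ "\<lambda>i x. f' i x * g x + f x * g' i x"] derivative_eq_intros
        Suc.IH times_cont_diff_add
        simp: sum.distrib[symmetric] sum_distrib_left sum_distrib_right algebra_simps)
qed

text \<open>The partial derivatives of \<open>D j (f x)\<close> are \<open>D (Suc j) (f x)\<close> times those of \<open>f\<close>; hence the induction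
  on the order of differentiability runs over all \<open>j\<close> simultaneously.\<close>

lemma times_cont_diff_comp1:
  fixes f :: "real^'n \<Rightarrow> real"
  assumes g: "smooth_on1 S g" and f: "smooth_fun f" and S: "\<And>x. f x \<in> S"
  shows "smooth_fun (\<lambda>x. g (f x))"
proof -
  obtain D where D: "D 0 = g" "\<And>k x. x \<in> S \<Longrightarrow> (D k has_real_derivative D (Suc k) x) (at x)"
    using g unfolding smooth_on1_def by auto
  have "times_cont_diff k (\<lambda>x. D j (f x))" for k j
  proof (induction k arbitrary: j)
    case 0
    have "continuous_on UNIV f" using f times_cont_diff_continuous unfolding smooth_fun_def by blast
    moreover have "continuous_on S (D j)"
      using D(2) by (auto intro!: continuous_at_imp_continuous_on DERIV_isCont)
    ultimately show ?case using S by (auto intro: continuous_on_compose2)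
  next
    case (Suc k)
    have "times_cont_diff (Suc k) f" using f by (auto simp: smooth_fun_def)
    then obtain f' where f': "\<And>x. (f has_derivative (\<lambda>h. \<Sum>i\<in>UNIV. f' i x * h $ i)) (at x)"
      "\<And>i. times_cont_diff k (f' i)" by auto
    have "((\<lambda>x. D j (f x)) has_derivative (\<lambda>h. \<Sum>i\<in>UNIV. (D (Suc j) (f x) * f' i x) * h $ i)) (at x)" for x
    proof -
      have "((\<lambda>x. D j (f x)) has_derivative (\<lambda>h. (\<Sum>i\<in>UNIV. f' i x * h $ i) * D (Suc j) (f x))) (at x)"
        using has_derivative_compose[OF f'(1)[of x], of "D j" "(*) (D (Suc j) (f x))"] D(2)[OF S, of j x]
        by (simp add: has_field_derivative_def mult.commute[of "D (Suc j) (f x)"])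
      then show ?thesis by (simp add: sum_distrib_right sum_distrib_left mult_ac)
    qed
    then show ?case using Suc.IH f'(2)
      by (auto intro!: exI[of _ "\<lambda>i x. D (Suc j) (f x) * f' i x"] times_cont_diff_mult)
  qed
  from this[of _ 0] show ?thesis using D(1) by (simp add: smooth_fun_def)
qed

lemma smooth_fun_const: "smooth_fun (\<lambda>x. c)"
  and smooth_fun_add: "smooth_fun f \<Longrightarrow> smooth_fun g \<Longrightarrow> smooth_fun (\<lambda>x. f x + g x)"
  and smooth_fun_mult: "smooth_fun f \<Longrightarrow> smooth_fun g \<Longrightarrow> smooth_fun (\<lambda>x. f x * g x)"
  by (auto simp: smooth_fun_def intro: times_cont_diff_const times_cont_diff_add times_cont_diff_mult)

lemma smooth_fun_norm_sq: "smooth_fun (\<lambda>x :: real^'n. (norm x)\<^sup>2)"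
proof -
  have "smooth_fun (\<lambda>x :: real^'n. \<Sum>i\<in>I. (x $ i)\<^sup>2)" if "finite I" for I
    using that by induction (auto intro!: smooth_fun_const smooth_fun_add smooth_fun_mult
        simp: power2_eq_square smooth_fun_def[of "\<lambda>x. x $ _"] times_cont_diff_nth)
  from this[of UNIV] show ?thesis by (simp add: norm_vec_sq)
qed

lemma smooth_on1_sqrt: "smooth_on1 {0<..} sqrt"
proof -
  define D where "D k x = (if k = 0 then sqrt x else (\<Prod>j<k. 1/2 - real j) * x powr (1/2 - real k))"
    for k :: nat and x :: real
  have "(D k has_real_derivative D (Suc k) x) (at x)" if "x > 0" for k x
  proof (cases "k = 0")
    case True
    then show ?thesis using that
      by (auto simp: D_def[abs_def] powr_minus powr_half_sqrt field_simps intro!: derivative_eq_intros)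
  next
    case False
    have "((\<lambda>x. (\<Prod>j<k. 1/2 - real j) * x powr (1/2 - real k)) has_real_derivative
       (\<Prod>j<Suc k. 1/2 - real j) * x powr (1/2 - real (Suc k))) (at x)"
      using that by (auto intro!: derivative_eq_intros simp: powr_diff field_simps powr_add)
    then show ?thesis using False by (simp add: D_def[abs_def])
  qed
  then show ?thesis unfolding smooth_on1_def by (intro exI[of _ D]) (auto simp: D_def[abs_def])
qed

text \<open>A smooth replacement for the positive part that vanishes on the negative axis. The explicit
  factor keeps the Lipschitz constant one: the derivative \<open>exp (- \<delta> / u) * (1 + \<delta> / u)\<close> is at most
  \<open>1\<close> because \<open>1 + z \<le> exp z\<close>.\<close>

definition soft_pos :: "real \<Rightarrow> real \<Rightarrow> real" where
  "soft_pos \<delta> u = (if u > 0 then u * exp (- \<delta> / u) else 0)"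

text \<open>On the positive axis, every derivative of \<open>exp (- \<delta> / u)\<close> is a polynomial in \<open>1 / u\<close> times
  \<open>exp (- \<delta> / u)\<close>. Such a product tends to \<open>0\<close> faster than any power of \<open>u\<close>, so all derivatives
  extend by \<open>0\<close> across the origin.\<close>

lemma soft_pos_smooth:
  assumes \<delta>: "\<delta> > 0"
  shows "smooth_on1 UNIV (soft_pos \<delta>)"
proof -
  define P :: "nat \<Rightarrow> real poly" where "P = rec_nat 1 (\<lambda>k p. [:0, 0, 1:] * (smult \<delta> p - pderiv p))"
  have P: "P 0 = 1" "P (Suc k) = [:0, 0, 1:] * (smult \<delta> (P k) - pderiv (P k))" for k
    by (simp_all add: P_def)
  \<comment> \<open>The family \<open>H p\<close> is closed under differentiation, with the polynomial recursion of \<open>P\<close>.\<close>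
  define H where "H p u = (if u > 0 then poly p (1 / u) * exp (- \<delta> / u) else 0)" for p :: "real poly" and u :: real
  have H: "(H p has_real_derivative H ([:0, 0, 1:] * (smult \<delta> p - pderiv p)) u) (at u)" for p u
  proof -
    consider "u > 0" | "u < 0" | "u = 0" by linarith
    then show ?thesis
    proof cases
      case 1
      have "((\<lambda>u. poly p (1 / u) * exp (- \<delta> / u)) has_real_derivative
          H ([:0, 0, 1:] * (smult \<delta> p - pderiv p)) u) (at u)"
        using 1 by (auto intro!: derivative_eq_intros simp: H_def field_simps power2_eq_square)
      then show ?thesis
        by (rule has_field_derivative_transform_within_open[of _ _ _ "{0<..}"]) (use 1 in \<open>auto simp: H_def\<close>)
    next
      case 2
      have "((\<lambda>u. 0) has_real_derivative H ([:0, 0, 1:] * (smult \<delta> p - pderiv p)) u) (at u)"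
        using 2 by (auto simp: H_def)
      then show ?thesis
        by (rule has_field_derivative_transform_within_open[of _ _ _ "{..<0}"]) (use 2 in \<open>auto simp: H_def\<close>)
    next
      case 3
      have lim: "((\<lambda>y. poly q y * exp (- \<delta> * y)) \<longlongrightarrow> 0) at_top" for q :: "real poly"
      proof -
        have "((\<lambda>y. (\<Sum>i\<le>degree q. coeff q i * (y ^ i * exp (- \<delta> * y)))) \<longlongrightarrow> (\<Sum>i\<le>degree q. coeff q i * 0)) at_top"
        proof (intro tendsto_sum tendsto_mult_left)
          fix i
          have "((\<lambda>x. x ^ i / exp x) \<longlongrightarrow> (0::real)) at_top" by (rule tendsto_power_div_exp_0)
          moreover have "filterlim (\<lambda>y. \<delta> * y) at_top at_top"
            using \<delta> by (intro filterlim_tendsto_pos_mult_at_top[OF tendsto_const]) (auto simp: filterlim_ident)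
          ultimately have "((\<lambda>y. (\<delta> * y) ^ i / exp (\<delta> * y)) \<longlongrightarrow> 0) at_top"
            by (rule filterlim_compose)
          then have "((\<lambda>y. (1 / \<delta> ^ i) * ((\<delta> * y) ^ i / exp (\<delta> * y))) \<longlongrightarrow> (1 / \<delta> ^ i) * 0) at_top"
            by (intro tendsto_mult_left)
          then show "((\<lambda>y. y ^ i * exp (- \<delta> * y)) \<longlongrightarrow> 0) at_top"
            using \<delta> by (simp add: power_mult_distrib exp_minus field_simps)
        qed
        then show ?thesis by (simp add: poly_altdef sum_distrib_right mult.assoc)
      qed
      have right: "((\<lambda>h. H p h / h) \<longlongrightarrow> 0) (at_right 0)"
      proof -
        have "((\<lambda>h. poly ([:0, 1:] * p) (inverse h) * exp (- \<delta> * inverse h)) \<longlongrightarrow> 0) (at_right 0)"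
          by (rule filterlim_compose[OF lim filterlim_inverse_at_top_right])
        then show ?thesis
          by (rule Lim_transform_eventually)
             (auto simp: H_def eventually_at_filter field_simps intro!: always_eventually)
      qed
      have left: "((\<lambda>h. H p h / h) \<longlongrightarrow> 0) (at_left 0)"
        by (rule Lim_transform_eventually[of "\<lambda>_. 0"])
           (auto simp: H_def eventually_at_filter)
      have "((\<lambda>h. H p h / h) \<longlongrightarrow> 0) (at 0)"
        using left right by (simp add: filterlim_at_split)
      then show ?thesis using 3 by (simp add: DERIV_def H_def)
    qed
  qed
  have H1: "(H (P k) has_real_derivative H (P (Suc k)) u) (at u)" for k u
    using H[of "P k" u] by (simp add: P)
  define D where "D k u = (if k = 0 then soft_pos \<delta> u else u * H (P k) u + real k * H (P (k - 1)) u)" for k u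
  have D0: "soft_pos \<delta> u = u * H (P 0) u" for u
    by (simp add: soft_pos_def H_def P)
  have Deq: "D k u = u * H (P k) u + real k * H (P (k - 1)) u" for k u
    by (simp add: D_def D0)
  have "(D k has_real_derivative D (Suc k) u) (at u)" for k u
  proof -
    have "((\<lambda>u. u * H (P k) u + real k * H (P (k - 1)) u) has_real_derivative
        (u * H (P (Suc k)) u + H (P k) u) + real k * H (P k) u) (at u)"
      by (cases k) (auto intro!: derivative_eq_intros H1)
    then show ?thesis by (simp add: Deq[abs_def] algebra_simps)
  qed
  then show ?thesis unfolding smooth_on1_def by (intro exI[of _ D]) (auto simp: D_def[abs_def])
qed

lemma soft_pos_Lipschitz:
  assumes \<delta>: "\<delta> > 0"
  shows "\<bar>soft_pos \<delta> u - soft_pos \<delta> v\<bar> \<le> \<bar>u - v\<bar>"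
proof -
  have *: "0 \<le> soft_pos \<delta> v - soft_pos \<delta> u \<and> soft_pos \<delta> v - soft_pos \<delta> u \<le> v - u" if uv: "u < v" "0 < u" for u v
  proof -
    have d: "(soft_pos \<delta> has_real_derivative exp (- \<delta> / x) * (1 + \<delta> / x)) (at x)" if "x > 0" for x
    proof -
      have "((\<lambda>u. u * exp (- \<delta> / u)) has_real_derivative exp (- \<delta> / x) * (1 + \<delta> / x)) (at x)"
        using that by (auto intro!: derivative_eq_intros simp: field_simps power2_eq_square)
      then show ?thesis
        by (rule has_field_derivative_transform_within_open[of _ _ _ "{0<..}"]) (use that in \<open>auto simp: soft_pos_def\<close>)
    qed
    obtain z where z: "z > u" "z < v" "soft_pos \<delta> v - soft_pos \<delta> u = (v - u) * (exp (- \<delta> / z) * (1 + \<delta> / z))"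
      using MVT2[OF uv(1), of "soft_pos \<delta>" "\<lambda>x. exp (- \<delta> / x) * (1 + \<delta> / x)"] d uv by auto
    have "exp (- \<delta> / z) * (1 + \<delta> / z) \<le> exp (- \<delta> / z) * exp (\<delta> / z)"
      by (intro mult_left_mono exp_ge_add_one_self) auto
    also have "\<dots> = 1" by (simp add: mult_exp_exp)
    finally have "exp (- \<delta> / z) * (1 + \<delta> / z) \<le> 1" .
    moreover have "0 \<le> exp (- \<delta> / z) * (1 + \<delta> / z)" using \<delta> z that by auto
    ultimately show ?thesis unfolding z(3) using that
      by (auto intro: mult_left_le mult_nonneg_nonneg)
  qed
  have nn: "0 \<le> soft_pos \<delta> u" for u by (auto simp: soft_pos_def)
  have le: "soft_pos \<delta> u \<le> u" if "u > 0" for u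
    using that \<delta> by (auto simp: soft_pos_def intro!: mult_left_le)
  have z: "soft_pos \<delta> u = 0" if "u \<le> 0" for u using that by (auto simp: soft_pos_def)
  have main: "\<bar>soft_pos \<delta> u - soft_pos \<delta> v\<bar> \<le> v - u" if "u \<le> v" for u v
    using *[of u v] nn[of v] le[of v] z[of u] z[of v] that
    by (cases "u > 0"; cases "v > 0"; cases "u = v") auto
  show ?thesis using main[of u v] main[of v u] by (cases "u \<le> v") auto
qed

lemma soft_pos_approx:
  assumes \<delta>: "\<delta> > 0"
  shows "max u 0 - \<delta> \<le> soft_pos \<delta> u" "soft_pos \<delta> u \<le> max u 0"
proof -
  have "u - \<delta> \<le> u * exp (- \<delta> / u)" if "u > 0"
  proof -
    have "u * (1 + - \<delta> / u) \<le> u * exp (- \<delta> / u)"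
      using that by (intro mult_left_mono exp_ge_add_one_self) auto
    moreover have "u * (1 + - \<delta> / u) = u - \<delta>" using that by (simp add: field_simps)
    ultimately show ?thesis by simp
  qed
  then show "max u 0 - \<delta> \<le> soft_pos \<delta> u" using \<delta>
    by (auto simp: soft_pos_def)
  show "soft_pos \<delta> u \<le> max u 0" using \<delta> by (auto simp: soft_pos_def intro!: mult_left_le)
qed

text \<open>Up to the additive constant \<open>n\<close> and the sign, this is a smooth version of \<open>min (norm x) n\<close>. A constant
  cancels in \<open>f - \<mu>(f)\<close>, so the norm can be approached by test functions of compact support without
  any loss in the Lipschitz constant. The summand under the root smooths the norm at the origin.\<close>

definition norm_trunc :: "nat \<Rightarrow> real^'n \<Rightarrow> real" where
  "norm_trunc n x = soft_pos (1 / (n + 1)) (n - sqrt ((1 / (n + 1))\<^sup>2 + (norm x)\<^sup>2))"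

lemma norm_trunc_smooth: "smooth_compact_support (\<lambda>x. c * norm_trunc n x)"
proof -
  let ?e = "1 / (real n + 1)"
  have e: "?e > 0" by simp
  have "smooth_fun (\<lambda>x :: real^'n. sqrt (?e\<^sup>2 + (norm x)\<^sup>2))"
    by (rule times_cont_diff_comp1[OF smooth_on1_sqrt])
       (auto intro!: smooth_fun_add smooth_fun_const smooth_fun_norm_sq add_pos_nonneg)
  then have "smooth_fun (\<lambda>x :: real^'n. real n + (- 1) * sqrt (?e\<^sup>2 + (norm x)\<^sup>2))"
    by (intro smooth_fun_add smooth_fun_mult smooth_fun_const)
  from times_cont_diff_comp1[OF soft_pos_smooth[OF e] this]
  have "smooth_fun (norm_trunc n :: real^'n \<Rightarrow> real)"
    by (simp add: norm_trunc_def[abs_def])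
  then have "smooth_fun (\<lambda>x. c * norm_trunc n x)" by (intro smooth_fun_mult smooth_fun_const)
  moreover have "compact (closure {x :: real^'n. c * norm_trunc n x \<noteq> 0})"
  proof -
    have "{x :: real^'n. c * norm_trunc n x \<noteq> 0} \<subseteq> cball 0 n"
    proof
      fix x :: "real^'n" assume "x \<in> {x. c * norm_trunc n x \<noteq> 0}"
      then have "sqrt (?e\<^sup>2 + (norm x)\<^sup>2) < n" by (auto simp: norm_trunc_def soft_pos_def split: if_splits)
      moreover have "norm x \<le> sqrt (?e\<^sup>2 + (norm x)\<^sup>2)" by (rule real_le_rsqrt) simp
      ultimately have "norm x < n" by linarith
      then show "x \<in> cball 0 n" by simp
    qed
    then show ?thesis using bounded_subset[OF bounded_cball] by (simp only: compact_closure)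
  qed
  ultimately show ?thesis by (simp add: smooth_compact_support_def smooth_fun_def)
qed

lemma norm_trunc_Lipschitz: "1-lipschitz_on UNIV (norm_trunc n)"
proof (rule lipschitz_onI)
  fix x y :: "real^'n"
  let ?e = "1 / (real n + 1)"
  have s: "sqrt (?e\<^sup>2 + u\<^sup>2) - sqrt (?e\<^sup>2 + v\<^sup>2) \<le> \<bar>u - v\<bar>" for u v
    using real_sqrt_sum_squares_triangle_ineq[of ?e 0 v "u - v"] by simp
  have "\<bar>norm_trunc n x - norm_trunc n y\<bar> \<le>
     \<bar>(n - sqrt (?e\<^sup>2 + (norm x)\<^sup>2)) - (n - sqrt (?e\<^sup>2 + (norm y)\<^sup>2))\<bar>"
    unfolding norm_trunc_def by (rule soft_pos_Lipschitz) simp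
  also have "\<dots> \<le> \<bar>norm x - norm y\<bar>"
    using s[of "norm x" "norm y"] s[of "norm y" "norm x"] by (simp add: abs_if split: if_splits)
  also have "\<dots> \<le> norm (x - y)" by (rule norm_triangle_ineq3)
  finally show "dist (norm_trunc n x) (norm_trunc n y) \<le> 1 * dist x y" by (simp add: dist_norm)
qed simp

lemma norm_trunc_bounds:
  "min (norm x) n \<le> n - norm_trunc n x" "n - norm_trunc n x \<le> min (norm x) n + 2 / (real n + 1)"
proof -
  let ?e = "1 / (real n + 1)"
  let ?r = "sqrt (?e\<^sup>2 + (norm x)\<^sup>2)"
  have "norm x \<le> ?r" by (rule real_le_rsqrt) simp
  moreover have "?r \<le> ?e + norm x" using sqrt_add_le_add_sqrt[of "?e\<^sup>2" "(norm x)\<^sup>2"] by simp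
  moreover have "max (n - ?r) 0 - ?e \<le> norm_trunc n x" "norm_trunc n x \<le> max (n - ?r) 0"
    unfolding norm_trunc_def by (rule soft_pos_approx, simp)+
  moreover have "2 / (real n + 1) = ?e + ?e" "?e > 0" by auto
  ultimately show "min (norm x) n \<le> n - norm_trunc n x" "n - norm_trunc n x \<le> min (norm x) n + 2 / (real n + 1)"
    by linarith+
qed

lemma norm_trunc_tendsto: "(\<lambda>n. n - norm_trunc n x) \<longlonglongrightarrow> norm x"
proof (rule tendsto_sandwich)
  obtain N :: nat where N: "norm x \<le> N" using real_arch_simple by blast
  show "\<forall>\<^sub>F n in sequentially. norm x \<le> n - norm_trunc n x"
    using eventually_ge_at_top[of N]
  proof eventually_elim
    case (elim n)
    then have "norm x \<le> n" using N by linarith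
    then show ?case using norm_trunc_bounds(1)[of x n] by simp
  qed
  show "\<forall>\<^sub>F n in sequentially. n - norm_trunc n x \<le> norm x + 2 * inverse (real (Suc n))"
  proof (intro always_eventually allI)
    fix n
    have "min (norm x) (real n) + 2 / (real n + 1) \<le> norm x + 2 * inverse (real (Suc n))"
    proof -
      have "2 / (real n + 1) = 2 * inverse (real (Suc n))" by (simp add: field_simps)
      then show ?thesis by simp
    qed
    then show "n - norm_trunc n x \<le> norm x + 2 * inverse (real (Suc n))"
      using norm_trunc_bounds(2)[of n x] by linarith
  qed
  show "(\<lambda>n. norm x + 2 * inverse (real (Suc n))) \<longlonglongrightarrow> norm x"
    using tendsto_add[OF tendsto_const[of "norm x"] tendsto_mult_right_zero[OF LIMSEQ_inverse_real_of_nat, of 2]] by simp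
qed simp

section \<open>Gaussian moments of the initial law\<close>

text \<open>The bound is tested on multiples of \<open>norm_trunc n\<close> and then \<open>n\<close> tends to infinity. Integrability of the
  norm has to be derived first. For \<open>c = - 1\<close>, the bound restricted to a ball of measure above \<open>1/2\<close>
  keeps the means of the truncations bounded; Fatou's lemma then shows that the norm is integrable,
  and dominated convergence identifies the limit of the means.\<close>

lemma GCBS_Laplace_norm:
  fixes \<mu> :: "(real^'n) measure"
  assumes "prob_space \<mu>" and sM: "sets \<mu> = sets borel" and D: "D \<ge> 0" and G: "GCBS \<mu> D"
  shows "(\<integral>\<^sup>+x. ennreal (exp (c * (norm x - (\<integral>x. norm x \<partial>\<mu>)))) \<partial>\<mu>) \<le> ennreal (exp (D * c\<^sup>2))"
proof -
  interpret prob_space \<mu> by fact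
  have [measurable_cong]: "sets \<mu> = sets borel" by (fact sM)
  define g where "g n x = n - norm_trunc n x" for n :: nat and x :: "real^'n"
  have nt [measurable]: "norm_trunc n \<in> borel_measurable borel" for n
    by (intro borel_measurable_continuous_onI lipschitz_on_continuous_on[OF norm_trunc_Lipschitz])
  have gm [measurable]: "g n \<in> borel_measurable borel" for n unfolding g_def by measurable
  have g0: "0 \<le> g n x" and g2: "g n x \<le> norm x + 2" and gn: "g n x \<le> real n + 2" for n :: nat and x
  proof -
    have "2 / (real n + 1) \<le> 2" by (simp add: field_simps)
    moreover have "min (norm x) n \<le> g n x" "g n x \<le> min (norm x) n + 2 / (real n + 1)"
      unfolding g_def by (rule norm_trunc_bounds)+
    moreover have "0 \<le> min (norm x) n" "min (norm x) n \<le> norm x" "min (norm x) n \<le> n" by auto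
    ultimately show "0 \<le> g n x" "g n x \<le> norm x + 2" "g n x \<le> real n + 2" by linarith+
  qed
  have gi: "integrable \<mu> (g n)" for n
  proof (rule integrable_const_bound)
    show "AE x in \<mu>. norm (g n x) \<le> real n + 2"
      using g0 gn by (intro AE_I2) simp
  qed simp
  have ni: "integrable \<mu> (norm_trunc n)" for n
    using Bochner_Integration.integrable_diff[OF integrable_const[of n] gi[of n]] by (simp add: g_def)
  define m where "m n = (\<integral>x. g n x \<partial>\<mu>)" for n
  have mn: "m n = n - (\<integral>x. norm_trunc n x \<partial>\<mu>)" for n
    unfolding m_def g_def using ni by (subst Bochner_Integration.integral_diff) (auto simp: prob_space)
  have E: "(\<integral>\<^sup>+x. ennreal (exp (c * (g n x - m n))) \<partial>\<mu>) \<le> ennreal (exp (D * c\<^sup>2))" for n c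
  proof -
    define f where "f x = (- c) * norm_trunc n x" for x :: "real^'n"
    have lf: "\<bar>c\<bar>-lipschitz_on UNIV f"
      using lipschitz_on_cmult_real[OF norm_trunc_Lipschitz, of "- c"] unfolding f_def by simp
    have "exp_moment_bound \<mu> D f"
      using G norm_trunc_smooth unfolding GCBS_def f_def by blast
    moreover have "f x - (\<integral>y. f y \<partial>\<mu>) = c * (g n x - m n)" for x
      unfolding f_def mn by (simp add: g_def algebra_simps)
    ultimately have i: "integrable \<mu> (\<lambda>x. exp (c * (g n x - m n)))"
      and l: "ln (\<integral>x. exp (c * (g n x - m n)) \<partial>\<mu>) \<le> D * (lip f)\<^sup>2"
      by (auto simp: exp_moment_bound_def)
    let ?I = "\<integral>x. exp (c * (g n x - m n)) \<partial>\<mu>"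
    have "lip f \<le> \<bar>c\<bar>" "0 \<le> lip f" using lip_bounds[OF lf] by auto
    then have "(lip f)\<^sup>2 \<le> c\<^sup>2" by (metis power_mono power2_abs)
    then have l2: "ln ?I \<le> D * c\<^sup>2" using l D mult_left_mono[of "(lip f)\<^sup>2" "c\<^sup>2" D] by linarith
    have "0 \<le> ?I" by simp
    then consider "?I = 0" | "?I > 0" by linarith
    then have "?I \<le> exp (D * c\<^sup>2)"
    proof cases
      case 2
      then show ?thesis using l2 by (metis exp_le_cancel_iff exp_ln)
    qed simp
    then show ?thesis using i by (simp add: nn_integral_eq_integral)
  qed
  have "\<exists>K. \<forall>n. m n \<le> K"
  proof -
    have "(\<lambda>k. prob (cball 0 (real k))) \<longlonglongrightarrow> prob (\<Union>k. cball 0 (real k))"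
      by (rule finite_Lim_measure_incseq) (auto simp: incseq_def)
    moreover have "(\<Union>k. cball (0::real^'n) (real k)) = space \<mu>"
      using real_arch_simple sets_eq_imp_space_eq[OF sM] by auto
    ultimately have "(\<lambda>k. prob (cball 0 (real k))) \<longlonglongrightarrow> 1" by (simp add: prob_space)
    then have "\<forall>\<^sub>F k in sequentially. prob (cball 0 (real k)) > 1/2"
      by (rule order_tendstoD) simp
    then obtain k :: nat where k: "prob (cball 0 (real k)) > 1/2"
      by (auto simp: eventually_sequentially)
    have "m n \<le> k + 2 + D + ln 2" for n
    proof -
      have "ennreal (exp (m n - (k + 2)) / 2) \<le> ennreal (exp (m n - (k + 2))) * emeasure \<mu> (cball 0 k)"
        using k by (simp add: emeasure_eq_measure ennreal_mult[symmetric])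
      also have "\<dots> = (\<integral>\<^sup>+x. ennreal (exp (m n - (k + 2))) * indicator (cball 0 (real k)) x \<partial>\<mu>)"
        by (subst nn_integral_cmult_indicator) auto
      also have "\<dots> \<le> (\<integral>\<^sup>+x. ennreal (exp ((- 1) * (g n x - m n))) \<partial>\<mu>)"
      proof (intro nn_integral_mono)
        fix x
        show "ennreal (exp (m n - (k + 2))) * indicator (cball 0 (real k)) x \<le> ennreal (exp ((- 1) * (g n x - m n)))"
          using g2[of n x] by (auto simp: indicator_def)
      qed
      also have "\<dots> \<le> ennreal (exp (D * (- 1)\<^sup>2))" by (rule E)
      finally have "exp (m n - (k + 2)) \<le> 2 * exp D" by simp
      also have "\<dots> = exp (ln 2 + D)" by (simp add: exp_add)
      finally show ?thesis by simp
    qed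
    then show ?thesis by blast
  qed
  then obtain K where K: "\<And>n. m n \<le> K" by blast
  have gt: "(\<lambda>n. g n x) \<longlonglongrightarrow> norm x" for x unfolding g_def by (rule norm_trunc_tendsto)
  have "(\<integral>\<^sup>+x. ennreal (norm x) \<partial>\<mu>) \<le> ennreal K"
    by (rule nn_integral_le_of_AE_limit[where f = "\<lambda>n x. ennreal (g n x)"])
       (use gi K in \<open>simp_all add: gt nn_integral_eq_integral g0 m_def ennreal_leI\<close>)
  then have "integrable \<mu> norm"
    by (intro integrableI_bounded) (auto simp: top_unique less_top[symmetric])
  have mt: "m \<longlonglongrightarrow> (\<integral>x. norm x \<partial>\<mu>)"
    unfolding m_def
    by (rule integral_dominated_convergence[where w = "\<lambda>x. norm x + 2"])
       (use \<open>integrable \<mu> norm\<close> in \<open>auto simp: gt g0 g2\<close>)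
  show ?thesis
  proof (rule nn_integral_le_of_AE_limit[OF _ _ E])
    show "AE x in \<mu>. (\<lambda>n. ennreal (exp (c * (g n x - m n)))) \<longlonglongrightarrow>
        ennreal (exp (c * (norm x - (\<integral>x. norm x \<partial>\<mu>))))"
      by (intro AE_I2 tendsto_intros gt mt)
  qed simp
qed

text \<open>The Laplace bound is averaged over a centred Gaussian parameter of variance \<open>4 * a\<close>, which gives
  \<open>1 / sqrt (1 - 8 * a * D) \<le> sqrt 2\<close> for the moment of \<open>exp (2 * a * (norm x - m)\<^sup>2)\<close>. Centring is
  undone by \<open>(norm x)\<^sup>2 \<le> 2 * (norm x - m)\<^sup>2 + 2 * m\<^sup>2\<close>.\<close>

theorem GCBS_square_exponential_moment:
  fixes \<mu> :: "(real^'n) measure"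
  assumes "prob_space \<mu>" and sM: "sets \<mu> = sets borel" and D: "D > 0" and G: "GCBS \<mu> D"
    and a: "0 < a" "a \<le> 1 / (16 * D)"
  shows "(\<integral>\<^sup>+x. ennreal (sqexp a x) \<partial>\<mu>) \<le>
    ennreal (3 * exp ((\<integral>x. norm x \<partial>\<mu>)\<^sup>2 / (8 * D)))"
proof -
  interpret prob_space \<mu> by fact
  have [measurable_cong]: "sets \<mu> = sets borel" by (fact sM)
  define m where "m = (\<integral>x. norm x \<partial>\<mu>)"
  define r where "r = sqrt (2 * (2 * a))"
  have r2: "r\<^sup>2 = 4 * a" using a by (simp add: r_def)
  have aD: "a * D \<le> 1 / 16" using a(2) D by (simp add: field_simps)
  have "(\<integral>\<^sup>+x. ennreal (exp (2 * a * (norm x - m)\<^sup>2)) \<partial>\<mu>) =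
      (\<integral>\<^sup>+x. (\<integral>\<^sup>+g. ennreal (exp (r * g * (norm x - m)) * normal_density 0 1 g) \<partial>lborel) \<partial>\<mu>)"
    using a by (simp add: exp_square_eq_normal_integral r_def)
  also have "\<dots> = (\<integral>\<^sup>+g. (\<integral>\<^sup>+x. ennreal (exp (r * g * (norm x - m)) * normal_density 0 1 g) \<partial>\<mu>) \<partial>lborel)"
    by (rule pair_sigma_finite.Fubini'[symmetric])
       (auto intro!: pair_sigma_finite.intro sigma_finite_measure_axioms sigma_finite_lborel)
  also have "\<dots> = (\<integral>\<^sup>+g. (\<integral>\<^sup>+x. ennreal (exp (r * g * (norm x - m))) \<partial>\<mu>) * ennreal (normal_density 0 1 g) \<partial>lborel)"
    by (simp add: ennreal_mult nn_integral_multc)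
  also have "\<dots> \<le> (\<integral>\<^sup>+g. ennreal (exp (D * (r * g)\<^sup>2)) * ennreal (normal_density 0 1 g) \<partial>lborel)"
    unfolding m_def using assms by (intro nn_integral_mono mult_right_mono GCBS_Laplace_norm) auto
  also have "\<dots> = (\<integral>\<^sup>+g. ennreal (exp (0 * g + 4 * a * D * g\<^sup>2) * normal_density 0 1 g) \<partial>lborel)"
    by (simp add: ennreal_mult power_mult_distrib r2 mult_ac)
  also have "\<dots> = ennreal (1 / sqrt (1 - 8 * (a * D)))"
    using aD by (subst nn_integral_exp_quadratic_normal) (simp_all add: mult.assoc)
  also have "\<dots> \<le> ennreal 3"
  proof (rule ennreal_leI)
    have "1 / 3 = sqrt (1 / 9)" by (simp add: real_sqrt_divide)
    also have "\<dots> \<le> sqrt (1 - 8 * (a * D))" using aD by (intro real_sqrt_le_mono) linarith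
    finally have "1 / 3 \<le> sqrt (1 - 8 * (a * D))" .
    moreover from this have "0 < sqrt (1 - 8 * (a * D))" by linarith
    ultimately show "1 / sqrt (1 - 8 * (a * D)) \<le> 3" by (simp add: pos_divide_le_eq)
  qed
  finally have b: "(\<integral>\<^sup>+x. ennreal (exp (2 * a * (norm x - m)\<^sup>2)) \<partial>\<mu>) \<le> ennreal 3" .
  have "(\<integral>\<^sup>+x. ennreal (sqexp a x) \<partial>\<mu>) \<le>
      (\<integral>\<^sup>+x. ennreal (exp (m\<^sup>2 / (8 * D))) * ennreal (exp (2 * a * (norm x - m)\<^sup>2)) \<partial>\<mu>)"
  proof (intro nn_integral_mono)
    fix x
    have "0 \<le> a * (norm x - 2 * m)\<^sup>2" using a by simp
    then have "a * (norm x)\<^sup>2 \<le> 2 * a * m\<^sup>2 + 2 * a * (norm x - m)\<^sup>2"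
      by (simp add: power2_eq_square algebra_simps)
    also have "2 * a * m\<^sup>2 \<le> 2 * (1 / (16 * D)) * m\<^sup>2"
      using a by (intro mult_right_mono) auto
    finally have "a * (norm x)\<^sup>2 \<le> m\<^sup>2 / (8 * D) + 2 * a * (norm x - m)\<^sup>2" by simp
    then show "ennreal (sqexp a x) \<le> ennreal (exp (m\<^sup>2 / (8 * D))) * ennreal (exp (2 * a * (norm x - m)\<^sup>2))"
      by (simp add: ennreal_mult[symmetric] exp_add[symmetric])
  qed
  also have "\<dots> \<le> ennreal (exp (m\<^sup>2 / (8 * D))) * ennreal 3"
    using b by (simp add: nn_integral_cmult mult_left_mono)
  also have "\<dots> = ennreal (3 * exp (m\<^sup>2 / (8 * D)))" by (simp add: ennreal_mult mult.commute)
  finally show ?thesis by (simp add: m_def)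
qed

section \<open>The exponential martingale of Brownian motion\<close>

lemma continuous_on_matrix_vector_mult:
  "continuous_on S f \<Longrightarrow> continuous_on S g \<Longrightarrow> continuous_on S (\<lambda>x. (f x :: real^'n^'m) *v g x)"
  unfolding matrix_vector_mult_def by (intro continuous_on_vec_lambda continuous_intros)

lemma continuous_on_vector_matrix_mult:
  "continuous_on S g \<Longrightarrow> continuous_on S (\<lambda>x. v v* (g x :: real^'n^'m))"
  unfolding vector_matrix_mult_def by (intro continuous_on_vec_lambda continuous_intros)

lemma measurable_matrix_vector_mult [measurable]:
  assumes "f \<in> borel_measurable M" "g \<in> borel_measurable M"
  shows "(\<lambda>x. (f x :: real^'n^'m) *v g x) \<in> borel_measurable M"
  using assms by (rule borel_measurable_continuous_Pair)
    (intro continuous_on_matrix_vector_mult continuous_intros)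

lemma measurable_vector_matrix_mult [measurable]:
  assumes "g \<in> borel_measurable M"
  shows "(\<lambda>x. v v* (g x :: real^'n^'m)) \<in> borel_measurable M"
  by (rule measurable_compose[OF assms])
    (intro borel_measurable_continuous_onI continuous_on_vector_matrix_mult continuous_intros)

lemma norm_matrix_vector_mult_le: "norm (A *v x) \<le> norm A * norm x" for A :: "real^'n^'m"
proof (rule power2_le_imp_le)
  have "(norm (A *v x))\<^sup>2 = (\<Sum>i\<in>UNIV. ((A $ i) \<bullet> x)\<^sup>2)"
    by (simp add: norm_vec_sq matrix_vector_mul_component)
  also have "\<dots> \<le> (\<Sum>i\<in>UNIV. (norm (A $ i))\<^sup>2 * (norm x)\<^sup>2)"
    using Cauchy_Schwarz_ineq[of _ x] by (intro sum_mono) (simp add: power2_norm_eq_inner)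
  also have "\<dots> = (norm A * norm x)\<^sup>2"
    by (simp add: norm_vec_def[of A] L2_set_def power_mult_distrib sum_nonneg sum_distrib_right)
  finally show "(norm (A *v x))\<^sup>2 \<le> (norm A * norm x)\<^sup>2" .
qed simp

lemma norm_vector_matrix_mult_le: "norm (v v* A) \<le> norm A * norm v" for A :: "real^'n^'m"
proof (cases "v v* A = 0")
  case False
  have "norm (v v* A) * norm (v v* A) = v \<bullet> (A *v (v v* A))"
    using power2_norm_eq_inner[of "v v* A"] unfolding power2_eq_square by (simp only: dot_lmul_matrix)
  also have "\<dots> \<le> norm v * norm (A *v (v v* A))" by (rule norm_cauchy_schwarz)
  also have "\<dots> \<le> norm v * (norm A * norm (v v* A))"
    by (intro mult_left_mono norm_matrix_vector_mult_le) auto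
  finally show ?thesis using False by (simp add: mult_ac)
qed simp

locale filtered_brownian_motion = prob_space M for M :: "'w measure" +
  fixes F :: "real \<Rightarrow> 'w measure" and W :: "real \<Rightarrow> 'w \<Rightarrow> real^'n"
  assumes filt: "filtration_on M F" and bm: "brownian_motion M F W"
begin

lemma subalg: "0 \<le> s \<Longrightarrow> subalgebra M (F s)"
  and subalg_mono: "0 \<le> s \<Longrightarrow> s \<le> t \<Longrightarrow> subalgebra (F t) (F s)"
  using filt by (auto simp: filtration_on_def)

lemma measurable_F_M: "0 \<le> s \<Longrightarrow> f \<in> measurable (F s) N \<Longrightarrow> f \<in> measurable M N"
  using subalg measurable_from_subalg by blast

lemma measurable_F_mono: "0 \<le> s \<Longrightarrow> s \<le> t \<Longrightarrow> f \<in> measurable (F s) N \<Longrightarrow> f \<in> measurable (F t) N"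
  using subalg_mono measurable_from_subalg by blast

lemma W_measurable: "0 \<le> s \<Longrightarrow> W s \<in> borel_measurable (F s)"
  using bm by (auto simp: brownian_motion_def adapted_def)

text \<open>Since \<open>(Y, u)\<close> is measurable with respect to the past and the increment is independent of it,
  Fubini's theorem permits freezing \<open>(Y, u)\<close>; what remains is the Laplace transform of a centred
  Gaussian vector.\<close>

lemma increment_exp_moment:
  assumes s: "0 \<le> s" "s \<le> t" and Y: "Y \<in> borel_measurable (F s)" and u: "u \<in> borel_measurable (F s)"
  shows "(\<integral>\<^sup>+\<omega>. Y \<omega> * ennreal (exp (u \<omega> \<bullet> (W t \<omega> - W s \<omega>) - (t - s) / 2 * (norm (u \<omega>))\<^sup>2)) \<partial>M) =
    (\<integral>\<^sup>+\<omega>. Y \<omega> \<partial>M)"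
proof (cases "s = t")
  case True then show ?thesis by simp
next
  case False
  then have st: "s < t" using s by simp
  let ?D = "\<lambda>\<omega>. W t \<omega> - W s \<omega>"
  let ?g = "\<lambda>x. ennreal (gauss_density (sqrt (t - s)) x)"
  have D: "distributed M lborel ?D ?g"
    and ind: "indep_set (sets (F s)) (sets (vimage_algebra (space M) ?D borel))"
    using bm s st by (auto simp: brownian_motion_def)
  have [measurable]: "?D \<in> borel_measurable M" using distributed_measurable[OF D] by simp
  have [measurable]: "Y \<in> borel_measurable M" "u \<in> borel_measurable M"
    using Y u s by (auto intro: measurable_F_M)
  let ?X = "\<lambda>\<omega>. (Y \<omega>, u \<omega>)"
  \<comment> \<open>The predicate \<open>indep_var\<close> relates variables of one type; a constant first component lifts the
    increment to the type of \<open>(Y, u)\<close>.\<close>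
  let ?D' = "\<lambda>\<omega>. (0 :: ennreal, ?D \<omega>)"
  let ?B = "borel \<Otimes>\<^sub>M borel :: (ennreal \<times> (real^'n)) measure"
  have sub: "sigma_sets (space M) {f -` A \<inter> space M |A. A \<in> sets ?B} \<subseteq> sets G"
    if f: "f \<in> measurable G ?B" and sp: "space G = space M" for f G
  proof -
    have "{f -` A \<inter> space M |A. A \<in> sets ?B} \<subseteq> sets G"
      using measurable_sets[OF f] unfolding sp by blast
    from sets.sigma_sets_subset[OF this] show ?thesis unfolding sp .
  qed
  have subX: "sigma_sets (space M) {?X -` A \<inter> space M |A. A \<in> sets ?B} \<subseteq> sets (F s)"
    using Y u subalg[OF s(1)] by (intro sub) (auto simp: subalgebra_def)
  have "?D \<in> measurable (vimage_algebra (space M) ?D borel) borel"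
    by (rule measurable_vimage_algebra1) simp
  then have subD: "sigma_sets (space M) {?D' -` A \<inter> space M |A. A \<in> sets ?B} \<subseteq>
      sets (vimage_algebra (space M) ?D borel)"
    by (intro sub measurable_Pair) auto
  have "indep_var ?B ?X ?B ?D'"
    unfolding indep_var_eq
  proof (intro conjI)
    show "indep_set (sigma_sets (space M) {?X -` A \<inter> space M |A. A \<in> sets ?B})
      (sigma_sets (space M) {?D' -` A \<inter> space M |A. A \<in> sets ?B})"
      using ind unfolding indep_set_def
      by (rule indep_sets_mono_sets) (use subX subD in \<open>auto split: bool.split\<close>)
  qed simp_all
  then have eq: "distr M ?B ?X \<Otimes>\<^sub>M distr M ?B ?D' = distr M (?B \<Otimes>\<^sub>M ?B) (\<lambda>\<omega>. (?X \<omega>, ?D' \<omega>))"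
    by (simp add: indep_var_distribution_eq)
  interpret D: prob_space "distr M ?B ?D'" by (rule prob_space_distr) simp
  define h :: "(ennreal \<times> (real^'n)) \<times> (ennreal \<times> (real^'n)) \<Rightarrow> ennreal"
    where "h = (\<lambda>p. fst (fst p) *
      ennreal (exp (snd (fst p) \<bullet> snd (snd p) - (t - s) / 2 * (norm (snd (fst p)))\<^sup>2)))"
  have hm [measurable]: "h \<in> borel_measurable (?B \<Otimes>\<^sub>M ?B)"
    unfolding h_def by measurable
  have "(\<integral>\<^sup>+\<omega>. Y \<omega> * ennreal (exp (u \<omega> \<bullet> ?D \<omega> - (t - s) / 2 * (norm (u \<omega>))\<^sup>2)) \<partial>M) =
      (\<integral>\<^sup>+p. h p \<partial>distr M (?B \<Otimes>\<^sub>M ?B) (\<lambda>\<omega>. (?X \<omega>, ?D' \<omega>)))"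
    by (subst nn_integral_distr) (auto simp: h_def)
  also have "\<dots> = (\<integral>\<^sup>+x. \<integral>\<^sup>+d. h (x, d) \<partial>distr M ?B ?D' \<partial>distr M ?B ?X)"
    unfolding eq[symmetric] by (subst D.nn_integral_fst[symmetric]) auto
  also have "\<dots> = (\<integral>\<^sup>+\<omega>. \<integral>\<^sup>+d. h (?X \<omega>, d) \<partial>distr M ?B ?D' \<partial>M)"
    by (subst nn_integral_distr) auto
  also have "\<dots> = (\<integral>\<^sup>+\<omega>. Y \<omega> \<partial>M)"
  proof (rule nn_integral_cong)
    fix \<omega>
    have k: "sqrt (t - s) > 0" "(sqrt (t - s))\<^sup>2 = t - s" using st by auto
    let ?c = "(t - s) / 2 * (norm (u \<omega>))\<^sup>2"
    have "(\<integral>\<^sup>+d. h (?X \<omega>, d) \<partial>distr M ?B ?D') =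
        (\<integral>\<^sup>+\<omega>'. Y \<omega> * ennreal (exp (u \<omega> \<bullet> ?D \<omega>' - ?c)) \<partial>M)"
      by (subst nn_integral_distr) (auto simp: h_def)
    also have "\<dots> = (\<integral>\<^sup>+d. ?g d * (Y \<omega> * ennreal (exp (u \<omega> \<bullet> d - ?c))) \<partial>lborel)"
      by (rule distributed_nn_integral[OF D, symmetric]) simp
    also have "\<dots> = (\<integral>\<^sup>+d. (Y \<omega> * ennreal (exp (- ?c))) *
         ennreal (exp (u \<omega> \<bullet> d + 0 * (norm d)\<^sup>2) * gauss_density (sqrt (t - s)) d) \<partial>lborel)"
    proof (intro nn_integral_cong)
      fix d :: "real^'n"
      have "exp (u \<omega> \<bullet> d - ?c) = exp (- ?c) * exp (u \<omega> \<bullet> d)" by (simp add: mult_exp_exp)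
      moreover have "0 \<le> gauss_density (sqrt (t - s)) d" by (simp add: prod_nonneg)
      ultimately show "?g d * (Y \<omega> * ennreal (exp (u \<omega> \<bullet> d - ?c))) = (Y \<omega> * ennreal (exp (- ?c))) *
         ennreal (exp (u \<omega> \<bullet> d + 0 * (norm d)\<^sup>2) * gauss_density (sqrt (t - s)) d)"
        by (simp only: ennreal_mult exp_ge_zero mult_zero_left add_0_right mult_ac)
    qed
    also have "\<dots> = Y \<omega> * ennreal (exp (- ?c)) *
        (\<integral>\<^sup>+d. ennreal (exp (u \<omega> \<bullet> d + 0 * (norm d)\<^sup>2) * gauss_density (sqrt (t - s)) d) \<partial>lborel)"
      by (rule nn_integral_cmult) simp
    also have "(\<integral>\<^sup>+d. ennreal (exp (u \<omega> \<bullet> d + 0 * (norm d)\<^sup>2) * gauss_density (sqrt (t - s)) d) \<partial>lborel) =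
        ennreal (exp ?c)"
      using k by (subst nn_integral_exp_quadratic_gauss) auto
    also have "Y \<omega> * ennreal (exp (- ?c)) * ennreal (exp ?c) = Y \<omega>"
      by (simp add: mult.assoc ennreal_mult[symmetric] mult_exp_exp)
    finally show "(\<integral>\<^sup>+d. h (?X \<omega>, d) \<partial>distr M ?B ?D') = Y \<omega>" .
  qed
  finally show ?thesis .
qed

definition grid_integral ::
  "(nat \<Rightarrow> real) \<Rightarrow> (nat \<Rightarrow> 'w \<Rightarrow> real^'n^'m) \<Rightarrow> nat \<Rightarrow> nat \<Rightarrow> 'w \<Rightarrow> real^'m" where
  "grid_integral q \<psi> m n \<omega> = (\<Sum>j\<in>{m..<n}. \<psi> j \<omega> *v (W (q (Suc j)) \<omega> - W (q j) \<omega>))"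

lemma grid_integral_measurable:
  assumes "mono q" "0 \<le> q m" "\<And>j. m \<le> j \<Longrightarrow> j < n \<Longrightarrow> \<psi> j \<in> borel_measurable (F (q j))" "m \<le> n"
  shows "grid_integral q \<psi> m n \<in> borel_measurable (F (q n))"
proof -
  have "(\<lambda>\<omega>. \<psi> j \<omega> *v (W (q (Suc j)) \<omega> - W (q j) \<omega>)) \<in> borel_measurable (F (q n))" if "j \<in> {m..<n}" for j
  proof -
    have q: "0 \<le> q j" "q j \<le> q n" "q (Suc j) \<le> q n" "0 \<le> q (Suc j)"
      using assms(2) monoD[OF assms(1), of m j] monoD[OF assms(1), of j n]
        monoD[OF assms(1), of "Suc j" n] monoD[OF assms(1), of m "Suc j"] that by auto
    have [measurable]: "\<psi> j \<in> borel_measurable (F (q n))" "W (q j) \<in> borel_measurable (F (q n))"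
      "W (q (Suc j)) \<in> borel_measurable (F (q n))"
      using that assms(3) W_measurable q
      by (auto intro: measurable_F_mono[OF q(1,2)] measurable_F_mono[OF q(4,3)])
    show ?thesis by measurable
  qed
  then show ?thesis unfolding grid_integral_def[abs_def] by (rule borel_measurable_sum)
qed

lemma grid_square_measurable:
  fixes f :: "nat \<Rightarrow> 'w \<Rightarrow> 'b::{real_normed_vector, second_countable_topology}"
  assumes "mono q" "0 \<le> q m" "\<And>j. m \<le> j \<Longrightarrow> j < n \<Longrightarrow> f j \<in> borel_measurable (F (q j))"
  shows "(\<lambda>\<omega>. \<Sum>j\<in>{m..<n}. (q (Suc j) - q j) * (norm (f j \<omega>))\<^sup>2) \<in> borel_measurable (F (q n))"
proof (rule borel_measurable_sum)
  fix j assume j: "j \<in> {m..<n}"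
  have q: "0 \<le> q j" "q j \<le> q n"
    using assms(2) monoD[OF assms(1), of m j] monoD[OF assms(1), of j n] j by auto
  have [measurable]: "f j \<in> borel_measurable (F (q n))"
    using j assms(3) by (auto intro: measurable_F_mono[OF q(1,2)])
  show "(\<lambda>\<omega>. (q (Suc j) - q j) * (norm (f j \<omega>))\<^sup>2) \<in> borel_measurable (F (q n))" by measurable
qed

text \<open>Each grid interval contributes a factor whose conditional expectation given the past is one. The
  weight \<open>Z\<close> turns the statement into one about conditional expectations given the time \<open>q m\<close>.\<close>

lemma grid_exponential_martingale:
  assumes q: "mono q" "0 \<le> q m" and \<psi>: "\<And>j. m \<le> j \<Longrightarrow> j < n \<Longrightarrow> \<psi> j \<in> borel_measurable (F (q j))"
    and Z: "Z \<in> borel_measurable (F (q m))" and mn: "m \<le> n"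
  shows "(\<integral>\<^sup>+\<omega>. Z \<omega> * ennreal (exp (v \<bullet> grid_integral q \<psi> m n \<omega> -
      (\<Sum>j\<in>{m..<n}. (q (Suc j) - q j) * (norm (v v* \<psi> j \<omega>))\<^sup>2) / 2)) \<partial>M) = (\<integral>\<^sup>+\<omega>. Z \<omega> \<partial>M)"
  using mn \<psi>
proof (induction n rule: dec_induct)
  case base
  then show ?case by (simp add: grid_integral_def)
next
  case (step n)
  let ?R = "\<lambda>n \<omega>. \<Sum>j\<in>{m..<n}. (q (Suc j) - q j) * (norm (v v* \<psi> j \<omega>))\<^sup>2"
  let ?Y = "\<lambda>\<omega>. Z \<omega> * ennreal (exp (v \<bullet> grid_integral q \<psi> m n \<omega> - ?R n \<omega> / 2))"
  have qn: "0 \<le> q n" "q m \<le> q n" "q n \<le> q (Suc n)"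
    using q(2) monoD[OF q(1), of m n] monoD[OF q(1), of n "Suc n"] step.hyps by auto
  have [measurable]: "Z \<in> borel_measurable (F (q n))" by (rule measurable_F_mono[OF q(2) qn(2) Z])
  have [measurable]: "\<psi> n \<in> borel_measurable (F (q n))" using step by auto
  have [measurable]: "grid_integral q \<psi> m n \<in> borel_measurable (F (q n))"
    using q step by (intro grid_integral_measurable) auto
  have [measurable]: "?R n \<in> borel_measurable (F (q n))"
    using q step.prems by (intro grid_square_measurable) (auto intro!: measurable_vector_matrix_mult)
  have "(\<integral>\<^sup>+\<omega>. Z \<omega> * ennreal (exp (v \<bullet> grid_integral q \<psi> m (Suc n) \<omega> - ?R (Suc n) \<omega> / 2)) \<partial>M) =
     (\<integral>\<^sup>+\<omega>. ?Y \<omega> * ennreal (exp ((v v* \<psi> n \<omega>) \<bullet> (W (q (Suc n)) \<omega> - W (q n) \<omega>) -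
        (q (Suc n) - q n) / 2 * (norm (v v* \<psi> n \<omega>))\<^sup>2)) \<partial>M)"
  proof (intro nn_integral_cong)
    fix \<omega>
    have "v \<bullet> grid_integral q \<psi> m (Suc n) \<omega> - ?R (Suc n) \<omega> / 2 =
        (v \<bullet> grid_integral q \<psi> m n \<omega> - ?R n \<omega> / 2) +
        ((v v* \<psi> n \<omega>) \<bullet> (W (q (Suc n)) \<omega> - W (q n) \<omega>) -
          (q (Suc n) - q n) / 2 * (norm (v v* \<psi> n \<omega>))\<^sup>2)"
      using step.hyps(1)
      by (simp add: grid_integral_def dot_lmul_matrix inner_add_right add_divide_distrib)
    then show "Z \<omega> * ennreal (exp (v \<bullet> grid_integral q \<psi> m (Suc n) \<omega> - ?R (Suc n) \<omega> / 2)) =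
       ?Y \<omega> * ennreal (exp ((v v* \<psi> n \<omega>) \<bullet> (W (q (Suc n)) \<omega> - W (q n) \<omega>) -
        (q (Suc n) - q n) / 2 * (norm (v v* \<psi> n \<omega>))\<^sup>2))"
      by (simp only: exp_add ennreal_mult exp_ge_zero mult.assoc)
  qed
  also have "\<dots> = (\<integral>\<^sup>+\<omega>. ?Y \<omega> \<partial>M)"
    using qn by (intro increment_exp_moment) measurable
  also have "\<dots> = (\<integral>\<^sup>+\<omega>. Z \<omega> \<partial>M)" using step by auto
  finally show ?case .
qed

text \<open>Markov's inequality for the exponential martingale. On the event \<open>Q \<omega> < \<delta>\<close> and \<open>\<epsilon> \<le> v \<bullet> N \<omega>\<close> its
  logarithm is at least \<open>\<epsilon> - (norm v)\<^sup>2 * \<delta> / 2\<close>. This replaces the isometry: it shows directly that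
  grid integrals are small in probability when their quadratic variation is.\<close>

lemma grid_integral_tail:
  assumes q: "mono q" "0 \<le> q m" and \<psi>: "\<And>j. m \<le> j \<Longrightarrow> j < n \<Longrightarrow> \<psi> j \<in> borel_measurable (F (q j))"
    and mn: "m \<le> n"
  defines "N \<equiv> grid_integral q \<psi> m n"
    and "Q \<equiv> (\<lambda>\<omega>. \<Sum>j\<in>{m..<n}. (q (Suc j) - q j) * (norm (\<psi> j \<omega>))\<^sup>2)"
  shows "prob {\<omega>\<in>space M. \<epsilon> \<le> v \<bullet> N \<omega>} \<le>
    exp ((norm v)\<^sup>2 * \<delta> / 2 - \<epsilon>) + prob {\<omega>\<in>space M. \<delta> \<le> Q \<omega>}"
proof -
  have qn: "0 \<le> q n" using q(2) monoD[OF q(1), of m n] mn by auto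
  have [measurable]: "N \<in> borel_measurable M" unfolding N_def
    by (intro measurable_F_M[OF qn] grid_integral_measurable assms)
  have [measurable]: "Q \<in> borel_measurable M" unfolding Q_def
    by (intro measurable_F_M[OF qn] grid_square_measurable assms)
  define R where "R \<omega> = (\<Sum>j\<in>{m..<n}. (q (Suc j) - q j) * (norm (v v* \<psi> j \<omega>))\<^sup>2)" for \<omega>
  have [measurable]: "R \<in> borel_measurable M" unfolding R_def[abs_def]
    using q \<psi> by (intro measurable_F_M[OF qn] grid_square_measurable) (auto intro!: measurable_vector_matrix_mult)
  have RQ: "R \<omega> \<le> (norm v)\<^sup>2 * Q \<omega>" for \<omega>
    unfolding R_def Q_def sum_distrib_left
  proof (rule sum_mono)
    fix j
    have "(norm (v v* \<psi> j \<omega>))\<^sup>2 \<le> (norm (\<psi> j \<omega>) * norm v)\<^sup>2"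
      by (intro power_mono norm_vector_matrix_mult_le) auto
    then have "(q (Suc j) - q j) * (norm (v v* \<psi> j \<omega>))\<^sup>2 \<le> (q (Suc j) - q j) * (norm (\<psi> j \<omega>) * norm v)\<^sup>2"
      using monoD[OF q(1), of j "Suc j"] by (intro mult_left_mono) auto
    then show "(q (Suc j) - q j) * (norm (v v* \<psi> j \<omega>))\<^sup>2 \<le> (norm v)\<^sup>2 * ((q (Suc j) - q j) * (norm (\<psi> j \<omega>))\<^sup>2)"
      by (simp add: power_mult_distrib mult_ac)
  qed
  let ?A = "{\<omega>\<in>space M. \<epsilon> \<le> v \<bullet> N \<omega> \<and> Q \<omega> < \<delta>}"
  let ?e = "\<epsilon> - (norm v)\<^sup>2 * \<delta> / 2"
  have mart: "(\<integral>\<^sup>+\<omega>. ennreal (exp (v \<bullet> N \<omega> - R \<omega> / 2)) \<partial>M) = 1"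
    using grid_exponential_martingale[OF q \<psi>, of n "\<lambda>_. 1" v] mn
    by (simp add: N_def R_def emeasure_space_1)
  have "ennreal (exp ?e) * emeasure M ?A =
      (\<integral>\<^sup>+\<omega>. ennreal (exp ?e) * indicator ?A \<omega> \<partial>M)"
    by (subst nn_integral_cmult_indicator) auto
  also have "\<dots> \<le> (\<integral>\<^sup>+\<omega>. ennreal (exp (v \<bullet> N \<omega> - R \<omega> / 2)) \<partial>M)"
  proof (intro nn_integral_mono)
    fix \<omega>
    have "?e \<le> v \<bullet> N \<omega> - R \<omega> / 2" if "\<epsilon> \<le> v \<bullet> N \<omega>" "Q \<omega> < \<delta>"
      using that RQ[of \<omega>] mult_left_mono[of "Q \<omega>" \<delta> "(norm v)\<^sup>2"] by simp
    then show "ennreal (exp ?e) * indicator ?A \<omega> \<le>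
        ennreal (exp (v \<bullet> N \<omega> - R \<omega> / 2))"
      by (auto simp: indicator_def)
  qed
  also have "\<dots> = 1" by (rule mart)
  finally have "exp ?e * prob ?A \<le> 1"
    by (simp add: emeasure_eq_measure ennreal_mult[symmetric])
  then have 1: "prob ?A \<le> exp (- ?e)"
    by (subst exp_minus) (simp add: inverse_eq_divide pos_le_divide_eq mult.commute)
  have "prob {\<omega>\<in>space M. \<epsilon> \<le> v \<bullet> N \<omega>} \<le>
      prob (?A \<union> {\<omega>\<in>space M. \<delta> \<le> Q \<omega>})"
    by (intro finite_measure_mono) auto
  also have "\<dots> \<le> prob ?A + prob {\<omega>\<in>space M. \<delta> \<le> Q \<omega>}"
    by (intro measure_Un_le) auto
  finally show ?thesis using 1 by simp
qed

end

section \<open>Convergence in probability\<close>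

context prob_space
begin

text \<open>For a unit vector \<open>b\<close>, the tail bound is used with \<open>v = l *\<^sub>R b\<close>, threshold \<open>l * \<epsilon>\<close> and \<open>\<delta> = \<epsilon> / l\<close>. The
  exponential term is then \<open>exp (- l * \<epsilon> / 2)\<close>, which is small for large \<open>l\<close>, uniformly in \<open>k\<close>.\<close>

lemma tendsto_in_prob_of_tail_bound:
  fixes N :: "nat \<Rightarrow> 'a \<Rightarrow> real^'m"
  assumes Nm: "\<And>k. N k \<in> borel_measurable M"
    and tail: "\<And>k v \<epsilon> \<delta>. prob {\<omega>\<in>space M. \<epsilon> \<le> v \<bullet> N k \<omega>} \<le>
      exp ((norm v)\<^sup>2 * \<delta> / 2 - \<epsilon>) + prob {\<omega>\<in>space M. \<delta> \<le> Q k \<omega>}"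
    and Q: "\<And>\<delta>. \<delta> > 0 \<Longrightarrow> (\<lambda>k. prob {\<omega>\<in>space M. \<delta> \<le> Q k \<omega>}) \<longlonglongrightarrow> 0"
  shows "tendsto_in_prob M N (\<lambda>_. 0)"
proof -
  note [measurable] = Nm
  have dir: "(\<lambda>k. prob {\<omega>\<in>space M. \<epsilon> \<le> b \<bullet> N k \<omega>}) \<longlonglongrightarrow> 0" if b: "norm b = 1" and e: "\<epsilon> > 0" for b \<epsilon>
  proof (rule LIMSEQ_I)
    fix \<eta> :: real assume \<eta>: "\<eta> > 0"
    define l where "l = 2 / \<epsilon> * (\<bar>ln (\<eta> / 2)\<bar> + 1)"
    have l: "l > 0" using e by (simp add: l_def add_nonneg_pos)
    have "exp (- (l * \<epsilon> / 2)) < \<eta> / 2"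
    proof -
      have "l * \<epsilon> / 2 = \<bar>ln (\<eta> / 2)\<bar> + 1" using e by (simp add: l_def field_simps)
      then have "- (l * \<epsilon> / 2) < ln (\<eta> / 2)" by linarith
      then have "exp (- (l * \<epsilon> / 2)) < exp (ln (\<eta> / 2))" by (simp only: exp_less_cancel_iff)
      then show ?thesis using \<eta> by simp
    qed
    note el = this
    have "\<exists>n0. \<forall>k\<ge>n0. norm (prob {\<omega>\<in>space M. \<epsilon> / l \<le> Q k \<omega>} - 0) < \<eta> / 2"
      using e l \<eta> by (intro LIMSEQ_D[OF Q]) auto
    then obtain n0 where Qn: "\<And>k. k \<ge> n0 \<Longrightarrow> prob {\<omega>\<in>space M. \<epsilon> / l \<le> Q k \<omega>} < \<eta> / 2" by auto
    have n0: "exp (- (l * \<epsilon> / 2)) + prob {\<omega>\<in>space M. \<epsilon> / l \<le> Q k \<omega>} < \<eta>" if "k \<ge> n0" for k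
      using el Qn[OF that] by linarith
    have "prob {\<omega>\<in>space M. \<epsilon> \<le> b \<bullet> N k \<omega>} < \<eta>" if "k \<ge> n0" for k
    proof -
      have "{\<omega>\<in>space M. \<epsilon> \<le> b \<bullet> N k \<omega>} = {\<omega>\<in>space M. l * \<epsilon> \<le> (l *\<^sub>R b) \<bullet> N k \<omega>}"
        using l by auto
      then have "prob {\<omega>\<in>space M. \<epsilon> \<le> b \<bullet> N k \<omega>} \<le>
          exp ((norm (l *\<^sub>R b))\<^sup>2 * (\<epsilon> / l) / 2 - l * \<epsilon>) + prob {\<omega>\<in>space M. \<epsilon> / l \<le> Q k \<omega>}"
        using tail[of "l * \<epsilon>" "l *\<^sub>R b" k "\<epsilon> / l"] by (simp only:)
      also have "(norm (l *\<^sub>R b))\<^sup>2 * (\<epsilon> / l) / 2 - l * \<epsilon> = - (l * \<epsilon> / 2)"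
        using l b by (simp add: power2_eq_square field_simps)
      finally show ?thesis using n0[OF that] by linarith
    qed
    then show "\<exists>n0. \<forall>k\<ge>n0. norm (prob {\<omega>\<in>space M. \<epsilon> \<le> b \<bullet> N k \<omega>} - 0) < \<eta>" by auto
  qed
  have "(\<lambda>k. prob {\<omega>\<in>space M. \<epsilon> \<le> dist (N k \<omega>) 0}) \<longlonglongrightarrow> 0" if e: "\<epsilon> > 0" for \<epsilon>
  proof -
    let ?e = "\<epsilon> / DIM(real^'m)"
    have e': "?e > 0" using e by simp
    let ?A = "\<lambda>b k. {\<omega>\<in>space M. ?e \<le> b \<bullet> N k \<omega>}"
    have "prob {\<omega>\<in>space M. \<epsilon> \<le> dist (N k \<omega>) 0} \<le> (\<Sum>b\<in>Basis. prob (?A b k) + prob (?A (- b) k))" for k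
    proof -
      have "prob {\<omega>\<in>space M. \<epsilon> \<le> dist (N k \<omega>) 0} \<le> prob (\<Union>b\<in>Basis. ?A b k \<union> ?A (- b) k)"
      proof (rule finite_measure_mono)
        show "{\<omega>\<in>space M. \<epsilon> \<le> dist (N k \<omega>) 0} \<subseteq> (\<Union>b\<in>Basis. ?A b k \<union> ?A (- b) k)"
        proof
          fix \<omega> assume w: "\<omega> \<in> {\<omega>\<in>space M. \<epsilon> \<le> dist (N k \<omega>) 0}"
          show "\<omega> \<in> (\<Union>b\<in>Basis. ?A b k \<union> ?A (- b) k)"
          proof (rule ccontr)
            assume "\<not> ?thesis"
            then have *: "\<bar>N k \<omega> \<bullet> b\<bar> < ?e" if "b \<in> Basis" for b
              using w that by (simp add: inner_commute[of _ b] abs_less_iff not_le)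
            have "norm (N k \<omega>) \<le> (\<Sum>b\<in>Basis. \<bar>N k \<omega> \<bullet> b\<bar>)" by (rule norm_le_l1)
            also have "\<dots> < (\<Sum>b\<in>(Basis :: (real^'m) set). ?e)" using * by (intro sum_strict_mono) auto
            also have "\<dots> = \<epsilon>" by simp
            finally show False using w by (simp add: dist_norm)
          qed
        qed
      qed (auto intro!: sets.finite_UN)
      also have "\<dots> \<le> (\<Sum>b\<in>Basis. prob (?A b k \<union> ?A (- b) k))"
        by (intro finite_measure_subadditive_finite) auto
      also have "\<dots> \<le> (\<Sum>b\<in>Basis. prob (?A b k) + prob (?A (- b) k))"
        by (intro sum_mono measure_Un_le) auto
      finally show ?thesis .
    qed
    moreover have "(\<lambda>k. \<Sum>b\<in>Basis. prob (?A b k) + prob (?A (- b) k)) \<longlonglongrightarrow> (\<Sum>b\<in>(Basis :: (real^'m) set). 0 + 0)"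
      using e' by (intro tendsto_sum tendsto_add dir) auto
    ultimately show ?thesis
      by (intro Lim_null_comparison[of "\<lambda>k. prob {\<omega>\<in>space M. \<epsilon> \<le> dist (N k \<omega>) 0}"] always_eventually allI) simp_all
  qed
  then show ?thesis by (auto simp: tendsto_in_prob_def)
qed

lemma tendsto_in_prob_subseq: "tendsto_in_prob M Y Z \<Longrightarrow> strict_mono r \<Longrightarrow> tendsto_in_prob M (\<lambda>k. Y (r k)) Z"
  unfolding tendsto_in_prob_def by (auto intro: LIMSEQ_subseq_LIMSEQ[unfolded comp_def])

text \<open>Convergence in probability is convergence to \<open>0\<close> of the expectation of \<open>min 1 (dist (Y k) Z)\<close>, and
  convergence in mean implies almost sure convergence along a subsequence.\<close>

lemma tendsto_in_prob_AE_subseq: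
  fixes Y :: "nat \<Rightarrow> 'a \<Rightarrow> real^'m"
  assumes Y: "tendsto_in_prob M Y Z"
  shows "\<exists>r. strict_mono r \<and> (AE \<omega> in M. (\<lambda>k. Y (r k) \<omega>) \<longlonglongrightarrow> Z \<omega>)"
proof -
  have [measurable]: "Y k \<in> borel_measurable M" "Z \<in> borel_measurable M" for k
    using Y by (auto simp: tendsto_in_prob_def)
  have lim: "\<And>\<epsilon>. \<epsilon> > 0 \<Longrightarrow> (\<lambda>k. prob {\<omega>\<in>space M. \<epsilon> \<le> dist (Y k \<omega>) (Z \<omega>)}) \<longlonglongrightarrow> 0"
    using Y by (auto simp: tendsto_in_prob_def)
  let ?u = "\<lambda>k \<omega>. min 1 (dist (Y k \<omega>) (Z \<omega>))"
  have ui: "integrable M (?u k)" for k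
    by (rule integrable_const_bound[of _ 1]) auto
  have "(\<lambda>k. \<integral>\<omega>. norm (?u k \<omega>) \<partial>M) \<longlonglongrightarrow> 0"
  proof (rule LIMSEQ_I)
    fix \<eta> :: real assume \<eta>: "\<eta> > 0"
    obtain n0 where n0: "\<And>k. k \<ge> n0 \<Longrightarrow> prob {\<omega>\<in>space M. \<eta> / 2 \<le> dist (Y k \<omega>) (Z \<omega>)} < \<eta> / 2"
      using LIMSEQ_D[OF lim[of "\<eta> / 2"], of "\<eta> / 2"] \<eta> by auto
    have "(\<integral>\<omega>. norm (?u k \<omega>) \<partial>M) < \<eta>" if "k \<ge> n0" for k
    proof -
      let ?B = "{\<omega>\<in>space M. \<eta> / 2 \<le> dist (Y k \<omega>) (Z \<omega>)}"
      have B: "?B \<in> sets M" by measurable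
      have iB: "integrable M (indicator ?B :: _ \<Rightarrow> real)"
        by (rule integrable_real_indicator[OF B]) (simp add: emeasure_eq_measure)
      have "(\<integral>\<omega>. norm (?u k \<omega>) \<partial>M) \<le> (\<integral>\<omega>. \<eta> / 2 + indicator ?B \<omega> \<partial>M)"
      proof (rule integral_mono)
        show "integrable M (\<lambda>\<omega>. norm (?u k \<omega>))" using ui[of k] by simp
        show "integrable M (\<lambda>\<omega>. \<eta> / 2 + indicator ?B \<omega>)"
          by (rule Bochner_Integration.integrable_add[OF integrable_const iB])
        show "norm (?u k \<omega>) \<le> \<eta> / 2 + indicator ?B \<omega>" if "\<omega> \<in> space M" for \<omega>
          using that \<eta> by (auto simp: indicator_def)
      qed
      also have "\<dots> = \<eta> / 2 + prob ?B"
        using B by (subst Bochner_Integration.integral_add[OF integrable_const iB]) (simp add: prob_space)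
      finally show ?thesis using n0[OF that] by simp
    qed
    then show "\<exists>n0. \<forall>k\<ge>n0. norm ((\<integral>\<omega>. norm (?u k \<omega>) \<partial>M) - 0) < \<eta>" by auto
  qed
  from tendsto_L1_AE_subseq[OF ui this] obtain r where r: "strict_mono r"
    and ae: "AE \<omega> in M. (\<lambda>k. ?u (r k) \<omega>) \<longlonglongrightarrow> 0" by auto
  from ae have "AE \<omega> in M. (\<lambda>k. Y (r k) \<omega>) \<longlonglongrightarrow> Z \<omega>"
  proof eventually_elim
    case (elim \<omega>)
    have "\<forall>\<^sub>F k in sequentially. ?u (r k) \<omega> < 1" using elim by (rule order_tendstoD) simp
    then have "\<forall>\<^sub>F k in sequentially. ?u (r k) \<omega> = dist (Y (r k) \<omega>) (Z \<omega>)" by eventually_elim auto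
    with elim have "(\<lambda>k. dist (Y (r k) \<omega>) (Z \<omega>)) \<longlonglongrightarrow> 0" by (rule Lim_transform_eventually)
    then show ?case by (rule tendsto_dist_iff[THEN iffD2])
  qed
  with r show ?thesis by auto
qed

end

section \<open>Simple processes on a common grid\<close>

lemma sorted_grid_exists:
  assumes G: "finite G" "0 \<in> G" "t \<in> G" "G \<subseteq> {0..t}"
  shows "\<exists>(q :: nat \<Rightarrow> real) n. mono q \<and> strict_mono_on {..n} q \<and> q 0 = (0::real) \<and> q n = t \<and> q ` {..n} = G"
proof -
  define xs where "xs = sorted_list_of_set G"
  define n where "n = length xs - 1"
  \<comment> \<open>Constant continuation beyond \<open>n\<close> makes \<open>q\<close> monotone on all natural numbers.\<close>
  define q where "q j = xs ! min j n" for j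
  have xs: "set xs = G" "sorted_wrt (<) xs" "xs \<noteq> []"
    using G by (auto simp: xs_def strict_sorted_iff)
  then have len: "length xs = Suc n" by (simp add: n_def)
  have less: "xs ! i < xs ! j" if "i < j" "j \<le> n" for i j
    using sorted_wrt_nth_less[OF xs(2)] that len by simp
  then have "mono q"
    unfolding q_def mono_def by (metis le_less min.cobounded2 min.mono order.refl)
  moreover have "strict_mono_on {..n} q"
    using less by (auto simp: strict_mono_on_def q_def)
  moreover have im: "q ` {..n} = G"
  proof -
    have "q ` {..n} = (\<lambda>j. xs ! j) ` {..<length xs}"
      unfolding len lessThan_Suc_atMost by (intro image_cong) (auto simp: q_def)
    then show ?thesis using xs(1) by (auto simp: set_conv_nth)
  qed
  moreover have "q 0 = 0"
  proof -
    obtain j where "j \<le> n" "q j = 0" using im G(2) by auto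
    then have "q 0 \<le> 0" using monoD[OF \<open>mono q\<close>, of 0 j] by simp
    moreover have "q 0 \<in> G" using im by auto
    ultimately show ?thesis using G(4) by auto
  qed
  moreover have "q n = t"
  proof -
    obtain j where "j \<le> n" "q j = t" using im G(3) by auto
    then have "t \<le> q n" using monoD[OF \<open>mono q\<close>, of j n] by simp
    moreover have "q n \<in> G" using im by auto
    ultimately show ?thesis using G(4) by auto
  qed
  ultimately show ?thesis by blast
qed

definition refines :: "nat \<Rightarrow> (nat \<Rightarrow> real) \<Rightarrow> nat \<Rightarrow> (nat \<Rightarrow> real) \<Rightarrow> bool" where
  "refines n q N p \<longleftrightarrow> (\<forall>i\<le>N. p i \<le> q n \<longrightarrow> p i \<in> q ` {..n})"

lemma refines_separates:
  assumes "strict_mono_on {..n} q" "refines n q N p" "i \<le> N" "j < n" "p i < q (Suc j)"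
  shows "p i \<le> q j"
proof -
  have "q (Suc j) \<le> q n"
    using strict_mono_on_leD[OF assms(1), of "Suc j" n] assms(4) by auto
  then obtain a where a: "a \<le> n" "p i = q a" using assms by (auto simp: refines_def)
  have "a \<le> j"
  proof (rule ccontr)
    assume "\<not> a \<le> j"
    then have "q (Suc j) \<le> q a" using strict_mono_on_leD[OF assms(1), of "Suc j" a] a by auto
    then show False using a assms(5) by simp
  qed
  then show ?thesis using strict_mono_on_leD[OF assms(1), of a j] a assms(4) by auto
qed

lemma simple_process_constant_on_grid:
  assumes q: "strict_mono_on {..n} q" "refines n q N p" and j: "j < n" and s: "q j < s" "s \<le> q (Suc j)"
  shows "simple_process N p \<xi> s \<omega> = simple_process N p \<xi> (q (Suc j)) \<omega>"
  unfolding simple_process_def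
proof (intro sum.cong refl)
  fix i assume "i \<in> {..<N}"
  then have "p i < q (Suc j) \<Longrightarrow> p i \<le> q j" "p (Suc i) < q (Suc j) \<Longrightarrow> p (Suc i) \<le> q j"
    using refines_separates[OF q, of i j] refines_separates[OF q, of "Suc i" j] j by auto
  then have "(p i < s \<longleftrightarrow> p i < q (Suc j)) \<and> (s \<le> p (Suc i) \<longleftrightarrow> q (Suc j) \<le> p (Suc i))"
    using s by linarith
  then show "indicat_real {p i<..p (Suc i)} s *\<^sub>R \<xi> i \<omega> = indicat_real {p i<..p (Suc i)} (q (Suc j)) *\<^sub>R \<xi> i \<omega>"
    by (auto simp: indicator_def)
qed

lemma sum_matrix_vector_mult: "(\<Sum>i\<in>I. A i) *v x = (\<Sum>i\<in>I. A i *v x)" for A :: "'b \<Rightarrow> real^'n^'m"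
  by (induction I rule: infinite_finite_induct) (auto simp: matrix_vector_mult_add_rdistrib)

lemma grid_sum_le_integral:
  fixes g :: "real \<Rightarrow> real"
  assumes q: "mono q" and g: "integrable lborel g" and g0: "\<And>s. 0 \<le> g s"
    and c: "\<And>j s. j < n \<Longrightarrow> q j < s \<Longrightarrow> s \<le> q (Suc j) \<Longrightarrow> c j \<le> g s"
  shows "(\<Sum>j\<in>{0..<n}. (q (Suc j) - q j) * c j) \<le> (\<integral>s. g s \<partial>lborel)"
proof -
  have gi: "set_integrable lborel A g" if "A \<in> sets lborel" for A
    using integrable_mult_indicator[OF that g] by (simp add: set_integrable_def)
  have "(\<Sum>j\<in>{0..<k}. (q (Suc j) - q j) * c j) \<le> (LINT s:{q 0<..q k}|lborel. g s)" if "k \<le> n" for k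
    using that
  proof (induction k)
    case (Suc k)
    have le: "q k \<le> q (Suc k)" "q 0 \<le> q k" using monoD[OF q] by auto
    have "(q (Suc k) - q k) * c k = (LINT s:{q k<..q (Suc k)}|lborel. c k)"
      using le by (simp add: set_lebesgue_integral_def)
    also have "\<dots> \<le> (LINT s:{q k<..q (Suc k)}|lborel. g s)"
      using c[of k] Suc.prems le by (intro set_integral_mono gi) (auto simp: set_integrable_def)
    finally have "(\<Sum>j\<in>{0..<Suc k}. (q (Suc j) - q j) * c j) \<le>
        (LINT s:{q 0<..q k}|lborel. g s) + (LINT s:{q k<..q (Suc k)}|lborel. g s)"
      using Suc by simp
    also have "\<dots> = (LINT s:{q 0<..q k} \<union> {q k<..q (Suc k)}|lborel. g s)"
      by (rule set_integral_Un[symmetric]) (auto intro: gi)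
    also have "{q 0<..q k} \<union> {q k<..q (Suc k)} = {q 0<..q (Suc k)}" using le by auto
    finally show ?case .
  qed (simp add: set_lebesgue_integral_def)
  from this[of n] have "(\<Sum>j\<in>{0..<n}. (q (Suc j) - q j) * c j) \<le> (LINT s:{q 0<..q n}|lborel. g s)" by simp
  also have "\<dots> \<le> (\<integral>s. g s \<partial>lborel)"
    unfolding set_lebesgue_integral_def using gi[of "{q 0<..q n}"] g g0
    by (intro integral_mono) (auto simp: set_integrable_def indicator_def)
  finally show ?thesis .
qed

lemma simple_process_minus_continuous_integrable:
  fixes H :: "real \<Rightarrow> real^'n^'m"
  assumes H: "continuous_on {0..t} H" and t: "0 \<le> t"
  shows "set_integrable lborel {0..t} (\<lambda>s. (norm (simple_process N p \<xi> s \<omega> - H s))\<^sup>2)"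
proof -
  define K where "K = (\<Sum>i<N. norm (\<xi> i \<omega>))"
  have K: "norm (simple_process N p \<xi> s \<omega>) \<le> K" for s
    unfolding simple_process_def K_def
    by (rule order_trans[OF norm_sum sum_mono]) (auto simp: indicator_def)
  obtain L where "\<forall>s\<in>{0..t}. norm (H s) \<le> L"
    using compact_imp_bounded[OF compact_continuous_image[OF H compact_Icc]] by (auto simp: bounded_iff)
  then have L: "norm (H s) \<le> L" if "s \<in> {0..t}" for s using that by blast
  have [measurable]: "(\<lambda>s. indicator {0..t} s *\<^sub>R H s) \<in> borel_measurable borel"
    by (rule borel_measurable_continuous_on_indicator) (auto simp: H)
  have [measurable]: "(\<lambda>s. simple_process N p \<xi> s \<omega>) \<in> borel_measurable borel"
    unfolding simple_process_def by measurable
  have e: "indicator {0..t} s *\<^sub>R (norm (simple_process N p \<xi> s \<omega> - H s))\<^sup>2 =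
     (norm (indicator {0..t} s *\<^sub>R simple_process N p \<xi> s \<omega> - indicator {0..t} s *\<^sub>R H s))\<^sup>2" for s :: real
    by (auto simp: indicator_def)
  show ?thesis unfolding set_integrable_def
  proof (rule Bochner_Integration.integrable_bound)
    show "integrable lborel (\<lambda>s. indicator {0..t} s * (K + L)\<^sup>2)"
      using t by (intro integrable_mult_left) auto
    show "(\<lambda>s. indicat_real {0..t} s *\<^sub>R (norm (simple_process N p \<xi> s \<omega> - H s))\<^sup>2) \<in> borel_measurable lborel"
      unfolding e by measurable
    show "AE s in lborel. norm (indicat_real {0..t} s *\<^sub>R (norm (simple_process N p \<xi> s \<omega> - H s))\<^sup>2) \<le>
        norm (indicator {0..t} s * (K + L)\<^sup>2)"
    proof (intro AE_I2)
      fix s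
      have "(norm (simple_process N p \<xi> s \<omega> - H s))\<^sup>2 \<le> (K + L)\<^sup>2" if "s \<in> {0..t}"
        using K[of s] L[OF that] norm_triangle_ineq4[of "simple_process N p \<xi> s \<omega>" "H s"]
        by (intro power_mono) auto
      then show "norm (indicat_real {0..t} s *\<^sub>R (norm (simple_process N p \<xi> s \<omega> - H s))\<^sup>2) \<le>
        norm (indicator {0..t} s * (K + L)\<^sup>2)" by (auto simp: indicator_def)
    qed
  qed
qed

context filtered_brownian_motion
begin

lemma simple_process_grid_measurable:
  assumes q: "strict_mono_on {..n} q" "refines n q N p" and j: "j < n" and sd: "simple_data M F N p \<xi>"
  shows "simple_process N p \<xi> (q (Suc j)) \<in> borel_measurable (F (q j))"
  unfolding simple_process_def[abs_def]
proof (rule borel_measurable_sum)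
  fix i assume i: "i \<in> {..<N}"
  have p: "0 \<le> p i" if "i \<le> N" for i
    using that
  proof (induction i)
    case (Suc i)
    then have "p i \<le> p (Suc i)" using sd by (auto simp: simple_data_def)
    then show ?case using Suc by simp
  qed (use sd in \<open>auto simp: simple_data_def\<close>)
  show "(\<lambda>\<omega>. indicat_real {p i<..p (Suc i)} (q (Suc j)) *\<^sub>R \<xi> i \<omega>) \<in> borel_measurable (F (q j))"
  proof (cases "p i < q (Suc j)")
    case True
    then have "p i \<le> q j" using refines_separates[OF q] i j by auto
    moreover have "\<xi> i \<in> borel_measurable (F (p i))" using sd i by (auto simp: simple_data_def)
    ultimately have [measurable]: "\<xi> i \<in> borel_measurable (F (q j))"
      using measurable_F_mono p i by (metis lessThan_iff less_imp_le)
    show ?thesis by measurable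
  qed simp
qed

text \<open>The elementary integral depends on the process only and not on its breakpoints: on a finer grid
  the increments between two consecutive breakpoints telescope. Processes with different breakpoints
  can therefore be compared on a common grid.\<close>

lemma simple_integral_on_grid:
  assumes q: "strict_mono_on {..n} q" "refines n q N p" "q 0 = 0" and k: "k \<le> n"
    and sd: "simple_data M F N p \<xi>"
  shows "simple_integral W N p \<xi> (q k) \<omega> = grid_integral q (\<lambda>j. simple_process N p \<xi> (q (Suc j))) 0 k \<omega>"
proof -
  let ?dW = "\<lambda>j. W (q (Suc j)) \<omega> - W (q j) \<omega>"
  note le = strict_mono_on_leD[OF q(1)] and less = strict_mono_onD[OF q(1)]
  \<comment> \<open>Both cut-off breakpoints of each summand are grid points with index at most \<open>k\<close>.\<close>
  have idx: "\<exists>a\<le>k. q a = min (q k) (p i)" if iN: "i \<le> N" for i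
  proof (cases "p i \<le> q k")
    case True
    then have "p i \<le> q n" using le[of k n] k by auto
    then obtain a where a: "a \<le> n" "p i = q a" using q(2) iN unfolding refines_def by blast
    have "a \<le> k"
    proof (rule ccontr)
      assume "\<not> a \<le> k"
      then have "q k < q a" using less[of k a] a k by auto
      then show False using True a by simp
    qed
    then show ?thesis using True a by (intro exI[of _ a]) auto
  next
    case False
    then show ?thesis by (intro exI[of _ k]) auto
  qed
  have cmp: "p i < q (Suc j) \<longleftrightarrow> a \<le> j" if "a \<le> k" "q a = min (q k) (p i)" "j < k" for a i j
  proof -
    have "q (Suc j) \<le> q k" using le[of "Suc j" k] that k by auto
    then have "p i < q (Suc j) \<longleftrightarrow> q a < q (Suc j)" using that(2) by auto
    also have "\<dots> \<longleftrightarrow> a \<le> j"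
      using less[of a "Suc j"] le[of "Suc j" a] that k by (cases "a \<le> j") auto
    finally show ?thesis .
  qed
  have "(\<Sum>j\<in>{0..<k}. (indicator {p i<..p (Suc i)} (q (Suc j)) *\<^sub>R \<xi> i \<omega>) *v ?dW j) =
      \<xi> i \<omega> *v (W (min (q k) (p (Suc i))) \<omega> - W (min (q k) (p i)) \<omega>)" if i: "i < N" for i
  proof -
    obtain a b where a: "a \<le> k" "q a = min (q k) (p i)" and b: "b \<le> k" "q b = min (q k) (p (Suc i))"
      using idx[of i] idx[of "Suc i"] i by auto
    have "p i \<le> p (Suc i)" using sd i by (auto simp: simple_data_def)
    then have "q a \<le> q b" using a b by auto
    then have ab: "a \<le> b" using less[of b a] a b k by (cases "a \<le> b") auto
    have "(\<Sum>j\<in>{0..<k}. (indicator {p i<..p (Suc i)} (q (Suc j)) *\<^sub>R \<xi> i \<omega>) *v ?dW j) =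
        (\<Sum>j\<in>{0..<k}. if j \<in> {a..<b} then \<xi> i \<omega> *v ?dW j else 0)"
    proof (intro sum.cong refl)
      fix j assume "j \<in> {0..<k}"
      then have "p i < q (Suc j) \<longleftrightarrow> a \<le> j" "p (Suc i) < q (Suc j) \<longleftrightarrow> b \<le> j"
        using cmp[OF a] cmp[OF b] by auto
      then show "(indicator {p i<..p (Suc i)} (q (Suc j)) *\<^sub>R \<xi> i \<omega>) *v ?dW j =
          (if j \<in> {a..<b} then \<xi> i \<omega> *v ?dW j else 0)"
        by (auto simp: indicator_def not_less not_le)
    qed
    also have "\<dots> = (\<Sum>j\<in>{a..<b}. \<xi> i \<omega> *v ?dW j)"
      using b by (intro sum.mono_neutral_cong_right) auto
    also have "\<dots> = \<xi> i \<omega> *v (\<Sum>j\<in>{a..<b}. ?dW j)"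
      by (simp add: linear_sum[OF matrix_vector_mul_linear])
    also have "(\<Sum>j\<in>{a..<b}. ?dW j) = W (q b) \<omega> - W (q a) \<omega>"
      using sum_Suc_diff'[OF ab, of "\<lambda>j. W (q j) \<omega>"] by simp
    finally show ?thesis using a b by simp
  qed
  then show ?thesis
    unfolding simple_integral_def grid_integral_def simple_process_def sum_matrix_vector_mult
    by (subst sum.swap) simp
qed

lemma grid_integral_concat:
  assumes "l \<le> m" "m \<le> n"
  shows "grid_integral q \<psi> l m \<omega> + grid_integral q \<psi> m n \<omega> = grid_integral q \<psi> l n \<omega>"
  unfolding grid_integral_def using assms by (rule sum.atLeastLessThan_concat)

lemma grid_integral_diff:
  "grid_integral q \<psi> m n \<omega> - grid_integral q \<phi> m n \<omega> = grid_integral q (\<lambda>j \<omega>. \<psi> j \<omega> - \<phi> j \<omega>) m n \<omega>"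
  unfolding grid_integral_def by (simp add: sum_subtractf matrix_vector_mult_diff_rdistrib)

lemma grid_integral_cong:
  "(\<And>j. m \<le> j \<Longrightarrow> j < n \<Longrightarrow> \<psi> j \<omega> = \<phi> j \<omega>) \<Longrightarrow> grid_integral q \<psi> m n \<omega> = grid_integral q \<phi> m n \<omega>"
  unfolding grid_integral_def by (intro sum.cong) auto

end

text \<open>Because \<open>v v* A\<close> is the transpose of \<open>A\<close> applied to \<open>v\<close>, this is the set of matrices with
  \<open>A ** transpose A\<close> below \<open>\<theta>\<close> times the identity, that is, a ball for the operator norm.\<close>

definition row_bounded :: "real \<Rightarrow> (real^'n^'m) set" where
  "row_bounded \<theta> = {A. \<forall>v. (norm (v v* A))\<^sup>2 \<le> \<theta> * (norm v)\<^sup>2}"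

lemma row_bounded_alt:
  assumes "\<theta> \<ge> 0"
  shows "row_bounded \<theta> = (\<Inter>v. {A. norm (v v* A) \<le> sqrt \<theta> * norm v})"
proof -
  have "(norm (v v* A))\<^sup>2 \<le> \<theta> * (norm v)\<^sup>2 \<longleftrightarrow> norm (v v* A) \<le> sqrt \<theta> * norm v" for v and A :: "real^'n^'m"
    using abs_le_square_iff[of "norm (v v* A)" "sqrt \<theta> * norm v"] assms
    by (simp add: power_mult_distrib)
  then show ?thesis by (auto simp: row_bounded_def)
qed

lemma row_bounded_closed_convex:
  assumes t: "\<theta> \<ge> 0"
  shows "closed (row_bounded \<theta>)" "convex (row_bounded \<theta>)" "0 \<in> row_bounded \<theta>"
proof -
  show "closed (row_bounded \<theta>)"
    unfolding row_bounded_alt[OF t]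
    by (intro closed_INT ballI closed_Collect_le continuous_intros continuous_on_vector_matrix_mult)
  have add: "v v* (x *\<^sub>R A + y *\<^sub>R B) = x *\<^sub>R (v v* A) + y *\<^sub>R (v v* B)" for v x y and A B :: "real^'n^'m"
    by (simp add: vec_eq_iff vector_matrix_mult_def sum.distrib sum_distrib_left algebra_simps)
  show "convex (row_bounded \<theta>)"
    unfolding row_bounded_alt[OF t]
  proof (intro convex_INT convexI, clarify)
    fix v :: "real^'m" and A B :: "real^'n^'m" and x y :: real
    assume *: "norm (v v* A) \<le> sqrt \<theta> * norm v" "norm (v v* B) \<le> sqrt \<theta> * norm v" "0 \<le> x" "0 \<le> y" "x + y = 1"
    have "norm (v v* (x *\<^sub>R A + y *\<^sub>R B)) \<le> x * norm (v v* A) + y * norm (v v* B)"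
      unfolding add using * by (metis abs_of_nonneg norm_scaleR norm_triangle_ineq)
    also have "\<dots> \<le> x * (sqrt \<theta> * norm v) + y * (sqrt \<theta> * norm v)"
      using * by (intro add_mono mult_left_mono) auto
    also have "\<dots> = sqrt \<theta> * norm v" using *(5) by (simp add: distrib_right[symmetric])
    finally show "norm (v v* (x *\<^sub>R A + y *\<^sub>R B)) \<le> sqrt \<theta> * norm v" .
  qed
  have "v v* (0 :: real^'n^'m) = 0" for v by (simp add: vec_eq_iff vector_matrix_mult_def)
  then show "0 \<in> row_bounded \<theta>" using t by (simp add: row_bounded_def)
qed

lemma row_bounded_of_loewner_le:
  fixes A :: "real^'n^'n"
  assumes "loewner_le (A ** transpose A) (\<theta> *\<^sub>R mat 1)"
  shows "A \<in> row_bounded \<theta>"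
  unfolding row_bounded_def
proof safe
  fix v :: "real^'n"
  have "v \<bullet> ((A ** transpose A) *v v) = (v v* A) \<bullet> (v v* A)"
    by (simp add: matrix_vector_mul_assoc[symmetric] dot_lmul_matrix[symmetric])
  moreover have "0 \<le> v \<bullet> ((\<theta> *\<^sub>R mat 1 - A ** transpose A) *v v)"
    using assms by (simp add: loewner_le_def positive_semidefinite_def)
  ultimately show "(norm (v v* A))\<^sup>2 \<le> \<theta> * (norm v)\<^sup>2"
    by (simp add: matrix_vector_mult_diff_rdistrib inner_diff_right power2_norm_eq_inner
        scaleR_matrix_vector_assoc[symmetric])
qed

section \<open>Increments of the Ito integral\<close>

context filtered_brownian_motion
begin

text \<open>The simple processes that approximate \<open>H\<close> may violate the bound \<open>\<theta>\<close> satisfied by \<open>H\<close>. They are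
  projected onto the closed convex set of admissible matrices; \<open>H\<close> lies in this set, so projecting
  moves a simple process by at most its distance to \<open>H\<close>. The variable \<open>C\<close> is the integral of the
  projected process over the interval from \<open>s\<close> to \<open>t\<close>, and its exponential moments are bounded by
  the exponential martingale, whose compensator is now at most \<open>\<theta> * (t - s) * (norm v)\<^sup>2\<close>.

  The integrals up to \<open>t\<close> and up to \<open>s\<close> come with unrelated approximations. On a common grid, the
  difference of the two integrals minus \<open>C\<close> is again a grid integral: its integrand is the difference
  of the two simple processes before \<open>s\<close> and the error of the projection after \<open>s\<close>. Its quadratic
  variation \<open>Q\<close> is controlled by the two approximation errors.\<close>

lemma simple_integral_increment_approximation:
  fixes H :: "real \<Rightarrow> 'w \<Rightarrow> real^'n^'m"
  assumes st: "0 \<le> s" "s < t" and th: "\<theta> \<ge> 0"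
    and sd: "simple_data M F N p \<xi>" "simple_data M F N' p' \<xi>'"
    and Hc: "\<And>\<omega>. \<omega> \<in> space M \<Longrightarrow> continuous_on {0..} (\<lambda>r. H r \<omega>)"
    and Hb: "\<And>r \<omega>. \<omega> \<in> space M \<Longrightarrow> 0 \<le> r \<Longrightarrow> H r \<omega> \<in> row_bounded \<theta>"
  shows "\<exists>C Q. C \<in> borel_measurable M \<and> Q \<in> borel_measurable M \<and>
    (\<forall>\<omega>\<in>space M. Q \<omega> \<le>
       2 * (LINT r:{0..t}|lborel. (norm (simple_process N p \<xi> r \<omega> - H r \<omega>))\<^sup>2) +
       2 * (LINT r:{0..s}|lborel. (norm (simple_process N' p' \<xi>' r \<omega> - H r \<omega>))\<^sup>2)) \<and>
    (\<forall>v \<epsilon> \<delta>. prob {\<omega>\<in>space M. \<epsilon> \<le> v \<bullet> (simple_integral W N p \<xi> t \<omega> - simple_integral W N' p' \<xi>' s \<omega> - C \<omega>)} \<le>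
       exp ((norm v)\<^sup>2 * \<delta> / 2 - \<epsilon>) + prob {\<omega>\<in>space M. \<delta> \<le> Q \<omega>}) \<and>
    (\<forall>v. \<forall>Z\<in>borel_measurable (F s). (\<integral>\<^sup>+\<omega>. Z \<omega> * ennreal (exp (v \<bullet> C \<omega>)) \<partial>M) \<le>
       ennreal (exp (\<theta> * (t - s) / 2 * (norm v)\<^sup>2)) * (\<integral>\<^sup>+\<omega>. Z \<omega> \<partial>M))"
proof -
  let ?A = "simple_integral W N p \<xi> t" and ?B = "simple_integral W N' p' \<xi>' s"
  define G where "G = {0, s, t} \<union> (p ` {..N} \<union> p' ` {..N'}) \<inter> {0..t}"
  obtain q :: "nat \<Rightarrow> real" and n where q: "mono q" "strict_mono_on {..n} q" "q 0 = 0" "q n = t" "q ` {..n} = G"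
  proof -
    have "finite G" "0 \<in> G" "t \<in> G" "G \<subseteq> {0..t}" using st by (auto simp: G_def)
    from sorted_grid_exists[OF this] show ?thesis by (elim exE conjE) (rule that; assumption)
  qed
  have pos: "0 \<le> p i" if "i \<le> N" "simple_data M F N p \<xi>" for N i p and \<xi> :: "nat \<Rightarrow> 'w \<Rightarrow> real^'n^'m"
    using that(1)
  proof (induction i)
    case (Suc i)
    then have "p i \<le> p (Suc i)" using that by (auto simp: simple_data_def)
    then show ?case using Suc by simp
  qed (use that in \<open>auto simp: simple_data_def\<close>)
  have ref: "refines n q N p" "refines n q N' p'"
    using pos[OF _ sd(1)] pos[OF _ sd(2)] unfolding refines_def q(4,5) by (auto simp: G_def)
  obtain m where m: "m \<le> n" "q m = s" using q(5) unfolding G_def by (metis UnI1 atMost_iff imageE insertCI)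
  define \<phi> where "\<phi> j = simple_process N p \<xi> (q (Suc j))" for j
  define \<zeta> where "\<zeta> j = simple_process N' p' \<xi>' (q (Suc j))" for j
  define P where "P = closest_point (row_bounded \<theta> :: (real^'n^'m) set)"
  note S = row_bounded_closed_convex[OF th]
  have Sne: "row_bounded \<theta> \<noteq> ({} :: (real^'n^'m) set)" using S(3) by blast
  have [measurable]: "P \<in> borel_measurable borel"
    unfolding P_def by (intro borel_measurable_continuous_onI continuous_on_closest_point S Sne)
  have PS: "P A \<in> row_bounded \<theta>" for A unfolding P_def by (rule closest_point_in_set[OF S(1) Sne])
  have Pd: "norm (A - P A) \<le> norm (A - B)" if "B \<in> row_bounded \<theta>" for A B
    using closest_point_le[OF S(1) that, of A] by (simp add: P_def dist_norm)
  define \<psi> where "\<psi> j \<omega> = (if j < m then \<phi> j \<omega> - \<zeta> j \<omega> else \<phi> j \<omega> - P (\<phi> j \<omega>))" for j \<omega>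
  define C where "C = grid_integral q (\<lambda>j \<omega>. P (\<phi> j \<omega>)) m n"
  define Q where "Q \<omega> = (\<Sum>j\<in>{0..<n}. (q (Suc j) - q j) * (norm (\<psi> j \<omega>))\<^sup>2)" for \<omega>
  have phim [measurable]: "\<phi> j \<in> borel_measurable (F (q j))" if "j < n" for j
    unfolding \<phi>_def by (rule simple_process_grid_measurable[OF q(2) ref(1) that sd(1)])
  have chim [measurable]: "\<zeta> j \<in> borel_measurable (F (q j))" if "j < n" for j
    unfolding \<zeta>_def by (rule simple_process_grid_measurable[OF q(2) ref(2) that sd(2)])
  have Pphi: "(\<lambda>\<omega>. P (\<phi> j \<omega>)) \<in> borel_measurable (F (q j))" if "j < n" for j
    using phim[OF that] by measurable
  have psim: "\<psi> j \<in> borel_measurable (F (q j))" if "j < n" for j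
    unfolding \<psi>_def[abs_def] using phim[OF that] chim[OF that] Pphi[OF that] by (cases "j < m") auto
  have t0: "0 \<le> q n" "0 \<le> q 0" "0 \<le> q m" using q st m by auto
  have Cm: "C \<in> borel_measurable M"
    unfolding C_def using m t0 q by (intro measurable_F_M[OF t0(1)] grid_integral_measurable Pphi) auto
  have Qm: "Q \<in> borel_measurable M"
    unfolding Q_def[abs_def] using t0 q by (intro measurable_F_M[OF t0(1)] grid_square_measurable psim) auto
  have Qle: "Q \<omega> \<le> 2 * (LINT r:{0..t}|lborel. (norm (simple_process N p \<xi> r \<omega> - H r \<omega>))\<^sup>2) +
       2 * (LINT r:{0..s}|lborel. (norm (simple_process N' p' \<xi>' r \<omega> - H r \<omega>))\<^sup>2)"
    if w: "\<omega> \<in> space M" for \<omega>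
  proof -
    let ?u = "\<lambda>r. (norm (simple_process N p \<xi> r \<omega> - H r \<omega>))\<^sup>2"
    let ?v = "\<lambda>r. (norm (simple_process N' p' \<xi>' r \<omega> - H r \<omega>))\<^sup>2"
    define g where "g r = 2 * (indicator {0..t} r *\<^sub>R ?u r) + 2 * (indicator {0..s} r *\<^sub>R ?v r)" for r
    have i: "set_integrable lborel {0..t} ?u" "set_integrable lborel {0..s} ?v"
      using Hc[OF w] st by (auto intro!: simple_process_minus_continuous_integrable intro: continuous_on_subset)
    have "Q \<omega> \<le> (\<integral>r. g r \<partial>lborel)"
      unfolding Q_def
    proof (rule grid_sum_le_integral[OF q(1)])
      show "integrable lborel g" using i unfolding g_def set_integrable_def by auto
      show "0 \<le> g r" for r by (simp add: g_def)
      fix j r assume j: "j < n" and r: "q j < r" "r \<le> q (Suc j)"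
      have r0: "0 \<le> r" "r \<le> t"
        using monoD[OF q(1), of 0 j] monoD[OF q(1), of "Suc j" n] j r q by auto
      have e: "\<phi> j \<omega> = simple_process N p \<xi> r \<omega>" "\<zeta> j \<omega> = simple_process N' p' \<xi>' r \<omega>"
        unfolding \<phi>_def \<zeta>_def
        by (rule simple_process_constant_on_grid[OF q(2) ref(1) j r, symmetric],
            rule simple_process_constant_on_grid[OF q(2) ref(2) j r, symmetric])
      show "(norm (\<psi> j \<omega>))\<^sup>2 \<le> g r"
      proof (cases "j < m")
        case True
        then have "r \<le> s" using monoD[OF q(1), of "Suc j" m] r m by auto
        have "norm (\<psi> j \<omega>) \<le> norm (\<phi> j \<omega> - H r \<omega>) + norm (\<zeta> j \<omega> - H r \<omega>)"
          using True norm_triangle_ineq4[of "\<phi> j \<omega> - H r \<omega>" "\<zeta> j \<omega> - H r \<omega>"] by (simp add: \<psi>_def)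
        then have "(norm (\<psi> j \<omega>))\<^sup>2 \<le> (norm (\<phi> j \<omega> - H r \<omega>) + norm (\<zeta> j \<omega> - H r \<omega>))\<^sup>2"
          by (intro power_mono) auto
        also have "\<dots> \<le> 2 * (norm (\<phi> j \<omega> - H r \<omega>))\<^sup>2 + 2 * (norm (\<zeta> j \<omega> - H r \<omega>))\<^sup>2"
          using sum_squares_bound[of "norm (\<phi> j \<omega> - H r \<omega>)" "norm (\<zeta> j \<omega> - H r \<omega>)"]
          by (simp add: power2_sum)
        finally show ?thesis using r0 \<open>r \<le> s\<close> by (simp add: g_def e)
      next
        case False
        have "(norm (\<psi> j \<omega>))\<^sup>2 \<le> (norm (\<phi> j \<omega> - H r \<omega>))\<^sup>2"
          using False Pd[OF Hb[OF w r0(1)], of "\<phi> j \<omega>"] by (intro power_mono) (auto simp: \<psi>_def)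
        moreover have "g r = 2 * (norm (\<phi> j \<omega> - H r \<omega>))\<^sup>2 + 2 * (indicator {0..s} r *\<^sub>R ?v r)"
          using r0 by (simp add: g_def e)
        moreover have "0 \<le> indicator {0..s} r *\<^sub>R ?v r" "0 \<le> (norm (\<phi> j \<omega> - H r \<omega>))\<^sup>2" by simp_all
        ultimately show ?thesis by linarith
      qed
    qed
    also have "\<dots> = 2 * (LINT r:{0..t}|lborel. ?u r) + 2 * (LINT r:{0..s}|lborel. ?v r)"
      using i unfolding g_def set_lebesgue_integral_def set_integrable_def
      by (subst Bochner_Integration.integral_add) auto
    finally show ?thesis .
  qed
  have R: "?A \<omega> - ?B \<omega> - C \<omega> = grid_integral q \<psi> 0 n \<omega>" for \<omega>
  proof -
    have "?A \<omega> = grid_integral q \<phi> 0 n \<omega>"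
      using simple_integral_on_grid[OF q(2) ref(1) q(3) order.refl sd(1)] q(4) by (simp add: \<phi>_def[abs_def])
    also have "\<dots> = grid_integral q \<phi> 0 m \<omega> + grid_integral q \<phi> m n \<omega>"
      using m by (simp add: grid_integral_concat)
    moreover have "?B \<omega> = grid_integral q \<zeta> 0 m \<omega>"
      using simple_integral_on_grid[OF q(2) ref(2) q(3) m(1) sd(2)] m(2) by (simp add: \<zeta>_def[abs_def])
    ultimately have "?A \<omega> - ?B \<omega> - C \<omega> =
       (grid_integral q \<phi> 0 m \<omega> - grid_integral q \<zeta> 0 m \<omega>) +
       (grid_integral q \<phi> m n \<omega> - grid_integral q (\<lambda>j \<omega>. P (\<phi> j \<omega>)) m n \<omega>)"
      by (simp add: C_def)
    also have "\<dots> = grid_integral q \<psi> 0 m \<omega> + grid_integral q \<psi> m n \<omega>"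
      unfolding grid_integral_diff by (intro arg_cong2[of _ _ _ _ "(+)"] grid_integral_cong) (auto simp: \<psi>_def)
    also have "\<dots> = grid_integral q \<psi> 0 n \<omega>" using m by (simp add: grid_integral_concat)
    finally show ?thesis .
  qed
  have tail: "prob {\<omega>\<in>space M. \<epsilon> \<le> v \<bullet> (?A \<omega> - ?B \<omega> - C \<omega>)} \<le>
       exp ((norm v)\<^sup>2 * \<delta> / 2 - \<epsilon>) + prob {\<omega>\<in>space M. \<delta> \<le> Q \<omega>}" for v \<epsilon> \<delta>
    unfolding R Q_def by (rule grid_integral_tail[OF q(1) t0(2) psim]) auto
  have exp: "(\<integral>\<^sup>+\<omega>. Z \<omega> * ennreal (exp (v \<bullet> C \<omega>)) \<partial>M) \<le>
       ennreal (exp (\<theta> * (t - s) / 2 * (norm v)\<^sup>2)) * (\<integral>\<^sup>+\<omega>. Z \<omega> \<partial>M)"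
    if Z: "Z \<in> borel_measurable (F s)" for v Z
  proof -
    let ?R = "\<lambda>\<omega>. \<Sum>j\<in>{m..<n}. (q (Suc j) - q j) * (norm (v v* P (\<phi> j \<omega>)))\<^sup>2"
    let ?k = "\<theta> * (t - s) / 2 * (norm v)\<^sup>2"
    have [measurable]: "Z \<in> borel_measurable M" using Z st by (intro measurable_F_M[of s]) auto
    have [measurable]: "C \<in> borel_measurable M" by (rule Cm)
    have "(\<lambda>\<omega>. v v* P (\<phi> j \<omega>)) \<in> borel_measurable (F (q j))" if "j < n" for j
      using Pphi[OF that] by (rule measurable_vector_matrix_mult)
    then have [measurable]: "?R \<in> borel_measurable M"
      using t0 q by (intro measurable_F_M[OF t0(1)] grid_square_measurable) auto
    have Rle: "?R \<omega> / 2 \<le> ?k" for \<omega>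
    proof -
      have "?R \<omega> \<le> (\<Sum>j\<in>{m..<n}. (q (Suc j) - q j) * (\<theta> * (norm v)\<^sup>2))"
        using PS monoD[OF q(1)] by (intro sum_mono mult_left_mono) (auto simp: row_bounded_def)
      also have "\<dots> = (t - s) * (\<theta> * (norm v)\<^sup>2)"
        using sum_Suc_diff'[OF m(1), of q] m q by (simp add: sum_distrib_right[symmetric])
      finally show ?thesis by (simp add: mult_ac)
    qed
    have "(\<integral>\<^sup>+\<omega>. Z \<omega> * ennreal (exp (v \<bullet> C \<omega>)) \<partial>M) \<le>
        (\<integral>\<^sup>+\<omega>. ennreal (exp ?k) * (Z \<omega> * ennreal (exp (v \<bullet> C \<omega> - ?R \<omega> / 2))) \<partial>M)"
    proof (intro nn_integral_mono)
      fix \<omega>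
      have "ennreal (exp (v \<bullet> C \<omega>)) \<le> ennreal (exp (?k + (v \<bullet> C \<omega> - ?R \<omega> / 2)))"
        using Rle[of \<omega>] by (intro ennreal_leI) simp
      then have "Z \<omega> * ennreal (exp (v \<bullet> C \<omega>)) \<le> Z \<omega> * (ennreal (exp ?k) * ennreal (exp (v \<bullet> C \<omega> - ?R \<omega> / 2)))"
        by (intro mult_left_mono) (simp_all only: exp_add ennreal_mult exp_ge_zero zero_le)
      then show "Z \<omega> * ennreal (exp (v \<bullet> C \<omega>)) \<le> ennreal (exp ?k) * (Z \<omega> * ennreal (exp (v \<bullet> C \<omega> - ?R \<omega> / 2)))"
        by (simp only: mult.left_commute)
    qed
    also have "\<dots> = ennreal (exp ?k) * (\<integral>\<^sup>+\<omega>. Z \<omega> * ennreal (exp (v \<bullet> C \<omega> - ?R \<omega> / 2)) \<partial>M)"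
      by (rule nn_integral_cmult) measurable
    also have "(\<integral>\<^sup>+\<omega>. Z \<omega> * ennreal (exp (v \<bullet> C \<omega> - ?R \<omega> / 2)) \<partial>M) = (\<integral>\<^sup>+\<omega>. Z \<omega> \<partial>M)"
      unfolding C_def using grid_exponential_martingale[OF q(1) t0(3) Pphi _ m(1)] Z m(2) by simp
    finally show ?thesis .
  qed
  show ?thesis using Cm Qm Qle tail exp by (intro exI[of _ C] exI[of _ Q]) blast
qed

text \<open>An integrand bounded by \<open>\<theta>\<close> produces increments whose conditional Laplace transform is dominated
  by that of a Gaussian vector with covariance \<open>\<theta> * (t - s)\<close> times the identity. The bound holds
  for the variables \<open>C\<close> of the preceding lemma, which converge in probability to the increment;
  Fatou's lemma along an almost surely convergent subsequence transfers it to the limit.\<close>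

theorem ito_increment_subgaussian:
  fixes H :: "real \<Rightarrow> 'w \<Rightarrow> real^'n^'m"
  assumes st: "0 \<le> s" "s < t" and th: "\<theta> \<ge> 0"
    and I: "has_ito_integral M F W H t I" and J: "has_ito_integral M F W H s J"
    and Hc: "\<And>\<omega>. \<omega> \<in> space M \<Longrightarrow> continuous_on {0..} (\<lambda>r. H r \<omega>)"
    and Hb: "\<And>r \<omega>. \<omega> \<in> space M \<Longrightarrow> 0 \<le> r \<Longrightarrow> H r \<omega> \<in> row_bounded \<theta>"
    and Z: "Z \<in> borel_measurable (F s)"
  shows "(\<integral>\<^sup>+\<omega>. Z \<omega> * ennreal (exp (v \<bullet> (I \<omega> - J \<omega>))) \<partial>M) \<le>
    ennreal (exp (\<theta> * (t - s) / 2 * (norm v)\<^sup>2)) * (\<integral>\<^sup>+\<omega>. Z \<omega> \<partial>M)"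
proof -
  obtain N p \<xi> where sd: "\<And>k. simple_data M F (N k) (p k) (\<xi> k)"
    and U: "tendsto_in_prob M (\<lambda>k \<omega>. LINT r:{0..t}|lborel. (norm (simple_process (N k) (p k) (\<xi> k) r \<omega> - H r \<omega>))\<^sup>2) (\<lambda>\<omega>. 0)"
    and AI: "tendsto_in_prob M (\<lambda>k. simple_integral W (N k) (p k) (\<xi> k) t) I"
    using I unfolding has_ito_integral_def by blast
  obtain N' p' \<xi>' where sd': "\<And>k. simple_data M F (N' k) (p' k) (\<xi>' k)"
    and V: "tendsto_in_prob M (\<lambda>k \<omega>. LINT r:{0..s}|lborel. (norm (simple_process (N' k) (p' k) (\<xi>' k) r \<omega> - H r \<omega>))\<^sup>2) (\<lambda>\<omega>. 0)"
    and BJ: "tendsto_in_prob M (\<lambda>k. simple_integral W (N' k) (p' k) (\<xi>' k) s) J"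
    using J unfolding has_ito_integral_def by blast
  define A where "A k = simple_integral W (N k) (p k) (\<xi> k) t" for k
  define B where "B k = simple_integral W (N' k) (p' k) (\<xi>' k) s" for k
  define u where "u k \<omega> = (LINT r:{0..t}|lborel. (norm (simple_process (N k) (p k) (\<xi> k) r \<omega> - H r \<omega>))\<^sup>2)" for k \<omega>
  define u' where "u' k \<omega> = (LINT r:{0..s}|lborel. (norm (simple_process (N' k) (p' k) (\<xi>' k) r \<omega> - H r \<omega>))\<^sup>2)" for k \<omega>
  have "\<forall>k. \<exists>C Q. C \<in> borel_measurable M \<and> Q \<in> borel_measurable M \<and>
      (\<forall>\<omega>\<in>space M. Q \<omega> \<le> 2 * u k \<omega> + 2 * u' k \<omega>) \<and>
      (\<forall>v \<epsilon> \<delta>. prob {\<omega>\<in>space M. \<epsilon> \<le> v \<bullet> (A k \<omega> - B k \<omega> - C \<omega>)} \<le>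
         exp ((norm v)\<^sup>2 * \<delta> / 2 - \<epsilon>) + prob {\<omega>\<in>space M. \<delta> \<le> Q \<omega>}) \<and>
      (\<forall>v. \<forall>Z\<in>borel_measurable (F s). (\<integral>\<^sup>+\<omega>. Z \<omega> * ennreal (exp (v \<bullet> C \<omega>)) \<partial>M) \<le>
         ennreal (exp (\<theta> * (t - s) / 2 * (norm v)\<^sup>2)) * (\<integral>\<^sup>+\<omega>. Z \<omega> \<partial>M))"
    (is "\<forall>k. \<exists>C Q. ?Phi k C Q")
  proof
    fix k
    show "\<exists>C Q. ?Phi k C Q"
      unfolding A_def B_def u_def u'_def
      by (rule simple_integral_increment_approximation[OF st th sd[of k] sd'[of k], where H = H]; (rule Hc Hb; assumption))
  qed
  from choice[OF this] obtain C where "\<forall>k. \<exists>Q. ?Phi k (C k) Q" ..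
  from choice[OF this] obtain Q where "\<forall>k. ?Phi k (C k) (Q k)" ..
  then have CQ: "?Phi k (C k) (Q k)" for k ..
  have [measurable]: "C k \<in> borel_measurable M" "Q k \<in> borel_measurable M" for k using CQ by auto
  have [measurable]: "A k \<in> borel_measurable M" "B k \<in> borel_measurable M"
    "u k \<in> borel_measurable M" "u' k \<in> borel_measurable M" for k
    using AI BJ U V by (auto simp: tendsto_in_prob_def A_def B_def u_def[abs_def] u'_def[abs_def])
  have u0: "0 \<le> u k \<omega>" "0 \<le> u' k \<omega>" for k \<omega>
    unfolding u_def u'_def set_lebesgue_integral_def by (auto intro!: integral_nonneg)
  have Q0: "(\<lambda>k. prob {\<omega>\<in>space M. \<delta> \<le> Q k \<omega>}) \<longlonglongrightarrow> 0" if d: "\<delta> > 0" for \<delta>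
  proof (rule Lim_null_comparison)
    let ?U = "\<lambda>k. {\<omega>\<in>space M. \<delta> / 4 \<le> dist (u k \<omega>) 0}"
    let ?U' = "\<lambda>k. {\<omega>\<in>space M. \<delta> / 4 \<le> dist (u' k \<omega>) 0}"
    have d4: "\<delta> / 4 > 0" using d by simp
    have "prob {\<omega>\<in>space M. \<delta> \<le> Q k \<omega>} \<le> prob (?U k) + prob (?U' k)" for k
    proof -
      have "prob {\<omega>\<in>space M. \<delta> \<le> Q k \<omega>} \<le> prob (?U k \<union> ?U' k)"
      proof (rule finite_measure_mono)
        have "\<delta> / 4 \<le> u k \<omega> \<or> \<delta> / 4 \<le> u' k \<omega>" if "\<omega> \<in> space M" "\<delta> \<le> Q k \<omega>" for \<omega>
        proof -
          have "Q k \<omega> \<le> 2 * u k \<omega> + 2 * u' k \<omega>" using CQ that by blast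
          then show ?thesis using that by linarith
        qed
        then show "{\<omega>\<in>space M. \<delta> \<le> Q k \<omega>} \<subseteq> ?U k \<union> ?U' k"
          using u0 by (auto simp: dist_real_def)
      qed measurable
      also have "\<dots> \<le> prob (?U k) + prob (?U' k)"
        by (intro measure_Un_le) measurable
      finally show ?thesis .
    qed
    then show "\<forall>\<^sub>F k in sequentially. norm (prob {\<omega>\<in>space M. \<delta> \<le> Q k \<omega>}) \<le> prob (?U k) + prob (?U' k)"
      by simp
    have "(\<lambda>k. prob (?U k)) \<longlonglongrightarrow> 0" "(\<lambda>k. prob (?U' k)) \<longlonglongrightarrow> 0"
      using U V d4 unfolding tendsto_in_prob_def u_def u'_def by blast+
    from tendsto_add[OF this] show "(\<lambda>k. prob (?U k) + prob (?U' k)) \<longlonglongrightarrow> 0" by simp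
  qed
  have R: "tendsto_in_prob M (\<lambda>k \<omega>. A k \<omega> - B k \<omega> - C k \<omega>) (\<lambda>_. 0)"
    by (rule tendsto_in_prob_of_tail_bound[where Q = Q, OF _ _ Q0]) (use CQ in \<open>auto\<close>)
  obtain r1 where r1: "strict_mono r1" "AE \<omega> in M. (\<lambda>k. A (r1 k) \<omega>) \<longlonglongrightarrow> I \<omega>"
    using tendsto_in_prob_AE_subseq[OF AI] unfolding A_def by blast
  obtain r2 where r2: "strict_mono r2" "AE \<omega> in M. (\<lambda>k. B (r1 (r2 k)) \<omega>) \<longlonglongrightarrow> J \<omega>"
    using tendsto_in_prob_AE_subseq[OF tendsto_in_prob_subseq[OF BJ r1(1)]] unfolding B_def by blast
  have r12: "strict_mono (\<lambda>k. r1 (r2 k))" using r1(1) r2(1) by (simp add: strict_mono_def)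
  obtain r3 where r3: "strict_mono r3"
    "AE \<omega> in M. (\<lambda>k. A (r1 (r2 (r3 k))) \<omega> - B (r1 (r2 (r3 k))) \<omega> - C (r1 (r2 (r3 k))) \<omega>) \<longlonglongrightarrow> 0"
    using tendsto_in_prob_AE_subseq[OF tendsto_in_prob_subseq[OF R r12]] by blast
  define r where "r k = r1 (r2 (r3 k))" for k
  have Clim: "AE \<omega> in M. (\<lambda>k. C (r k) \<omega>) \<longlonglongrightarrow> I \<omega> - J \<omega>"
    using r1(2) r2(2) r3(2)
  proof eventually_elim
    case (elim \<omega>)
    have "strict_mono (\<lambda>k. r2 (r3 k))" using r2(1) r3(1) by (simp add: strict_mono_def)
    from LIMSEQ_subseq_LIMSEQ[OF elim(1) this] have "(\<lambda>k. A (r k) \<omega>) \<longlonglongrightarrow> I \<omega>"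
      by (simp add: comp_def r_def)
    moreover from LIMSEQ_subseq_LIMSEQ[OF elim(2) r3(1)] have "(\<lambda>k. B (r k) \<omega>) \<longlonglongrightarrow> J \<omega>"
      by (simp add: comp_def r_def)
    moreover have "(\<lambda>k. A (r k) \<omega> - B (r k) \<omega> - C (r k) \<omega>) \<longlonglongrightarrow> 0" using elim(3) by (simp add: r_def)
    ultimately have "(\<lambda>k. (A (r k) \<omega> - B (r k) \<omega>) - (A (r k) \<omega> - B (r k) \<omega> - C (r k) \<omega>)) \<longlonglongrightarrow> (I \<omega> - J \<omega>) - 0"
      by (intro tendsto_diff)
    then show ?case by simp
  qed
  have ZM [measurable]: "Z \<in> borel_measurable M" by (rule measurable_F_M[OF st(1) Z])
  show ?thesis
  proof (rule nn_integral_le_of_AE_limit)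
    show "AE \<omega> in M. (\<lambda>k. Z \<omega> * ennreal (exp (v \<bullet> C (r k) \<omega>))) \<longlonglongrightarrow> Z \<omega> * ennreal (exp (v \<bullet> (I \<omega> - J \<omega>)))"
      using Clim
    proof eventually_elim
      case (elim \<omega>)
      have "(\<lambda>k. ennreal (exp (v \<bullet> C (r k) \<omega>))) \<longlonglongrightarrow> ennreal (exp (v \<bullet> (I \<omega> - J \<omega>)))"
        by (intro tendsto_intros elim)
      then show ?case by (rule tendsto_mult_ennreal[OF tendsto_const]) simp
    qed
    show "(\<integral>\<^sup>+\<omega>. Z \<omega> * ennreal (exp (v \<bullet> C (r k) \<omega>)) \<partial>M) \<le>
        ennreal (exp (\<theta> * (t - s) / 2 * (norm v)\<^sup>2)) * (\<integral>\<^sup>+\<omega>. Z \<omega> \<partial>M)" for k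
      using CQ[of "r k"] Z by blast
  qed measurable
qed

end

section \<open>One step of the scheme\<close>

text \<open>The convolution of \<open>sqexp a\<close> with the centred Gaussian law of covariance \<open>\<theta> * h\<close> times the
  identity, evaluated at \<open>x\<close>.\<close>

abbreviation heat_sqexp :: "real \<Rightarrow> real \<Rightarrow> real \<Rightarrow> real^'n \<Rightarrow> real" where
  "heat_sqexp a \<theta> h x \<equiv> exp (a * (norm x)\<^sup>2 / (1 - 2 * a * \<theta> * h)) / sqrt (1 - 2 * a * \<theta> * h) ^ CARD('n)"

lemma exp_le_quadratic: "exp u \<le> 1 + u + u\<^sup>2" if "\<bar>u\<bar> \<le> 1" for u :: real
proof (cases "0 \<le> u")
  case True then show ?thesis using exp_bound[of u] that by simp
next
  case False
  define v where "v = - u"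
  have v: "v > 0" using False by (simp add: v_def)
  have "1 * 1 \<le> (1 - v + v\<^sup>2) * (1 + v)"
    using v by (simp add: algebra_simps power2_eq_square)
  also have "\<dots> \<le> (1 - v + v\<^sup>2) * exp v"
  proof (intro mult_left_mono exp_ge_add_one_self)
    have "0 \<le> (1 - v / 2)\<^sup>2 + 3 / 4 * v\<^sup>2" by (intro add_nonneg_nonneg) auto
    also have "\<dots> = 1 - v + v\<^sup>2" by (simp add: power2_eq_square algebra_simps)
    finally show "0 \<le> 1 - v + v\<^sup>2" .
  qed
  finally have "exp (- v) \<le> 1 - v + v\<^sup>2" by (simp add: exp_minus field_simps)
  then show ?thesis by (simp add: v_def)
qed

text \<open>The factor \<open>a * (K - \<beta> / 2 * y)\<close> bounds the growth rate of \<open>sqexp a\<close> under the dynamics at a point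
  with \<open>(norm x)\<^sup>2 = y\<close>. For \<open>y \<ge> 4 * K / \<beta>\<close> it is at most \<open>- (a * K)\<close>; for smaller \<open>y\<close> it is at
  most \<open>a * K\<close>, while \<open>exp (a * y)\<close> stays below \<open>exp (4 * a / \<beta> * K)\<close>.\<close>

lemma Lyapunov_drift:
  fixes a K \<beta> y :: real
  assumes "a > 0" "K > 0" "\<beta> > 0" "y \<ge> 0"
  shows "exp (a * y) * (a * (K - \<beta> / 2 * y)) \<le> - (a * K) * exp (a * y) + 2 * a * K * exp (4 * a / \<beta> * K)"
proof (cases "4 * K / \<beta> \<le> y")
  case True
  then have "a * (K - \<beta> / 2 * y) \<le> - (a * K)" using assms by (simp add: field_simps)
  then have "exp (a * y) * (a * (K - \<beta> / 2 * y)) \<le> exp (a * y) * (- (a * K))"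
    by (intro mult_left_mono) auto
  also have "\<dots> \<le> - (a * K) * exp (a * y) + 2 * a * K * exp (4 * a / \<beta> * K)"
    using assms by (simp add: mult.commute)
  finally show ?thesis .
next
  case False
  then have y: "a * y \<le> 4 * a / \<beta> * K" using assms by (simp add: field_simps)
  have "exp (a * y) * (a * (K - \<beta> / 2 * y)) \<le> exp (a * y) * (a * K)"
    using assms by (intro mult_left_mono) auto
  also have "\<dots> = - (a * K) * exp (a * y) + 2 * a * K * exp (a * y)" by simp
  also have "\<dots> \<le> - (a * K) * exp (a * y) + 2 * a * K * exp (4 * a / \<beta> * K)"
    using y assms by (intro add_left_mono mult_left_mono) auto
  finally show ?thesis .
qed

text \<open>One step moves the point by \<open>h *\<^sub>R v\<close> and then convolves with a Gaussian law. To first order in \<open>h\<close>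
  the logarithm of the result grows by \<open>h * a\<close> times
  \<open>\<theta> * d + 2 * \<alpha> * norm x - 2 * \<beta> * (norm x)\<^sup>2 + 2 * a * \<theta> * (norm x)\<^sup>2\<close>, where \<open>d\<close> is the dimension.
  The last term is absorbed by half of the dissipation because \<open>a \<le> \<beta> / (2 * \<theta>)\<close>, the linear term by
  another quarter, at the cost of \<open>2 * \<alpha>\<^sup>2 / \<beta>\<close>; this leaves \<open>K - \<beta> / 2 * (norm x)\<^sup>2\<close>. All remainders are
  of order \<open>h\<^sup>2\<close>, uniformly for \<open>norm x \<le> R\<close> and \<open>norm v \<le> C\<close>.\<close>

lemma gaussian_drift_step:
  fixes a \<alpha> \<beta> \<theta> R C :: real
  defines "K \<equiv> \<theta> * real CARD('n) + 2 * \<alpha>\<^sup>2 / \<beta>"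
  assumes pos: "\<alpha> > 0" "\<beta> > 0" "\<theta> > 0" "a > 0" and a: "a \<le> \<beta> / (2 * \<theta>)" and RC: "R \<ge> 0" "C \<ge> 0"
  shows "\<exists>c h0. c \<ge> 0 \<and> h0 > 0 \<and> (\<forall>h (x :: real^'n) v. 0 < h \<longrightarrow> h \<le> h0 \<longrightarrow> norm x \<le> R \<longrightarrow> norm v \<le> C \<longrightarrow>
    x \<bullet> v \<le> \<alpha> * norm x - \<beta> * (norm x)\<^sup>2 \<longrightarrow>
    2 * a * \<theta> * h < 1 \<and> a * K * h \<le> 1 \<and> h \<le> 1 \<and>
    heat_sqexp a \<theta> h (x + h *\<^sub>R v) \<le>
      (1 - a * K * h) * sqexp a x + 2 * a * K * exp (4 * a / \<beta> * K) * h + c * h\<^sup>2)"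
proof -
  let ?d = "real CARD('n)"
  \<comment> \<open>\<open>c0 * h\<^sup>2\<close> collects the second-order terms of the exponent, and \<open>G * h\<close> bounds its increment.\<close>
  define w0 where "w0 = (R + C)\<^sup>2"
  define c0 where "c0 = a * (C\<^sup>2 + 2 * a * \<theta> * (2 * R * C + C\<^sup>2) + 2 * (2 * a * \<theta>)\<^sup>2 * w0) + ?d * (2 * a * \<theta>)\<^sup>2"
  define G where "G = a * (K + \<beta> / 2 * R\<^sup>2) + c0"
  have K: "K > 0" using pos unfolding K_def by (intro add_pos_pos) auto
  have c0: "c0 \<ge> 0" using pos RC unfolding c0_def w0_def by auto
  have G: "G > 0" using pos K c0 unfolding G_def by (intro add_pos_nonneg mult_pos_pos) auto
  define h0 where "h0 = Min {1, 1 / (4 * a * \<theta>), 1 / (a * K), 1 / G}"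
  define c where "c = exp (a * R\<^sup>2) * (c0 + G\<^sup>2)"
  have h0: "h0 > 0" using pos K G by (simp add: h0_def)
  have c: "c \<ge> 0" using c0 by (simp add: c_def)
  show ?thesis
  proof (rule exI[of _ c], rule exI[of _ h0], intro conjI[OF c] conjI[OF h0] allI impI)
    fix h and x v :: "real^'n"
    assume h: "0 < h" "h \<le> h0" and x: "norm x \<le> R" and v: "norm v \<le> C"
      and xv: "x \<bullet> v \<le> \<alpha> * norm x - \<beta> * (norm x)\<^sup>2"
    define z where "z = 2 * a * \<theta> * h"
    define y where "y = (norm x)\<^sup>2"
    define w where "w = (norm (x + h *\<^sub>R v))\<^sup>2"
    have h1: "h \<le> 1" "h \<le> 1 / (4 * a * \<theta>)" "h \<le> 1 / (a * K)" "h \<le> 1 / G"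
      using h(2) unfolding h0_def by auto
    have z: "0 < z" "z \<le> 1 / 2" using h1(2) h pos by (auto simp: z_def field_simps)
    have aKh: "a * K * h \<le> 1" using h1(3) pos K by (simp add: field_simps)
    have hG: "h * G \<le> 1" using h1(4) G by (simp add: field_simps)
    have y: "0 \<le> y" "y \<le> R\<^sup>2" using x by (auto simp: y_def intro: power_mono)
    have hh: "h\<^sup>2 \<le> h" using h h1 by (simp add: power2_eq_square mult_left_le)
    have w_eq: "w = y + 2 * h * (x \<bullet> v) + h\<^sup>2 * (norm v)\<^sup>2"
      unfolding w_def y_def power2_norm_eq_inner
      by (simp add: inner_add_left inner_add_right inner_commute[of v x] power2_eq_square[of h] algebra_simps)
    have v2: "(norm v)\<^sup>2 \<le> C\<^sup>2" using v by (intro power_mono) auto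
    have w1: "w \<le> y + 2 * h * (\<alpha> * norm x - \<beta> * y) + h\<^sup>2 * C\<^sup>2"
      unfolding w_eq using xv h v2 by (intro add_mono mult_left_mono) (auto simp: y_def)
    have xvRC: "x \<bullet> v \<le> R * C"
      using norm_cauchy_schwarz[of x v] mult_mono[OF x v] RC by simp
    have w2: "w \<le> y + h * (2 * R * C + C\<^sup>2)"
    proof -
      have "w \<le> y + 2 * h * (R * C) + h\<^sup>2 * C\<^sup>2"
        unfolding w_eq using xvRC h v2 by (intro add_mono mult_left_mono) auto
      also have "h\<^sup>2 * C\<^sup>2 \<le> h * C\<^sup>2" using hh by (intro mult_right_mono) auto
      finally show ?thesis by (simp add: algebra_simps)
    qed
    have w3: "0 \<le> w" "w \<le> w0"
    proof -
      have "norm (x + h *\<^sub>R v) \<le> norm x + norm (h *\<^sub>R v)" by (rule norm_triangle_ineq)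
      also have "norm (h *\<^sub>R v) \<le> C" using h h1 v mult_mono[of h 1 "norm v" C] by simp
      finally show "w \<le> w0" unfolding w_def w0_def using x by (intro power_mono) auto
    qed (simp add: w_def)
    have inv: "1 / (1 - z) \<le> 1 + z + 2 * z\<^sup>2"
    proof -
      have "1 \<le> (1 + z + 2 * z\<^sup>2) * (1 - z)"
        using z mult_nonneg_nonneg[of "z\<^sup>2" "1 - 2 * z"] by (simp add: algebra_simps power2_eq_square)
      then show ?thesis using z by (simp add: pos_divide_le_eq)
    qed
    have lnz: "- ln (1 - z) \<le> z + 2 * z\<^sup>2"
      using ln_one_minus_pos_lower_bound[of z] z by simp
    have e1: "a * w / (1 - z) \<le> a * (y + 2 * h * (\<alpha> * norm x - \<beta> * y) + 2 * a * \<theta> * h * y) +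
        a * (C\<^sup>2 + 2 * a * \<theta> * (2 * R * C + C\<^sup>2) + 2 * (2 * a * \<theta>)\<^sup>2 * w0) * h\<^sup>2"
    proof -
      have "a * w / (1 - z) = a * (w * (1 / (1 - z)))" by simp
      also have "\<dots> \<le> a * (w * (1 + z + 2 * z\<^sup>2))"
        using inv w3 pos by (intro mult_left_mono) auto
      also have "w * (1 + z + 2 * z\<^sup>2) = w + z * w + 2 * z\<^sup>2 * w" by (simp add: algebra_simps)
      also have "a * (w + z * w + 2 * z\<^sup>2 * w) \<le>
          a * ((y + 2 * h * (\<alpha> * norm x - \<beta> * y) + h\<^sup>2 * C\<^sup>2) + z * (y + h * (2 * R * C + C\<^sup>2)) + 2 * z\<^sup>2 * w0)"
        using w1 w2 w3 z pos by (intro mult_left_mono add_mono) auto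
      also have "\<dots> = a * (y + 2 * h * (\<alpha> * norm x - \<beta> * y) + 2 * a * \<theta> * h * y) +
        a * (C\<^sup>2 + 2 * a * \<theta> * (2 * R * C + C\<^sup>2) + 2 * (2 * a * \<theta>)\<^sup>2 * w0) * h\<^sup>2"
        by (simp add: z_def algebra_simps power2_eq_square)
      finally show ?thesis .
    qed
    have e2: "- (?d / 2 * ln (1 - z)) \<le> a * \<theta> * ?d * h + ?d * (2 * a * \<theta>)\<^sup>2 * h\<^sup>2"
    proof -
      have "?d / 2 * (- ln (1 - z)) \<le> ?d / 2 * (z + 2 * z\<^sup>2)" using lnz by (intro mult_left_mono) auto
      also have "\<dots> = a * \<theta> * ?d * h + ?d * (2 * a * \<theta>)\<^sup>2 * h\<^sup>2"
        by (simp add: z_def field_simps power2_eq_square)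
      finally show ?thesis by simp
    qed
    have e3: "a * (2 * (\<alpha> * norm x - \<beta> * y) + 2 * a * \<theta> * y) + a * \<theta> * ?d \<le> a * (K - \<beta> / 2 * y)"
    proof -
      have "2 * a * \<theta> * y \<le> \<beta> * y" using a pos y by (intro mult_right_mono) (auto simp: field_simps)
      moreover have "2 * \<alpha> * norm x \<le> \<beta> / 2 * y + 2 * \<alpha>\<^sup>2 / \<beta>"
      proof -
        have "0 \<le> \<beta> / 2 * (norm x - 2 * \<alpha> / \<beta>)\<^sup>2" using pos by auto
        also have "\<dots> = \<beta> / 2 * y + 2 * \<alpha>\<^sup>2 / \<beta> - 2 * \<alpha> * norm x"
          using pos by (simp add: y_def power2_diff power_divide field_simps power2_eq_square)
        finally show ?thesis by simp
      qed
      ultimately have "2 * (\<alpha> * norm x - \<beta> * y) + 2 * a * \<theta> * y + \<theta> * ?d \<le> K - \<beta> / 2 * y"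
        unfolding K_def by (simp add: algebra_simps)
      from mult_left_mono[OF this, of a] show ?thesis using pos by (simp add: algebra_simps)
    qed
    define g where "g = a * (K - \<beta> / 2 * y)"
    define u where "u = h * g + c0 * h\<^sup>2"
    have expo: "a * w / (1 - z) - ?d / 2 * ln (1 - z) \<le> a * y + u"
    proof -
      have "a * w / (1 - z) - ?d / 2 * ln (1 - z) \<le>
          a * y + h * (a * (2 * (\<alpha> * norm x - \<beta> * y) + 2 * a * \<theta> * y) + a * \<theta> * ?d) + c0 * h\<^sup>2"
        using e1 e2 by (simp add: c0_def algebra_simps)
      also have "\<dots> \<le> a * y + h * g + c0 * h\<^sup>2"
        using mult_left_mono[OF e3, of h] h unfolding g_def by simp
      finally show ?thesis by (simp add: u_def)
    qed
    have absu: "\<bar>u\<bar> \<le> h * G"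
    proof -
      have "\<bar>g\<bar> \<le> a * (K + \<beta> / 2 * R\<^sup>2)"
      proof -
        have "\<bar>K - \<beta> / 2 * y\<bar> \<le> K + \<beta> / 2 * R\<^sup>2"
        proof -
          have "0 \<le> \<beta> / 2 * y" "\<beta> / 2 * y \<le> \<beta> / 2 * R\<^sup>2"
            using pos y by (auto intro!: mult_left_mono)
          then show ?thesis using K by linarith
        qed
        then show ?thesis unfolding g_def abs_mult using pos by (intro mult_mono) auto
      qed
      then have "h * \<bar>g\<bar> \<le> h * (a * (K + \<beta> / 2 * R\<^sup>2))" using h by (intro mult_left_mono) auto
      moreover have "c0 * h\<^sup>2 \<le> c0 * h" using hh c0 by (intro mult_left_mono) auto
      moreover have "\<bar>u\<bar> \<le> h * \<bar>g\<bar> + c0 * h\<^sup>2"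
        unfolding u_def using abs_triangle_ineq[of "h * g" "c0 * h\<^sup>2"] h c0 by (simp add: abs_mult)
      ultimately show ?thesis by (simp add: G_def algebra_simps)
    qed
    have "exp (a * w / (1 - z)) / sqrt (1 - z) ^ CARD('n) = exp (a * w / (1 - z) - ?d / 2 * ln (1 - z))"
    proof -
      have "sqrt (1 - z) = exp (ln (1 - z) / 2)"
        using z by (simp add: ln_sqrt[symmetric])
      then have "sqrt (1 - z) ^ CARD('n) = exp (?d / 2 * ln (1 - z))"
        by (simp add: exp_of_nat_mult[symmetric])
      then show ?thesis by (simp add: exp_diff)
    qed
    also have "\<dots> \<le> exp (a * y + u)" using expo by simp
    also have "\<dots> = exp (a * y) * exp u" by (simp add: exp_add)
    also have "\<dots> \<le> exp (a * y) * (1 + u + u\<^sup>2)"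
      using absu hG by (intro mult_left_mono exp_le_quadratic) auto
    also have "\<dots> = exp (a * y) + h * (exp (a * y) * g) + exp (a * y) * (c0 * h\<^sup>2 + u\<^sup>2)"
      by (simp add: u_def algebra_simps)
    also have "\<dots> \<le> exp (a * y) + h * (- (a * K) * exp (a * y) + 2 * a * K * exp (4 * a / \<beta> * K)) +
        exp (a * R\<^sup>2) * (c0 * h\<^sup>2 + (h * G)\<^sup>2)"
    proof -
      have "exp (a * y) * g \<le> - (a * K) * exp (a * y) + 2 * a * K * exp (4 * a / \<beta> * K)"
        unfolding g_def using pos K y by (intro Lyapunov_drift) auto
      from mult_left_mono[OF this, of h] h
      have "h * (exp (a * y) * g) \<le> h * (- (a * K) * exp (a * y) + 2 * a * K * exp (4 * a / \<beta> * K))"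
        by simp
      moreover have "exp (a * y) * (c0 * h\<^sup>2 + u\<^sup>2) \<le> exp (a * R\<^sup>2) * (c0 * h\<^sup>2 + (h * G)\<^sup>2)"
      proof (rule mult_mono)
        show "exp (a * y) \<le> exp (a * R\<^sup>2)" using y pos by simp
        have "u\<^sup>2 \<le> (h * G)\<^sup>2" using absu by (metis abs_ge_zero power2_abs power_mono)
        then show "c0 * h\<^sup>2 + u\<^sup>2 \<le> c0 * h\<^sup>2 + (h * G)\<^sup>2" by simp
        show "0 \<le> c0 * h\<^sup>2 + u\<^sup>2" using c0 by simp
      qed simp
      ultimately show ?thesis by linarith
    qed
    also have "\<dots> = (1 - a * K * h) * exp (a * y) + 2 * a * K * exp (4 * a / \<beta> * K) * h + c * h\<^sup>2"
      by (simp add: c_def algebra_simps power_mult_distrib)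
    finally have "heat_sqexp a \<theta> h (x + h *\<^sub>R v) \<le>
      (1 - a * K * h) * sqexp a x + 2 * a * K * exp (4 * a / \<beta> * K) * h + c * h\<^sup>2"
      by (simp add: z_def y_def w_def)
    moreover have "2 * a * \<theta> * h < 1" using z by (simp add: z_def)
    ultimately show "2 * a * \<theta> * h < 1 \<and> a * K * h \<le> 1 \<and> h \<le> 1 \<and>
      heat_sqexp a \<theta> h (x + h *\<^sub>R v) \<le>
      (1 - a * K * h) * sqexp a x + 2 * a * K * exp (4 * a / \<beta> * K) * h + c * h\<^sup>2"
      using aKh h1 by blast
  qed
qed

section \<open>Square-exponential moments along the flow\<close>

lemma closure_rational_unit: "{0..1} \<subseteq> closure ({0<..<1} \<inter> \<rat> :: real set)"
proof -
  have "{0<..<1::real} \<subseteq> closure ({0<..<1} \<inter> \<rat>)"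
    using open_Int_closure_subset[of "{0<..<1::real}" \<rat>] by (simp add: Rats_closure_real)
  then have "closure {0<..<1::real} \<subseteq> closure ({0<..<1} \<inter> \<rat>)" by (intro closure_minimal) auto
  then show ?thesis by simp
qed

lemma integral_minus_left_value_le:
  fixes f :: "real \<Rightarrow> 'b::euclidean_space"
  assumes f: "continuous_on {0..t} f" and st: "0 \<le> s" "s \<le> t"
    and k: "\<And>r. s \<le> r \<Longrightarrow> r \<le> t \<Longrightarrow> norm (f r - f s) \<le> k"
  shows "norm ((LINT r:{0..t}|lborel. f r) - (LINT r:{0..s}|lborel. f r) - (t - s) *\<^sub>R f s) \<le> k * (t - s)"
proof -
  have fi: "set_integrable lborel {0..t} f"
    unfolding set_integrable_def using f by (intro borel_integrable_compact) auto
  then have fi1: "set_integrable lborel {0..s} f" "set_integrable lborel {s<..t} f"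
    by (rule set_integrable_subset; use st in auto)+
  have ci: "set_integrable lborel {s<..t} (\<lambda>_. c)" for c :: 'b
    using st by (auto simp: set_integrable_def intro!: integrable_scaleR_left)
  have "{0..t} = {0..s} \<union> {s<..t}" using st by auto
  then have "(LINT r:{0..t}|lborel. f r) = (LINT r:{0..s}|lborel. f r) + (LINT r:{s<..t}|lborel. f r)"
    using fi1 by (metis (no_types, lifting) set_integral_Un Int_commute disjoint_iff atLeastAtMost_iff greaterThanAtMost_iff not_le)
  moreover have "(LINT r:{s<..t}|lborel. f s) = (t - s) *\<^sub>R f s"
    using st by (simp add: set_lebesgue_integral_def)
  ultimately have "(LINT r:{0..t}|lborel. f r) - (LINT r:{0..s}|lborel. f r) - (t - s) *\<^sub>R f s =
      (LINT r:{s<..t}|lborel. f r - f s)"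
    using fi1(2) ci by (simp add: set_integral_diff)
  also have "norm \<dots> \<le> (LINT r:{s<..t}|lborel. norm (f r - f s))"
    using fi1(2) ci by (intro set_integral_norm_bound set_integral_diff) 
  also have "\<dots> \<le> (LINT r:{s<..t}|lborel. k)"
  proof (rule set_integral_mono)
    show "set_integrable lborel {s<..t} (\<lambda>r. norm (f r - f s))"
      using fi1(2) ci by (intro set_integrable_norm set_integral_diff)
    show "set_integrable lborel {s<..t} (\<lambda>_. k)"
      using st by (auto simp: set_integrable_def)
  qed (use k in auto)
  also have "\<dots> = k * (t - s)" using st by (simp add: set_lebesgue_integral_def)
  finally show ?thesis .
qed

text \<open>Convexity of the exponential function bounds the difference by the derivative at \<open>y\<close>. The
  quadratic term in \<open>e\<close> has a favourable sign, so the estimate holds for errors \<open>e\<close> of any size.\<close>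

lemma exp_norm_sq_le:
  fixes y e :: "'b::real_inner"
  assumes a: "a \<ge> 0" and y: "norm y \<le> R"
  shows "sqexp a y \<le> sqexp a (y - e) + 2 * a * R * exp (a * R\<^sup>2) * norm e"
proof -
  let ?p = "a * (norm y)\<^sup>2" and ?p' = "a * (norm (y - e))\<^sup>2"
  have R: "R \<ge> 0" using y norm_ge_zero order_trans by blast
  have "?p - ?p' = a * (2 * (y \<bullet> e) - (norm e)\<^sup>2)"
    by (simp add: power2_norm_eq_inner inner_diff_left inner_diff_right inner_commute[of e y] algebra_simps)
  also have "\<dots> \<le> a * (2 * (R * norm e))"
  proof (intro mult_left_mono a)
    have "y \<bullet> e \<le> R * norm e"
      using norm_cauchy_schwarz[of y e] mult_right_mono[OF y, of "norm e"] by simp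
    moreover have "0 \<le> (norm e)\<^sup>2" by simp
    ultimately show "2 * (y \<bullet> e) - (norm e)\<^sup>2 \<le> 2 * (R * norm e)" by linarith
  qed
  finally have d: "?p - ?p' \<le> 2 * a * R * norm e" by simp
  have "exp ?p * (1 + (?p' - ?p)) \<le> exp ?p * exp (?p' - ?p)"
    by (intro mult_left_mono exp_ge_add_one_self) auto
  also have "\<dots> = exp ?p'" by (simp add: mult_exp_exp)
  finally have "exp ?p \<le> exp ?p' + exp ?p * (?p - ?p')" by (simp add: algebra_simps)
  also have "exp ?p * (?p - ?p') \<le> exp ?p * (2 * a * R * norm e)" using d by (intro mult_left_mono) auto
  also have "\<dots> \<le> exp (a * R\<^sup>2) * (2 * a * R * norm e)"
    using a y R by (intro mult_right_mono) (auto intro!: mult_left_mono power_mono)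
  finally show ?thesis by (simp add: mult_ac)
qed

text \<open>A discrete Gronwall inequality around the fixed point \<open>m\<close> of the recursion.\<close>

lemma affine_recursion_bound:
  fixes v \<epsilon> :: "nat \<Rightarrow> real"
  assumes q: "0 \<le> q" "q \<le> 1" and e: "\<And>i. 0 \<le> \<epsilon> i"
    and rec: "\<And>i. i < n \<Longrightarrow> v (Suc i) - m \<le> q * (v i - m) + \<epsilon> i"
  shows "v n - m \<le> q ^ n * (v 0 - m) + (\<Sum>i<n. \<epsilon> i)"
  using rec
proof (induction n)
  case (Suc n)
  have "v (Suc n) - m \<le> q * (v n - m) + \<epsilon> n" using Suc.prems by simp
  also have "q * (v n - m) \<le> q * (q ^ n * (v 0 - m) + (\<Sum>i<n. \<epsilon> i))"
    using Suc q by (intro mult_left_mono) auto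
  also have "\<dots> = q ^ Suc n * (v 0 - m) + q * (\<Sum>i<n. \<epsilon> i)" by (simp add: algebra_simps)
  also have "q * (\<Sum>i<n. \<epsilon> i) \<le> 1 * (\<Sum>i<n. \<epsilon> i)"
    using q e by (intro mult_right_mono sum_nonneg) auto
  finally show ?case by simp
qed simp

locale dissipative_sde = filtered_brownian_motion M F W
  for M :: "'w measure" and F and W :: "real \<Rightarrow> 'w \<Rightarrow> real^'n" +
  fixes b :: "real \<Rightarrow> real^'n \<Rightarrow> real^'n" and \<sigma> :: "real \<Rightarrow> real^'n \<Rightarrow> real^'n^'n"
    and X :: "real \<Rightarrow> 'w \<Rightarrow> real^'n" and \<alpha> \<beta> \<theta> :: real
  assumes b_cont: "continuous_on ({0..} \<times> UNIV) (\<lambda>(t, x). b t x)"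
    and \<sigma>_cont: "continuous_on ({0..} \<times> UNIV) (\<lambda>(t, x). \<sigma> t x)"
    and X_adapted: "adapted F X" and X_paths: "continuous_paths M X"
    and X_ito: "\<And>t. 0 \<le> t \<Longrightarrow> has_ito_integral M F W (\<lambda>s \<omega>. \<sigma> s (X s \<omega>)) t
        (\<lambda>\<omega>. X t \<omega> - X 0 \<omega> - (LINT s:{0..t}|lborel. b s (X s \<omega>)))"
    and pos: "\<alpha> > 0" "\<beta> > 0" "\<theta> > 0"
    and b_drift: "\<And>t x. 0 \<le> t \<Longrightarrow> x \<bullet> b t x \<le> \<alpha> * norm x - \<beta> * (norm x)\<^sup>2"
    and \<sigma>_bound: "\<And>t x. 0 \<le> t \<Longrightarrow> \<sigma> t x \<in> row_bounded \<theta>"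
begin

definition drift :: "real \<Rightarrow> 'w \<Rightarrow> real^'n" where
  "drift t \<omega> = (LINT s:{0..t}|lborel. b s (X s \<omega>))"

definition noise :: "real \<Rightarrow> 'w \<Rightarrow> real^'n" where
  "noise t \<omega> = X t \<omega> - X 0 \<omega> - drift t \<omega>"

text \<open>Only paths that stay in a ball up to time \<open>t\<close> are followed. Since \<open>sqexp a\<close> is nonnegative, dropping
  the other paths is harmless for upper bounds, and on the remaining ones the drift is bounded.\<close>

definition confined :: "real \<Rightarrow> real \<Rightarrow> 'w set" where
  "confined R t = {\<omega>\<in>space M. \<forall>s\<in>{0..t}. norm (X s \<omega>) \<le> R}"

lemma X_measurable: "0 \<le> t \<Longrightarrow> X t \<in> borel_measurable (F t)"
  using X_adapted by (auto simp: adapted_def)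

lemma X_measurable_M: "0 \<le> t \<Longrightarrow> X t \<in> borel_measurable M"
  using X_measurable measurable_F_M by blast

lemma noise_measurable: "0 \<le> t \<Longrightarrow> noise t \<in> borel_measurable M"
  using X_ito[of t] unfolding has_ito_integral_def tendsto_in_prob_def noise_def[abs_def] drift_def by auto

lemma X_continuous: "\<omega> \<in> space M \<Longrightarrow> continuous_on {0..} (\<lambda>t. X t \<omega>)"
  using X_paths by (auto simp: continuous_paths_def)

lemma coefficient_along_path_continuous:
  fixes f :: "real \<Rightarrow> real^'n \<Rightarrow> 'c::topological_space"
  assumes "continuous_on ({0..} \<times> UNIV) (\<lambda>(t, x). f t x)" "\<omega> \<in> space M"
  shows "continuous_on {0..} (\<lambda>t. f t (X t \<omega>))"
proof -
  have "continuous_on {0..} (\<lambda>t. (t, X t \<omega>))"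
    by (intro continuous_intros X_continuous assms)
  from continuous_on_compose2[OF assms(1) this] show ?thesis by auto
qed

lemma b_measurable: "0 \<le> t \<Longrightarrow> b t \<in> borel_measurable borel"
proof (rule borel_measurable_continuous_onI)
  assume t: "0 \<le> t"
  have "continuous_on UNIV (\<lambda>x. (\<lambda>(t, x). b t x) (t, x))"
    by (rule continuous_on_compose2[OF b_cont]) (use t in \<open>auto intro!: continuous_intros\<close>)
  then show "continuous_on UNIV (b t)" by simp
qed

text \<open>By continuity of the paths it suffices to inspect the countably many times \<open>r * t\<close> with rational \<open>r\<close>.\<close>

lemma confined_measurable: "0 \<le> t \<Longrightarrow> confined R t \<in> sets (F t)"
proof -
  assume t: "0 \<le> t"
  let ?Q = "{0<..<1} \<inter> \<rat> :: real set"
  have sp: "space (F t) = space M" using subalg[OF t] by (simp add: subalgebra_def)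
  have "confined R t = {\<omega>\<in>space (F t). \<forall>r\<in>?Q. norm (X (r * t) \<omega>) \<le> R}"
  proof (intro set_eqI iffI)
    fix \<omega> assume "\<omega> \<in> confined R t"
    then show "\<omega> \<in> {\<omega>\<in>space (F t). \<forall>r\<in>?Q. norm (X (r * t) \<omega>) \<le> R}"
      using t by (auto simp: confined_def sp mult_left_le_one_le)
  next
    fix \<omega> assume w: "\<omega> \<in> {\<omega>\<in>space (F t). \<forall>r\<in>?Q. norm (X (r * t) \<omega>) \<le> R}"
    then have wM: "\<omega> \<in> space M" by (simp add: sp)
    have "continuous_on {0..} (\<lambda>r. norm (X (r * t) \<omega>))"
      by (intro continuous_on_norm continuous_on_compose2[OF X_continuous[OF wM]] continuous_intros) (use t in auto)
    moreover have "closure ?Q \<subseteq> {0..}" by (rule closure_minimal) auto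
    ultimately have c: "continuous_on (closure ?Q) (\<lambda>r. norm (X (r * t) \<omega>))" using continuous_on_subset by blast
    have "norm (X (r * t) \<omega>) \<le> R" if "r \<in> {0..1}" for r
      using continuous_le_on_closure[OF c, of r R] closure_rational_unit that w by auto
    moreover have "\<exists>r\<in>{0..1}. s = r * t" if "s \<in> {0..t}" for s
      using that by (cases "t = 0") (auto intro!: bexI[of _ "s / t"])
    ultimately have "\<forall>s\<in>{0..t}. norm (X s \<omega>) \<le> R" by metis
    then show "\<omega> \<in> confined R t" using wM by (simp add: confined_def)
  qed
  also have "\<dots> \<in> sets (F t)"
  proof (rule sets.sets_Collect_countable_All')
    show "countable ?Q" using countable_rat by (rule countable_subset[rotated]) auto
    fix r assume r: "r \<in> ?Q"
    have "X (r * t) \<in> borel_measurable (F t)"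
      using r t by (intro measurable_F_mono[OF _ _ X_measurable]) (auto simp: mult_left_le_one_le)
    then show "{\<omega>\<in>space (F t). norm (X (r * t) \<omega>) \<le> R} \<in> sets (F t)" by measurable
  qed
  finally show ?thesis .
qed

lemma confined_sets: "0 \<le> t \<Longrightarrow> confined R t \<in> sets M"
  using confined_measurable subalg[of t] by (auto simp: subalgebra_def)

lemma confined_antimono: "s \<le> t \<Longrightarrow> confined R t \<subseteq> confined R s"
  by (auto simp: confined_def)

text \<open>Written as a Gaussian mixture of exponentials of linear forms, \<open>sqexp a\<close> inherits the domination of
  the noise increment by a Gaussian vector: with \<open>g\<close> fixed, the Laplace transform of the increment
  at \<open>sqrt (2 * a) *\<^sub>R g\<close> is at most \<open>exp (a * \<theta> * (t - s) * (norm g)\<^sup>2)\<close>, and the integral over \<open>g\<close>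
  is explicit.\<close>

lemma noise_increment_square_exponential:
  assumes st: "0 \<le> s" "s < t" and a: "a \<ge> 0" "2 * a * \<theta> * (t - s) < 1"
    and x: "x \<in> borel_measurable (F s)" and A: "A \<in> sets (F s)"
  shows "(\<integral>\<^sup>+\<omega>. indicator A \<omega> * ennreal (sqexp a (x \<omega> + (noise t \<omega> - noise s \<omega>))) \<partial>M) \<le>
    (\<integral>\<^sup>+\<omega>. indicator A \<omega> * ennreal (heat_sqexp a \<theta> (t - s) (x \<omega>)) \<partial>M)"
proof -
  define \<eta> where "\<eta> \<omega> = noise t \<omega> - noise s \<omega>" for \<omega>
  define c where "c = sqrt (2 * a)"
  define k where "k = a * \<theta> * (t - s)"
  have c2: "c\<^sup>2 = 2 * a" using a by (simp add: c_def)
  have [measurable]: "noise t \<in> borel_measurable M" "noise s \<in> borel_measurable M"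
    using noise_measurable st by auto
  have [measurable]: "\<eta> \<in> borel_measurable M" unfolding \<eta>_def[abs_def] by measurable
  have [measurable]: "x \<in> borel_measurable M" by (rule measurable_F_M[OF st(1) x])
  have [measurable]: "A \<in> sets M" using A subalg[OF st(1)] by (auto simp: subalgebra_def)
  let ?V = "\<lambda>\<omega> g. indicator A \<omega> * ennreal (exp (c * ((x \<omega> + \<eta> \<omega>) \<bullet> g)) * gauss_density 1 g)"
  let ?U = "\<lambda>\<omega> g. indicator A \<omega> * ennreal (exp ((c *\<^sub>R x \<omega>) \<bullet> g + k * (norm g)\<^sup>2) * gauss_density 1 g)"
  let ?S = "\<lambda>\<omega>. heat_sqexp a \<theta> (t - s) (x \<omega>)"
  interpret P: pair_sigma_finite M "lborel :: (real^'n) measure"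
    by (intro pair_sigma_finite.intro sigma_finite_measure_axioms sigma_finite_lborel)
  have gm [measurable]: "(\<lambda>g :: real^'n. gauss_density 1 g) \<in> borel_measurable borel" by measurable
  have g0: "0 \<le> gauss_density 1 g" for g :: "real^'n" by (simp add: prod_nonneg)
  have "(\<integral>\<^sup>+\<omega>. indicator A \<omega> * ennreal (sqexp a (x \<omega> + \<eta> \<omega>)) \<partial>M) =
      (\<integral>\<^sup>+\<omega>. (\<integral>\<^sup>+g. ?V \<omega> g \<partial>lborel) \<partial>M)"
    using a by (subst nn_integral_cmult) (auto simp: exp_square_eq_gauss_integral c_def)
  also have "\<dots> = (\<integral>\<^sup>+g. (\<integral>\<^sup>+\<omega>. ?V \<omega> g \<partial>M) \<partial>lborel)"
    by (rule P.Fubini'[symmetric]) measurable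
  also have "\<dots> \<le> (\<integral>\<^sup>+g. (\<integral>\<^sup>+\<omega>. ?U \<omega> g \<partial>M) \<partial>lborel)"
  proof (rule nn_integral_mono)
    fix g :: "real^'n"
    define Z where "Z \<omega> = indicator A \<omega> * ennreal (exp ((c *\<^sub>R x \<omega>) \<bullet> g))" for \<omega>
    have ZF: "Z \<in> borel_measurable (F s)" unfolding Z_def[abs_def] using x A by measurable
    have [measurable]: "Z \<in> borel_measurable M" by (rule measurable_F_M[OF st(1) ZF])
    have sub: "(\<integral>\<^sup>+\<omega>. Z \<omega> * ennreal (exp ((c *\<^sub>R g) \<bullet> \<eta> \<omega>)) \<partial>M) \<le>
        ennreal (exp (\<theta> * (t - s) / 2 * (norm (c *\<^sub>R g))\<^sup>2)) * (\<integral>\<^sup>+\<omega>. Z \<omega> \<partial>M)"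
      unfolding \<eta>_def noise_def drift_def
      using st pos coefficient_along_path_continuous[OF \<sigma>_cont] \<sigma>_bound ZF
      by (intro ito_increment_subgaussian[OF _ _ _ X_ito X_ito]) auto
    have "(\<integral>\<^sup>+\<omega>. ?V \<omega> g \<partial>M) =
       (\<integral>\<^sup>+\<omega>. ennreal (gauss_density 1 g) * (Z \<omega> * ennreal (exp ((c *\<^sub>R g) \<bullet> \<eta> \<omega>))) \<partial>M)"
    proof (intro nn_integral_cong)
      fix \<omega>
      have "exp (c * ((x \<omega> + \<eta> \<omega>) \<bullet> g)) = exp ((c *\<^sub>R x \<omega>) \<bullet> g) * exp ((c *\<^sub>R g) \<bullet> \<eta> \<omega>)"
        by (simp add: mult_exp_exp inner_add_left inner_commute[of g] distrib_left)
      then show "?V \<omega> g =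
          ennreal (gauss_density 1 g) * (Z \<omega> * ennreal (exp ((c *\<^sub>R g) \<bullet> \<eta> \<omega>)))"
        using g0[of g] by (simp only: Z_def ennreal_mult exp_ge_zero mult_nonneg_nonneg mult_ac)
    qed
    also have "\<dots> = ennreal (gauss_density 1 g) * (\<integral>\<^sup>+\<omega>. Z \<omega> * ennreal (exp ((c *\<^sub>R g) \<bullet> \<eta> \<omega>)) \<partial>M)"
      by (rule nn_integral_cmult) measurable
    also have "\<dots> \<le> ennreal (gauss_density 1 g) *
        (ennreal (exp (\<theta> * (t - s) / 2 * (norm (c *\<^sub>R g))\<^sup>2)) * (\<integral>\<^sup>+\<omega>. Z \<omega> \<partial>M))"
      by (intro mult_left_mono sub) simp
    also have "\<theta> * (t - s) / 2 * (norm (c *\<^sub>R g))\<^sup>2 = k * (norm g)\<^sup>2"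
      by (simp add: power_mult_distrib c2 k_def)
    also have "ennreal (gauss_density 1 g) * (ennreal (sqexp k g) * (\<integral>\<^sup>+\<omega>. Z \<omega> \<partial>M)) =
       (\<integral>\<^sup>+\<omega>. (ennreal (gauss_density 1 g) * ennreal (sqexp k g)) * Z \<omega> \<partial>M)"
      by (subst nn_integral_cmult) (auto simp: mult.assoc)
    also have "\<dots> = (\<integral>\<^sup>+\<omega>. ?U \<omega> g \<partial>M)"
      using g0[of g] by (intro nn_integral_cong)
        (simp only: Z_def exp_add ennreal_mult exp_ge_zero mult_nonneg_nonneg mult_ac)
    finally show "(\<integral>\<^sup>+\<omega>. ?V \<omega> g \<partial>M) \<le>
       (\<integral>\<^sup>+\<omega>. ?U \<omega> g \<partial>M)" .
  qed
  also have "\<dots> = (\<integral>\<^sup>+\<omega>. (\<integral>\<^sup>+g. ?U \<omega> g \<partial>lborel) \<partial>M)"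
    by (rule P.Fubini') measurable
  also have "\<dots> = (\<integral>\<^sup>+\<omega>. indicator A \<omega> * ennreal (?S \<omega>) \<partial>M)"
  proof (intro nn_integral_cong)
    fix \<omega>
    have "2 * k * 1\<^sup>2 < 1" using a(2) by (simp add: k_def mult_ac)
    note G = nn_integral_exp_quadratic_gauss[OF zero_less_one this, of "c *\<^sub>R x \<omega>"]
    have q: "1 - 2 * k * 1\<^sup>2 = 1 - 2 * a * \<theta> * (t - s)" by (simp add: k_def mult.assoc)
    have "1\<^sup>2 * (norm (c *\<^sub>R x \<omega>))\<^sup>2 / (2 * (1 - 2 * a * \<theta> * (t - s))) =
        (2 * (a * (norm (x \<omega>))\<^sup>2)) / (2 * (1 - 2 * a * \<theta> * (t - s)))"
      by (simp add: power_mult_distrib c2)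
    also have "\<dots> = a * (norm (x \<omega>))\<^sup>2 / (1 - 2 * a * \<theta> * (t - s))"
      by (rule mult_divide_mult_cancel_left) simp
    finally have e: "1\<^sup>2 * (norm (c *\<^sub>R x \<omega>))\<^sup>2 / (2 * (1 - 2 * a * \<theta> * (t - s))) =
        a * (norm (x \<omega>))\<^sup>2 / (1 - 2 * a * \<theta> * (t - s))" .
    from G
    have "(\<integral>\<^sup>+g. ennreal (exp ((c *\<^sub>R x \<omega>) \<bullet> g + k * (norm g)\<^sup>2) * gauss_density 1 g) \<partial>lborel) =
        ennreal (?S \<omega>)"
      unfolding q e .
    then show "(\<integral>\<^sup>+g. ?U \<omega> g \<partial>lborel) =
       indicator A \<omega> * ennreal (?S \<omega>)"
      by (subst nn_integral_cmult) auto
  qed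
  finally show ?thesis by (simp add: \<eta>_def)
qed

lemma drift_measurable: "0 \<le> t \<Longrightarrow> drift t \<in> borel_measurable M"
proof -
  assume t: "0 \<le> t"
  have [measurable]: "X t \<in> borel_measurable M" "X 0 \<in> borel_measurable M" "noise t \<in> borel_measurable M"
    using t X_measurable_M noise_measurable by auto
  have "drift t = (\<lambda>\<omega>. X t \<omega> - X 0 \<omega> - noise t \<omega>)" by (simp add: noise_def fun_eq_iff)
  then show ?thesis by simp
qed

definition euler_error :: "real \<Rightarrow> real \<Rightarrow> 'w \<Rightarrow> real^'n" where
  "euler_error s t \<omega> = drift t \<omega> - drift s \<omega> - (t - s) *\<^sub>R b s (X s \<omega>)"

lemma euler_error_measurable:
  assumes "0 \<le> s" "s \<le> t"
  shows "euler_error s t \<in> borel_measurable M"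
proof -
  have [measurable]: "drift t \<in> borel_measurable M" "drift s \<in> borel_measurable M"
    "X s \<in> borel_measurable M" "b s \<in> borel_measurable borel"
    using assms drift_measurable X_measurable_M b_measurable by auto
  show ?thesis unfolding euler_error_def[abs_def] by measurable
qed

lemma euler_error_le:
  assumes "\<omega> \<in> space M" "0 \<le> s" "s \<le> t"
    and "\<And>r. s \<le> r \<Longrightarrow> r \<le> t \<Longrightarrow> norm (b r (X r \<omega>) - b s (X s \<omega>)) \<le> k"
  shows "norm (euler_error s t \<omega>) \<le> k * (t - s)"
  unfolding euler_error_def drift_def
  using assms coefficient_along_path_continuous[OF b_cont assms(1)]
  by (intro integral_minus_left_value_le) (auto intro: continuous_on_subset)

definition confined_moment :: "real \<Rightarrow> real \<Rightarrow> real \<Rightarrow> real" where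
  "confined_moment a R t = (\<integral>\<omega>. indicator (confined R t) \<omega> * sqexp a (X t \<omega>) \<partial>M)"

lemma confined_integrable:
  assumes "0 \<le> t" "0 \<le> a"
  shows "integrable M (\<lambda>\<omega>. indicator (confined R t) \<omega> * sqexp a (X t \<omega>))"
proof (rule integrable_const_bound)
  have [measurable]: "X t \<in> borel_measurable M" "confined R t \<in> sets M"
    using assms X_measurable_M confined_sets by auto
  show "(\<lambda>\<omega>. indicator (confined R t) \<omega> * sqexp a (X t \<omega>)) \<in> borel_measurable M"
    by measurable
  show "AE \<omega> in M. norm (indicator (confined R t) \<omega> * sqexp a (X t \<omega>)) \<le> exp (a * R\<^sup>2)"
    using assms by (intro AE_I2)
      (auto simp: indicator_def confined_def intro!: mult_left_mono power_mono)
qed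

lemma confined_moment_nn:
  assumes "0 \<le> t" "0 \<le> a"
  shows "ennreal (confined_moment a R t) =
    (\<integral>\<^sup>+\<omega>. indicator (confined R t) \<omega> * ennreal (sqexp a (X t \<omega>)) \<partial>M)"
  unfolding confined_moment_def using confined_integrable[OF assms]
  by (subst nn_integral_eq_integral[symmetric])
    (auto intro!: nn_integral_cong simp: indicator_def)

text \<open>The solution at time \<open>t\<close> is the Euler step from time \<open>s\<close>, plus the noise increment, plus the Euler
  error of the drift. The error is removed first, by the Lipschitz estimate for \<open>sqexp a\<close> at points of
  the ball. What remains depends on the past only through \<open>X s\<close>, up to the noise, so that the
  indicator of confinement up to time \<open>t\<close> may be enlarged to the one up to time \<open>s\<close> before the noise
  is integrated out.\<close>

lemma confined_moment_step:
  fixes a R C c h :: real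
  defines "K \<equiv> \<theta> * real CARD('n) + 2 * \<alpha>\<^sup>2 / \<beta>"
  defines "E \<equiv> exp (4 * a / \<beta> * K)"
  assumes a: "a > 0" and RC: "R \<ge> 0" "C \<ge> 0" "c \<ge> 0" and st: "0 \<le> s" "s < t"
    and bC: "\<And>r x. s \<le> r \<Longrightarrow> r \<le> t \<Longrightarrow> norm x \<le> R \<Longrightarrow> norm (b r x) \<le> C"
    and h: "h = t - s" "2 * a * \<theta> * h < 1" "a * K * h \<le> 1"
    and step: "\<And>x v :: real^'n. norm x \<le> R \<Longrightarrow> norm v \<le> C \<Longrightarrow> x \<bullet> v \<le> \<alpha> * norm x - \<beta> * (norm x)\<^sup>2 \<Longrightarrow>
      heat_sqexp a \<theta> h (x + h *\<^sub>R v) \<le>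
      (1 - a * K * h) * sqexp a x + 2 * a * K * E * h + c * h\<^sup>2"
  shows "confined_moment a R t \<le> (1 - a * K * h) * confined_moment a R s + 2 * a * K * E * h + c * h\<^sup>2 +
    2 * a * R * exp (a * R\<^sup>2) * (\<integral>\<omega>. indicator (confined R t) \<omega> * norm (euler_error s t \<omega>) \<partial>M)"
proof -
  have K: "K > 0" using pos unfolding K_def by (intro add_pos_pos) auto
  have h0: "h > 0" using st h by simp
  have t0: "0 \<le> t" using st by simp
  define x where "x \<omega> = X s \<omega> + h *\<^sub>R b s (X s \<omega>)" for \<omega>
  define \<eta> where "\<eta> \<omega> = noise t \<omega> - noise s \<omega>" for \<omega>
  define L where "L = 2 * a * R * exp (a * R\<^sup>2)"
  define D where "D = 2 * a * K * E * h + c * h\<^sup>2"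
  have L: "L \<ge> 0" using a RC by (simp add: L_def)
  have D: "D \<ge> 0" using a K RC h0 by (simp add: D_def E_def)
  let ?A = "confined R s" and ?B = "confined R t"
  let ?e = "\<lambda>\<omega>. indicator ?B \<omega> * norm (euler_error s t \<omega>)"
  have xF: "x \<in> borel_measurable (F s)"
  proof -
    have [measurable]: "X s \<in> borel_measurable (F s)" "b s \<in> borel_measurable borel"
      using st X_measurable b_measurable by auto
    show ?thesis unfolding x_def[abs_def] by measurable
  qed
  have [measurable]: "x \<in> borel_measurable M" by (rule measurable_F_M[OF st(1) xF])
  have [measurable]: "noise t \<in> borel_measurable M" "noise s \<in> borel_measurable M"
    "X s \<in> borel_measurable M" "X t \<in> borel_measurable M"
    using noise_measurable X_measurable_M st by auto
  have [measurable]: "\<eta> \<in> borel_measurable M" unfolding \<eta>_def[abs_def] by measurable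
  have [measurable]: "?A \<in> sets M" "?B \<in> sets M" using confined_sets st by auto
  have [measurable]: "euler_error s t \<in> borel_measurable M" using euler_error_measurable st by simp
  have e2C: "norm (euler_error s t \<omega>) \<le> 2 * C * h" if "\<omega> \<in> ?B" for \<omega>
    unfolding h(1)
  proof (rule euler_error_le)
    fix r assume r: "s \<le> r" "r \<le> t"
    have "norm (X r \<omega>) \<le> R" "norm (X s \<omega>) \<le> R" using that r st by (auto simp: confined_def)
    then have "norm (b r (X r \<omega>)) \<le> C" "norm (b s (X s \<omega>)) \<le> C" using bC r by auto
    then show "norm (b r (X r \<omega>) - b s (X s \<omega>)) \<le> 2 * C"
      using norm_triangle_ineq4[of "b r (X r \<omega>)" "b s (X s \<omega>)"] by simp
  qed (use that st in \<open>auto simp: confined_def\<close>)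
  have ei: "integrable M ?e"
  proof (rule integrable_const_bound[of _ "2 * C * h"])
    show "AE \<omega> in M. norm (?e \<omega>) \<le> 2 * C * h"
      using e2C RC h0 by (intro AE_I2) (auto simp: indicator_def)
  qed measurable
  have "ennreal (confined_moment a R t) = (\<integral>\<^sup>+\<omega>. indicator ?B \<omega> * ennreal (sqexp a (X t \<omega>)) \<partial>M)"
    using t0 a by (intro confined_moment_nn) auto
  also have "\<dots> \<le> (\<integral>\<^sup>+\<omega>. indicator ?A \<omega> * ennreal (sqexp a (x \<omega> + \<eta> \<omega>)) + ennreal (L * ?e \<omega>) \<partial>M)"
  proof (rule nn_integral_mono)
    fix \<omega> assume "\<omega> \<in> space M"
    show "indicator ?B \<omega> * ennreal (sqexp a (X t \<omega>)) \<le>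
        indicator ?A \<omega> * ennreal (sqexp a (x \<omega> + \<eta> \<omega>)) + ennreal (L * ?e \<omega>)"
    proof (cases "\<omega> \<in> ?B")
      case True
      then have A: "\<omega> \<in> ?A" using confined_antimono[of s t R] st by auto
      have R: "norm (X t \<omega>) \<le> R" using True t0 by (auto simp: confined_def)
      have "X t \<omega> - euler_error s t \<omega> = x \<omega> + \<eta> \<omega>"
        by (simp add: euler_error_def x_def \<eta>_def noise_def h(1))
      then have "sqexp a (X t \<omega>) \<le> sqexp a (x \<omega> + \<eta> \<omega>) + L * norm (euler_error s t \<omega>)"
        using exp_norm_sq_le[OF _ R, of a "euler_error s t \<omega>"] a by (simp add: L_def)
      then have "ennreal (sqexp a (X t \<omega>)) \<le>
          ennreal (sqexp a (x \<omega> + \<eta> \<omega>)) + ennreal (L * norm (euler_error s t \<omega>))"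
        using L by (subst ennreal_plus[symmetric]) (auto simp del: ennreal_plus intro: ennreal_leI)
      then show ?thesis using True A by simp
    qed simp
  qed
  also have "\<dots> = (\<integral>\<^sup>+\<omega>. indicator ?A \<omega> * ennreal (sqexp a (x \<omega> + \<eta> \<omega>)) \<partial>M) + (\<integral>\<^sup>+\<omega>. ennreal (L * ?e \<omega>) \<partial>M)"
    by (rule nn_integral_add) measurable
  also have "(\<integral>\<^sup>+\<omega>. ennreal (L * ?e \<omega>) \<partial>M) = ennreal (L * (\<integral>\<omega>. ?e \<omega> \<partial>M))"
    using ei L by (subst nn_integral_eq_integral) auto
  also have "(\<integral>\<^sup>+\<omega>. indicator ?A \<omega> * ennreal (sqexp a (x \<omega> + \<eta> \<omega>)) \<partial>M) \<le>
      (\<integral>\<^sup>+\<omega>. indicator ?A \<omega> * ennreal (heat_sqexp a \<theta> h (x \<omega>)) \<partial>M)"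
    unfolding \<eta>_def h(1)
    using st a h xF confined_measurable[OF st(1)] by (intro noise_increment_square_exponential) auto
  also have "\<dots> \<le> (\<integral>\<^sup>+\<omega>. ennreal ((1 - a * K * h) * (indicator ?A \<omega> * sqexp a (X s \<omega>)) + D) \<partial>M)"
  proof (rule nn_integral_mono)
    fix \<omega> assume "\<omega> \<in> space M"
    show "indicator ?A \<omega> * ennreal (heat_sqexp a \<theta> h (x \<omega>)) \<le> ennreal ((1 - a * K * h) * (indicator ?A \<omega> * sqexp a (X s \<omega>)) + D)"
    proof (cases "\<omega> \<in> ?A")
      case True
      then have "norm (X s \<omega>) \<le> R" using st by (auto simp: confined_def)
      then have "heat_sqexp a \<theta> h (x \<omega>) \<le>
          (1 - a * K * h) * sqexp a (X s \<omega>) + D"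
        using step[of "X s \<omega>" "b s (X s \<omega>)"] bC[of s "X s \<omega>"] b_drift[OF st(1), of "X s \<omega>"] st
        by (simp add: x_def D_def)
      then show ?thesis using True by (simp add: ennreal_leI)
    qed simp
  qed
  also have "\<dots> = ennreal ((1 - a * K * h) * confined_moment a R s + D)"
  proof -
    have i: "integrable M (\<lambda>\<omega>. (1 - a * K * h) * (indicator ?A \<omega> * sqexp a (X s \<omega>)))"
      using confined_integrable[OF st(1), of a R] a by (intro integrable_mult_right) auto
    have "(\<integral>\<omega>. (1 - a * K * h) * (indicator ?A \<omega> * sqexp a (X s \<omega>)) + D \<partial>M) =
        (1 - a * K * h) * confined_moment a R s + D"
      using i by (subst Bochner_Integration.integral_add) (auto simp: prob_space confined_moment_def)
    then show ?thesis
      using i h D by (subst nn_integral_eq_integral) auto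
  qed
  finally have "ennreal (confined_moment a R t) \<le>
      ennreal ((1 - a * K * h) * confined_moment a R s + D) + ennreal (L * (\<integral>\<omega>. ?e \<omega> \<partial>M))"
    by (simp add: add_right_mono)
  moreover have "0 \<le> (1 - a * K * h) * confined_moment a R s + D" "0 \<le> L * (\<integral>\<omega>. ?e \<omega> \<partial>M)"
    using h D L by (auto simp: confined_moment_def intro!: add_nonneg_nonneg mult_nonneg_nonneg
        Bochner_Integration.integral_nonneg)
  ultimately have "confined_moment a R t \<le> (1 - a * K * h) * confined_moment a R s + D + L * (\<integral>\<omega>. ?e \<omega> \<partial>M)"
    by (simp add: ennreal_plus[symmetric] del: ennreal_plus)
  then show ?thesis by (simp add: D_def L_def add.assoc)
qed

text \<open>Along each path, \<open>s \<mapsto> b s (X s)\<close> is uniformly continuous on the time interval, so the total error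
  tends to \<open>0\<close> pointwise. On confined paths the drift is at most \<open>C\<close>, so the total error is at
  most \<open>2 * C * T\<close> and dominated convergence applies.\<close>

lemma total_euler_error_tendsto:
  assumes T: "T > 0" and RC: "C \<ge> 0"
    and bC: "\<And>r x. 0 \<le> r \<Longrightarrow> r \<le> T \<Longrightarrow> norm x \<le> R \<Longrightarrow> norm (b r x) \<le> C"
  shows "(\<lambda>n. \<Sum>i<n. \<integral>\<omega>. indicator (confined R (T / n * Suc i)) \<omega> *
      norm (euler_error (T / n * i) (T / n * Suc i) \<omega>) \<partial>M) \<longlonglongrightarrow> 0"
proof -
  let ?p = "\<lambda>n i. T / real n * real i"
  define e where "e n i \<omega> = indicator (confined R (?p n (Suc i))) \<omega> *
      norm (euler_error (?p n i) (?p n (Suc i)) \<omega>)" for n i :: nat and \<omega>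
  have step: "?p n (Suc i) - ?p n i = T / n" for n i :: nat
    by (simp only: of_nat_Suc distrib_left mult_1_right add_diff_cancel_right')
  have tn: "0 \<le> ?p n i" "?p n i \<le> ?p n (Suc i)" for n i :: nat
  proof -
    have p: "0 \<le> T / n" using T by simp
    then show "0 \<le> ?p n i" by (rule mult_nonneg_nonneg) simp
    show "?p n i \<le> ?p n (Suc i)" using step[of n i] p by linarith
  qed
  have tT: "?p n (Suc i) \<le> T" if "i < n" for n i :: nat
  proof -
    have "?p n (Suc i) \<le> T / n * n" using T that by (intro mult_left_mono) auto
    then show ?thesis using that by simp
  qed
  have em [measurable]: "e n i \<in> borel_measurable M" for n i
  proof -
    have [measurable]: "confined R (?p n (Suc i)) \<in> sets M" using confined_sets tn order_trans by blast
    have [measurable]: "euler_error (?p n i) (?p n (Suc i)) \<in> borel_measurable M"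
      using euler_error_measurable tn by blast
    show ?thesis unfolding e_def[abs_def] by measurable
  qed
  have e_le: "e n i \<omega> \<le> k * (T / n)"
    if "\<omega> \<in> space M" "i < n" "k \<ge> 0"
      "\<And>r. ?p n i \<le> r \<Longrightarrow> r \<le> ?p n (Suc i) \<Longrightarrow> \<omega> \<in> confined R (?p n (Suc i)) \<Longrightarrow>
        norm (b r (X r \<omega>) - b (?p n i) (X (?p n i) \<omega>)) \<le> k" for n i k \<omega>
    using euler_error_le[OF that(1) tn, of n i k] that T step[of n i] by (auto simp: e_def indicator_def)
  have e0: "0 \<le> e n i \<omega>" for n i \<omega> by (simp add: e_def)
  have sum_le: "(\<Sum>i<n. e n i \<omega>) \<le> k * T" if "k \<ge> 0" "\<And>i. i < n \<Longrightarrow> e n i \<omega> \<le> k * (T / n)" for n k \<omega>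
  proof -
    have "(\<Sum>i<n. e n i \<omega>) \<le> (\<Sum>i<n. k * (T / n))" using that by (intro sum_mono) auto
    also have "\<dots> \<le> k * T" using that(1) T by (cases "n = 0") auto
    finally show ?thesis .
  qed
  have bound: "e n i \<omega> \<le> (2 * C) * (T / n)" if w: "\<omega> \<in> space M" and i: "i < n" for n i \<omega>
  proof (rule e_le[OF w i])
    fix r assume r: "?p n i \<le> r" "r \<le> ?p n (Suc i)" and conf: "\<omega> \<in> confined R (?p n (Suc i))"
    have r0: "0 \<le> r" "r \<le> T" using r tn[of n i] tT[OF i] by linarith+
    have "norm (X r \<omega>) \<le> R" "norm (X (?p n i) \<omega>) \<le> R"
      using conf r r0 tn[of n i] by (auto simp: confined_def)
    then have "norm (b r (X r \<omega>)) \<le> C" "norm (b (?p n i) (X (?p n i) \<omega>)) \<le> C"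
      using bC r r0 tn[of n i] by auto
    then show "norm (b r (X r \<omega>) - b (?p n i) (X (?p n i) \<omega>)) \<le> 2 * C"
      using norm_triangle_ineq4[of "b r (X r \<omega>)" "b (?p n i) (X (?p n i) \<omega>)"] by simp
  qed (use RC in simp)
  have "(\<lambda>n. \<integral>\<omega>. (\<Sum>i<n. e n i \<omega>) \<partial>M) \<longlonglongrightarrow> (\<integral>\<omega>. 0 \<partial>M)"
  proof (rule integral_dominated_convergence[where w = "\<lambda>_. 2 * C * T"])
    show "AE \<omega> in M. norm (\<Sum>i<n. e n i \<omega>) \<le> 2 * C * T" for n
      using sum_le[of "2 * C" n] bound RC e0 by (intro AE_I2) (simp add: sum_nonneg)
    show "AE \<omega> in M. (\<lambda>n. \<Sum>i<n. e n i \<omega>) \<longlonglongrightarrow> 0"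
    proof (intro AE_I2 LIMSEQ_I)
      fix \<omega> and r :: real assume w: "\<omega> \<in> space M" and r: "0 < r"
      define k where "k = r / (2 * T)"
      have k: "k > 0" using r T by (simp add: k_def)
      let ?f = "\<lambda>t. b t (X t \<omega>)"
      have "continuous_on {0..T} ?f"
        using coefficient_along_path_continuous[OF b_cont w] by (rule continuous_on_subset) auto
      then have "uniformly_continuous_on {0..T} ?f" by (rule compact_uniformly_continuous) simp
      then obtain d where d: "d > 0" "\<And>u v. u \<in> {0..T} \<Longrightarrow> v \<in> {0..T} \<Longrightarrow> dist v u < d \<Longrightarrow> dist (?f v) (?f u) < k"
        unfolding uniformly_continuous_on_def using k by metis
      obtain n0 :: nat where n0: "T / d < n0" using reals_Archimedean2 by blast
      have "(\<Sum>i<n. e n i \<omega>) < r" if "n \<ge> n0" for n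
      proof -
        have "T / d < n" using n0 that by linarith
        then have n: "T / n < d" using d T by (cases "n = 0") (auto simp: field_simps)
        have "e n i \<omega> \<le> k * (T / n)" if i: "i < n" for i
        proof (rule e_le[OF w i])
          fix u assume u: "?p n i \<le> u" "u \<le> ?p n (Suc i)"
          have "u \<in> {0..T}" "?p n i \<in> {0..T}" using u tn[of n i] tT[OF i] by auto
          moreover have "dist u (?p n i) < d" using u step[of n i] n by (auto simp: dist_real_def)
          ultimately have "dist (?f u) (?f (?p n i)) < k" using d(2) by blast
          then show "norm (?f u - ?f (?p n i)) \<le> k" by (simp add: dist_norm)
        qed (use k in simp)
        then have "(\<Sum>i<n. e n i \<omega>) \<le> k * T" using k by (intro sum_le) auto
        also have "k * T = r / 2" using T by (simp add: k_def)
        finally show ?thesis using r by simp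
      qed
      then show "\<exists>n0. \<forall>n\<ge>n0. norm ((\<Sum>i<n. e n i \<omega>) - 0) < r"
        using e0 by (intro exI[of _ n0]) (simp add: sum_nonneg)
    qed
  qed simp_all
  moreover have "(\<integral>\<omega>. (\<Sum>i<n. e n i \<omega>) \<partial>M) = (\<Sum>i<n. \<integral>\<omega>. e n i \<omega> \<partial>M)" for n
  proof (rule Bochner_Integration.integral_sum)
    fix i assume "i \<in> {..<n}"
    then show "integrable M (e n i)"
      using bound[of _ i n] e0 by (intro integrable_const_bound[of _ "2 * C * (T / n)"] AE_I2) auto
  qed
  ultimately show ?thesis by (simp add: e_def[abs_def])
qed

text \<open>The one-step bound is iterated over \<open>n\<close> steps of length \<open>T / n\<close>. The second-order terms add up to
  \<open>c * T\<^sup>2 / n\<close>, the Euler errors vanish in the limit, and the contraction factors multiply to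
  \<open>(1 - a * K * T / n) ^ n\<close>, which tends to \<open>exp (- (a * K * T))\<close>.\<close>

theorem confined_moment_le:
  fixes a :: real
  defines "K \<equiv> \<theta> * real CARD('n) + 2 * \<alpha>\<^sup>2 / \<beta>"
  defines "E \<equiv> exp (4 * a / \<beta> * K)"
  assumes a: "0 < a" "a \<le> \<beta> / (2 * \<theta>)" and R: "R \<ge> 0" and T: "T > 0"
  shows "confined_moment a R T - 2 * E \<le> exp (- (a * K * T)) * (confined_moment a R 0 - 2 * E)"
proof -
  have "compact ((\<lambda>(t, x). b t x) ` ({0..T} \<times> cball 0 R))"
    by (intro compact_continuous_image compact_Times continuous_on_subset[OF b_cont]) auto
  then obtain C where C: "\<forall>y\<in>(\<lambda>(t, x). b t x) ` ({0..T} \<times> cball 0 R). norm y \<le> C"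
    using compact_imp_bounded bounded_iff by metis
  have bC: "norm (b r x) \<le> C" if "0 \<le> r" "r \<le> T" "norm x \<le> R" for r x
    using C that by force
  have C0: "C \<ge> 0" by (rule order_trans[OF norm_ge_zero bC[of 0 0]]) (use R T in auto)
  obtain c h0 where c: "c \<ge> 0" and h0: "h0 > 0" and gd: "\<And>h (x :: real^'n) v. 0 < h \<Longrightarrow> h \<le> h0 \<Longrightarrow> norm x \<le> R \<Longrightarrow> norm v \<le> C \<Longrightarrow>
    x \<bullet> v \<le> \<alpha> * norm x - \<beta> * (norm x)\<^sup>2 \<Longrightarrow>
    2 * a * \<theta> * h < 1 \<and> a * K * h \<le> 1 \<and> h \<le> 1 \<and>
    heat_sqexp a \<theta> h (x + h *\<^sub>R v) \<le>
      (1 - a * K * h) * sqexp a x + 2 * a * K * E * h + c * h\<^sup>2"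
    using gaussian_drift_step[OF pos a R C0, where 'n = 'n] unfolding K_def[symmetric] E_def[symmetric] by blast
  define L where "L = 2 * a * R * exp (a * R\<^sup>2)"
  define \<epsilon> where "\<epsilon> n i = (\<integral>\<omega>. indicator (confined R (T / n * Suc i)) \<omega> *
      norm (euler_error (T / n * i) (T / n * Suc i) \<omega>) \<partial>M)" for n i :: nat
  have eps0: "0 \<le> \<epsilon> n i" for n i unfolding \<epsilon>_def by (intro Bochner_Integration.integral_nonneg) auto
  have L: "L \<ge> 0" using a R by (simp add: L_def)
  define f where "f n = (1 + (- (a * K * T)) / n) ^ n * (confined_moment a R 0 - 2 * E) +
      (c * T\<^sup>2 / n + L * (\<Sum>i<n. \<epsilon> n i))" for n :: nat
  have ev: "confined_moment a R T - 2 * E \<le> f n" if n: "T / h0 < n" for n :: nat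
  proof -
    have n0: "n > 0" using n T h0 by (metis divide_pos_pos less_trans of_nat_0_less_iff)
    define h where "h = T / n"
    have h: "0 < h" "h \<le> h0" using n n0 T h0 by (auto simp: h_def field_simps)
    have cond: "2 * a * \<theta> * h < 1" "a * K * h \<le> 1"
      using gd[OF h, of 0 0] R C0 by auto
    have rec: "confined_moment a R (h * Suc i) - 2 * E \<le>
        (1 - a * K * h) * (confined_moment a R (h * i) - 2 * E) + (c * h\<^sup>2 + L * \<epsilon> n i)" if i: "i < n" for i
    proof -
      have "h * Suc i \<le> h * n" using h i by (intro mult_left_mono) auto
      then have hT: "h * Suc i \<le> T" using n0 by (simp add: h_def)
      have hi: "0 \<le> h * i" "h * i < h * Suc i" using h by auto
      have "confined_moment a R (h * Suc i) \<le> (1 - a * K * h) * confined_moment a R (h * i) +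
          2 * a * K * E * h + c * h\<^sup>2 + L * \<epsilon> n i"
        unfolding L_def \<epsilon>_def h_def[symmetric]
      proof (rule confined_moment_step[OF a(1) R C0 c hi, folded K_def, folded E_def])
        show "norm (b r x) \<le> C" if "h * i \<le> r" "r \<le> h * Suc i" "norm x \<le> R" for r x
          using that hi hT by (intro bC) linarith+
        show "h = h * real (Suc i) - h * real i" by (simp add: algebra_simps)
      qed (use cond gd[OF h] in blast)+
      then show ?thesis by (simp add: algebra_simps)
    qed
    have "confined_moment a R (h * n) - 2 * E \<le>
        (1 - a * K * h) ^ n * (confined_moment a R (h * real 0) - 2 * E) + (\<Sum>i<n. c * h\<^sup>2 + L * \<epsilon> n i)"
    proof (rule affine_recursion_bound[where v = "\<lambda>i. confined_moment a R (h * real i)"])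
      have "0 \<le> a * K * h" using h a pos by (auto simp: K_def)
      then show "0 \<le> 1 - a * K * h" "1 - a * K * h \<le> 1" using cond by auto
    qed (use rec eps0 c L in auto)
    also have "h * n = T" using n0 by (simp add: h_def)
    also have "(\<Sum>i<n. c * h\<^sup>2 + L * \<epsilon> n i) = c * T\<^sup>2 / n + L * (\<Sum>i<n. \<epsilon> n i)"
      using n0 by (simp add: sum.distrib sum_distrib_left h_def power2_eq_square)
    also have "1 - a * K * h = 1 + (- (a * K * T)) / n" by (simp add: h_def)
    finally show ?thesis by (simp add: f_def)
  qed
  have "f \<longlonglongrightarrow> exp (- (a * K * T)) * (confined_moment a R 0 - 2 * E) + (0 + L * 0)"
    unfolding f_def
  proof (intro tendsto_add tendsto_mult tendsto_const tendsto_exp_limit_sequentially)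
    show "(\<lambda>n. c * T\<^sup>2 / real n) \<longlonglongrightarrow> 0" by (rule lim_const_over_n)
    show "(\<lambda>n. \<Sum>i<n. \<epsilon> n i) \<longlonglongrightarrow> 0"
      unfolding \<epsilon>_def by (rule total_euler_error_tendsto[OF T C0 bC])
  qed
  moreover have "\<forall>\<^sub>F n in sequentially. confined_moment a R T - 2 * E \<le> f n"
  proof -
    obtain n0 :: nat where "T / h0 < n0" using reals_Archimedean2 by blast
    then have "\<forall>n\<ge>n0. confined_moment a R T - 2 * E \<le> f n" using ev by (meson less_le_trans of_nat_le_iff)
    then show ?thesis by (auto simp: eventually_sequentially)
  qed
  ultimately show ?thesis using tendsto_lowerbound[of f _ sequentially] by fastforce
qed

text \<open>The bound for confined paths does not depend on the radius \<open>R\<close>. Every path is bounded on compact time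
  intervals, hence confined for large \<open>R\<close>, and Fatou's lemma removes the confinement.\<close>

theorem square_exponential_moment_le:
  fixes a B :: real
  defines "K \<equiv> \<theta> * real CARD('n) + 2 * \<alpha>\<^sup>2 / \<beta>"
  defines "E \<equiv> exp (4 * a / \<beta> * K)"
  assumes a: "0 < a" "a \<le> \<beta> / (2 * \<theta>)" and T: "T \<ge> 0" and B: "B \<ge> 0"
    and init: "(\<integral>\<^sup>+\<omega>. ennreal (sqexp a (X 0 \<omega>)) \<partial>M) \<le> ennreal B"
  shows "(\<integral>\<^sup>+\<omega>. ennreal (sqexp a (X T \<omega>)) \<partial>M) \<le>
    ennreal (B * exp (- (a * K * T)) + 2 * E * (1 - exp (- (a * K * T))))"
proof (cases "T = 0")
  case True then show ?thesis using init by simp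
next
  case False
  let ?r = "exp (- (a * K * T))"
  have T0: "T > 0" using T False by simp
  have v0: "confined_moment a R 0 \<le> B" for R
  proof -
    have "ennreal (confined_moment a R 0) \<le> (\<integral>\<^sup>+\<omega>. ennreal (sqexp a (X 0 \<omega>)) \<partial>M)"
      using a by (subst confined_moment_nn) (auto intro!: nn_integral_mono simp: indicator_def)
    also have "\<dots> \<le> ennreal B" by (rule init)
    finally show ?thesis using B by simp
  qed
  have vT: "confined_moment a R T \<le> B * ?r + 2 * E * (1 - ?r)" if "R \<ge> 0" for R
  proof -
    have "confined_moment a R T \<le> 2 * E + ?r * (confined_moment a R 0 - 2 * E)"
      using confined_moment_le[OF a that T0] unfolding K_def E_def by simp
    also have "\<dots> \<le> 2 * E + ?r * (B - 2 * E)" using v0 by (intro add_left_mono mult_left_mono) auto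
    also have "\<dots> = B * ?r + 2 * E * (1 - ?r)" by (simp add: algebra_simps)
    finally show ?thesis .
  qed
  have [measurable]: "X T \<in> borel_measurable M" "confined R T \<in> sets M" for R
    using X_measurable_M confined_sets T by auto
  show ?thesis
  proof (rule nn_integral_le_of_AE_limit[OF _ AE_I2])
    show "(\<integral>\<^sup>+\<omega>. indicator (confined (real k) T) \<omega> * ennreal (sqexp a (X T \<omega>)) \<partial>M) \<le>
        ennreal (B * ?r + 2 * E * (1 - ?r))" for k
      using vT[of "real k"] T a by (simp add: confined_moment_nn[symmetric] ennreal_leI)
    fix \<omega> assume w: "\<omega> \<in> space M"
    have "bounded ((\<lambda>t. X t \<omega>) ` {0..T})"
      by (intro compact_imp_bounded compact_continuous_image continuous_on_subset[OF X_continuous[OF w]]) auto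
    then obtain k0 where k0: "\<forall>y\<in>(\<lambda>t. X t \<omega>) ` {0..T}. norm y \<le> k0" using bounded_iff by blast
    obtain m :: nat where m: "k0 \<le> m" using real_arch_simple by blast
    have "\<omega> \<in> confined (real k) T" if "k \<ge> m" for k
      using w k0 m that by (fastforce simp: confined_def)
    then have "\<forall>\<^sub>F k in sequentially. ennreal (sqexp a (X T \<omega>)) =
        indicator (confined (real k) T) \<omega> * ennreal (sqexp a (X T \<omega>))"
      unfolding eventually_sequentially by (intro exI[of _ m]) simp
    then show "(\<lambda>k. indicator (confined (real k) T) \<omega> * ennreal (sqexp a (X T \<omega>))) \<longlonglongrightarrow>
        ennreal (sqexp a (X T \<omega>))"
      by (rule Lim_transform_eventually[OF tendsto_const])
  qed measurable
qed

end

theorem theorem5p3: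
  fixes M :: "'w measure" and F :: "real \<Rightarrow> 'w measure"
    and W X :: "real \<Rightarrow> 'w \<Rightarrow> real^'n"
    and b :: "real \<Rightarrow> real^'n \<Rightarrow> real^'n"
    and \<sigma> :: "real \<Rightarrow> real^'n \<Rightarrow> real^'n^'n"
    and \<mu>\<^sub>0 :: "(real^'n) measure"
    and \<alpha> \<beta> \<theta> D\<^sub>0 a\<^sub>0 b\<^sub>0 d :: real
    and bb DD :: "real \<Rightarrow> real"
  assumes "continuous_on ({0..} \<times> UNIV) (\<lambda>(t, x). b t x)"
    and "continuous_on ({0..} \<times> UNIV) (\<lambda>(t, x). \<sigma> t x)"
    and "locally_lipschitz_coeffs b \<sigma>"
    and "non_explosion_coeffs b \<sigma>"
    and "sde_solution M F W b \<sigma> X"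
    and "\<alpha> > 0" and "\<beta> > 0" and "\<theta> > 0"
    and "\<And>t x. t \<ge> 0 \<Longrightarrow> x \<bullet> b t x \<le> \<alpha> * norm x - \<beta> * (norm x)\<^sup>2"
    and "\<And>t x. t \<ge> 0 \<Longrightarrow> loewner_le (\<sigma> t x ** transpose (\<sigma> t x)) (\<theta> *\<^sub>R mat 1)"
    and "distr M borel (X 0) = \<mu>\<^sub>0"
    and "D\<^sub>0 > 0" and "GCBS \<mu>\<^sub>0 D\<^sub>0"
    and "d = real CARD('n)"
    and "a\<^sub>0 = min (\<beta> / (2 * \<theta>)) (1 / (16 * D\<^sub>0))"
    and "b\<^sub>0 = 3 * exp ((\<integral>x. norm x \<partial>\<mu>\<^sub>0)\<^sup>2 / (8 * D\<^sub>0))"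
    and "\<And>t. bb t =
           b\<^sub>0 * exp (- a\<^sub>0 * (\<theta> * d + 2 * \<alpha>\<^sup>2 / \<beta>) * t) +
           2 * exp (4 * a\<^sub>0 / \<beta> * (\<theta> * d + 2 * \<alpha>\<^sup>2 / \<beta>)) *
             (1 - exp (- a\<^sub>0 * (\<theta> * d + 2 * \<alpha>\<^sup>2 / \<beta>) * t))"
    and "\<And>t. DD t = (bb t)\<^sup>2 * exp 1 / (2 * a\<^sub>0 * sqrt pi)"
  shows "\<forall>t\<ge>0. GCB (distr M borel (X t)) (DD t)"
proof (intro allI impI)
  fix t :: real assume t: "0 \<le> t"
  note hyps = assms
  note sol = hyps(5)[unfolded sde_solution_def]
  interpret prob_space M using sol by blast
  have "dissipative_sde M F W b \<sigma> X \<alpha> \<beta> \<theta>"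
  proof (intro dissipative_sde.intro filtered_brownian_motion.intro filtered_brownian_motion_axioms.intro
      dissipative_sde_axioms.intro)
    fix s x assume s: "(0 :: real) \<le> s"
    show "\<sigma> s x \<in> row_bounded \<theta>"
      using hyps(10)[OF s] by (rule row_bounded_of_loewner_le)
  qed (use sol hyps in blast)+
  then interpret dissipative_sde M F W b \<sigma> X \<alpha> \<beta> \<theta> .
  define K where "K = \<theta> * d + 2 * \<alpha>\<^sup>2 / \<beta>"
  have a: "0 < a\<^sub>0" "a\<^sub>0 \<le> \<beta> / (2 * \<theta>)" "a\<^sub>0 \<le> 1 / (16 * D\<^sub>0)"
    using hyps(7,8,12,15) by auto
  have X0 [measurable]: "X 0 \<in> borel_measurable M" and Xt [measurable]: "X t \<in> borel_measurable M"
    using X_measurable_M t by auto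
  have "prob_space \<mu>\<^sub>0" using prob_space_distr[OF X0] hyps(11) by simp
  moreover have "sets \<mu>\<^sub>0 = sets borel" using hyps(11) by auto
  ultimately have "(\<integral>\<^sup>+x. ennreal (sqexp a\<^sub>0 x) \<partial>\<mu>\<^sub>0) \<le> ennreal b\<^sub>0"
    using hyps(12,13) a unfolding hyps(16) by (intro GCBS_square_exponential_moment) auto
  then have init: "(\<integral>\<^sup>+\<omega>. ennreal (sqexp a\<^sub>0 (X 0 \<omega>)) \<partial>M) \<le> ennreal b\<^sub>0"
    unfolding hyps(11)[symmetric] by (subst (asm) nn_integral_distr) auto
  have "b\<^sub>0 \<ge> 0" unfolding hyps(16) by simp
  from square_exponential_moment_le[OF a(1,2) t this init]
  have "(\<integral>\<^sup>+\<omega>. ennreal (sqexp a\<^sub>0 (X t \<omega>)) \<partial>M) \<le> ennreal (bb t)"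
    unfolding hyps(17) hyps(14)[symmetric] by simp
  then have moment: "(\<integral>\<^sup>+x. ennreal (sqexp a\<^sub>0 x) \<partial>distr M borel (X t)) \<le> ennreal (bb t)"
    by (subst nn_integral_distr) auto
  show "GCB (distr M borel (X t)) (DD t)"
  proof (rule GCB_of_square_exponential_moment[OF prob_space_distr[OF Xt] _ a(1) moment])
    \<comment> \<open>Comparison of the constant \<open>exp (- 1/2)\<close> with \<open>exp 1 / (2 * sqrt pi)\<close>, through
      \<open>4 * pi \<le> 16 \<le> exp 3\<close>.\<close>
    have "2 * sqrt pi \<le> exp (3/2)"
    proof (rule power2_le_imp_le)
      have "(2 * sqrt pi)\<^sup>2 = 4 * pi" by (simp add: power_mult_distrib)
      also have "\<dots> \<le> 16" using pi_less_4 by simp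
      also have "\<dots> \<le> (1 + 1/2 + (1/2)\<^sup>2 / 2) ^ 6" by (simp add: power2_eq_square eval_nat_numeral)
      also have "\<dots> \<le> exp (1/2) ^ 6" by (intro power_mono exp_lower_Taylor_quadratic) auto
      also have "\<dots> = (exp (3/2))\<^sup>2" by (simp add: exp_of_nat_mult[symmetric])
      finally show "(2 * sqrt pi)\<^sup>2 \<le> (exp (3/2))\<^sup>2" .
    qed simp
    then have "2 * sqrt pi * exp (- 1/2) \<le> exp (3/2) * exp (- 1/2)" by (intro mult_right_mono) auto
    then have "exp (- 1/2) \<le> exp 1 / (2 * sqrt pi)" by (simp add: mult_exp_exp field_simps)
    then have "(bb t)\<^sup>2 / a\<^sub>0 * exp (- 1/2) \<le> (bb t)\<^sup>2 / a\<^sub>0 * (exp 1 / (2 * sqrt pi))"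
      using a by (intro mult_left_mono) auto
    then show "(bb t)\<^sup>2 * exp (- 1/2) / a\<^sub>0 \<le> DD t" by (simp add: hyps(18) mult_ac)
  qed simp
qed

end
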